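(* Let $n\in\mathbb{N}$. The natural fibration $\pi \colon \Omega_n \to \mathbb{G}_n$ of the spectral ball over the symmetrized polydisc has the fibred density property.
   Context: The spectral ball is $\Omega_n=\{A\in \mathrm{Mat}(n\times n;\mathbb{C}) : \rho(A)<1\}$, where $\rho(A)$ is the spectral radius. The symmetrized polydisc is $\mathbb{G}_n=(\sigma_1,\dots,\sigma_n)(\mathbb{D}^n)\subset\mathbb{C}^n$, where $\sigma_1,\dots,\sigma_n$ are the elementary symmetric polynomials in $n$ variables and $\mathbb{D}$ is the open unit disc. The map $\pi=(\pi_1,\dots,\pi_n)$ sends a matrix to the elementary symmetric polynomials of its eigenvalues, i.e. $\chi_A(\lambda)=\lambda^n+\sum_{j=1}^n(-1)^j\pi_j(A)\lambda^{n-j}$ for the characteristic polynomial $\chi_A$. A holomorphic surjection $p\colon X\to Y$ between complex manifolds is called a holomorphic fibration. It has the fibred density property if the Lie algebra generated by all $\mathbb{C}$-complete holomorphic vector fields on $X$ (those whose flow exists for all complex times) that are tangent to the fibres of $p$ (i.e. $dp(\Theta)=0$) is dense, with respect to the compact-open topology, in the Lie algebra of all holomorphic vector fields on $X$ tangent to the fibres of $p$. *)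

theory Defs
  imports "HOL-Analysis.Analysis" "HOL-Computational_Algebra.Polynomial"
begin

section \<open>Complex normed spaces and holomorphic maps between open subsets\<close>

class complex_normed_space = real_normed_vector +
  fixes scaleC :: "complex \<Rightarrow> 'a \<Rightarrow> 'a"  (infixr \<open>*\<^sub>C\<close> 75)
  assumes scaleC_add_right: "a *\<^sub>C (x + y) = a *\<^sub>C x + a *\<^sub>C y"
    and scaleC_add_left: "(a + b) *\<^sub>C x = a *\<^sub>C x + b *\<^sub>C x"
    and scaleC_scaleC: "a *\<^sub>C b *\<^sub>C x = (a * b) *\<^sub>C x"
    and scaleC_of_real: "complex_of_real r *\<^sub>C x = r *\<^sub>R x"
    and norm_scaleC: "norm (a *\<^sub>C x) = cmod a * norm x"

instantiation complex :: complex_normed_space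
begin

definition scaleC_complex :: "complex \<Rightarrow> complex \<Rightarrow> complex"
  where "scaleC_complex a x = a * x"

instance
  by standard (auto simp: scaleC_complex_def algebra_simps norm_mult scaleR_conv_of_real)

end

instantiation vec :: (complex_normed_space, finite) complex_normed_space
begin

definition scaleC_vec :: "complex \<Rightarrow> 'a ^ 'b \<Rightarrow> 'a ^ 'b"
  where "scaleC_vec a x = (\<chi> i. a *\<^sub>C (x $ i))"

instance
proof
  fix a :: complex and x :: "'a ^ 'b"
  have "norm (a *\<^sub>C x) = L2_set (\<lambda>i. cmod a * norm (x $ i)) UNIV"
    by (simp add: norm_vec_def scaleC_vec_def norm_scaleC)
  also have "\<dots> = cmod a * norm x"
    by (simp add: norm_vec_def L2_set_right_distrib)
  finally show "norm (a *\<^sub>C x) = cmod a * norm x" .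
qed (auto simp: scaleC_vec_def vec_eq_iff scaleC_add_right scaleC_add_left scaleC_scaleC
       scaleC_of_real)

end

definition complex_linear_map :: "('a::complex_normed_space \<Rightarrow> 'b::complex_normed_space) \<Rightarrow> bool"
  where "complex_linear_map f \<longleftrightarrow>
    (\<forall>x y. f (x + y) = f x + f y) \<and> (\<forall>c x. f (c *\<^sub>C x) = c *\<^sub>C f x)"

text \<open>Meant for open sets \<^term>\<open>U\<close>, where \<open>at x\<close> and \<open>at x within U\<close> coincide.\<close>

definition holomorphic_map_on ::
    "('a::complex_normed_space \<Rightarrow> 'b::complex_normed_space) \<Rightarrow> 'a set \<Rightarrow> bool"
  where "holomorphic_map_on f U \<longleftrightarrow>
    (\<forall>x\<in>U. \<exists>D. (f has_derivative D) (at x) \<and> complex_linear_map D)"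

text \<open>The complex manifolds considered are open subsets of complex normed spaces (of finite
  dimension in the application).\<close>

definition holomorphic_fibration ::
    "('a::complex_normed_space \<Rightarrow> 'b::complex_normed_space) \<Rightarrow> 'a set \<Rightarrow> 'b set \<Rightarrow> bool"
  where "holomorphic_fibration p X Y \<longleftrightarrow>
    open X \<and> open Y \<and> holomorphic_map_on p X \<and> p ` X = Y"


section \<open>Vector fields\<close>

text \<open>The tangent bundle of an open set \<^term>\<open>X\<close> in a vector space is trivial, so a vector field
  on \<^term>\<open>X\<close> is a map from \<^term>\<open>X\<close> to that space. It is represented by a total
  function; the values outside \<^term>\<open>X\<close> play no role in any of the notions below.\<close>

definition tangent_holomorphic_fields ::
    "('a::complex_normed_space \<Rightarrow> 'b::complex_normed_space) \<Rightarrow> 'a set \<Rightarrow> ('a \<Rightarrow> 'a) set"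
  where "tangent_holomorphic_fields p X =
    {\<Theta>. holomorphic_map_on \<Theta> X \<and> (\<forall>x\<in>X. frechet_derivative p (at x) (\<Theta> x) = 0)}"

definition complex_complete_on :: "'a::complex_normed_space set \<Rightarrow> ('a \<Rightarrow> 'a) \<Rightarrow> bool"
  where "complex_complete_on X \<Theta> \<longleftrightarrow>
    (\<exists>\<phi> :: complex \<Rightarrow> 'a \<Rightarrow> 'a. \<forall>x\<in>X. \<phi> 0 x = x \<and>
      (\<forall>t. \<phi> t x \<in> X \<and>
        ((\<lambda>s. \<phi> s x) has_derivative (\<lambda>h. h *\<^sub>C \<Theta> (\<phi> t x))) (at t)))"

definition lie_bracket ::
    "('a::real_normed_vector \<Rightarrow> 'a) \<Rightarrow> ('a \<Rightarrow> 'a) \<Rightarrow> 'a \<Rightarrow> 'a"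
  where "lie_bracket V W x =
    frechet_derivative W (at x) (V x) - frechet_derivative V (at x) (W x)"

inductive_set generated_lie_algebra ::
    "('a::complex_normed_space \<Rightarrow> 'a) set \<Rightarrow> ('a \<Rightarrow> 'a) set"
  for S :: "('a \<Rightarrow> 'a) set" where
  zero: "(\<lambda>x. 0) \<in> generated_lie_algebra S"
| generator: "V \<in> S \<Longrightarrow> V \<in> generated_lie_algebra S"
| add: "V \<in> generated_lie_algebra S \<Longrightarrow> W \<in> generated_lie_algebra S \<Longrightarrow>
    (\<lambda>x. V x + W x) \<in> generated_lie_algebra S"
| scale: "V \<in> generated_lie_algebra S \<Longrightarrow> (\<lambda>x. c *\<^sub>C V x) \<in> generated_lie_algebra S"
| bracket: "V \<in> generated_lie_algebra S \<Longrightarrow> W \<in> generated_lie_algebra S \<Longrightarrow>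
    lie_bracket V W \<in> generated_lie_algebra S"

definition compact_open_topology ::
    "'a::topological_space set \<Rightarrow> ('a \<Rightarrow> 'b::topological_space) topology"
  where "compact_open_topology X = topology_generated_by
    {{f. continuous_on X f \<and> f ` K \<subseteq> U} | K U. compact K \<and> K \<subseteq> X \<and> open U}"

definition fibred_density_property ::
    "('a::complex_normed_space \<Rightarrow> 'b::complex_normed_space) \<Rightarrow> 'a set \<Rightarrow> 'b set \<Rightarrow> bool"
  where "fibred_density_property p X Y \<longleftrightarrow>
    holomorphic_fibration p X Y \<and>
    subtopology (compact_open_topology X) (tangent_holomorphic_fields p X) closure_of
      generated_lie_algebra {\<Theta> \<in> tangent_holomorphic_fields p X. complex_complete_on X \<Theta>}
    = tangent_holomorphic_fields p X"


section \<open>The spectral ball and the symmetrized polydisc\<close>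

definition matrix_eigenvalue :: "complex ^ 'n ^ 'n \<Rightarrow> complex \<Rightarrow> bool"
  where "matrix_eigenvalue A k \<longleftrightarrow> (\<exists>v. v \<noteq> 0 \<and> A *v v = k *s v)"

definition matrix_spectral_radius :: "complex ^ 'n ^ 'n \<Rightarrow> real"
  where "matrix_spectral_radius A = Max (cmod ` {k. matrix_eigenvalue A k})"

definition spectral_ball :: "(complex ^ 'n ^ 'n) set"
  where "spectral_ball = {A. matrix_spectral_radius A < 1}"

definition matrix_charpoly :: "complex ^ 'n ^ 'n \<Rightarrow> complex poly"
  where "matrix_charpoly A = det (\<chi> i j. (if i = j then [:0, 1:] else 0) - [:A $ i $ j:])"

text \<open>The linear order on the index type numbers the coordinates of \<open>\<complex>\<^sup>n\<close> by
  \<open>1, \<dots>, n\<close>, where \<open>n = CARD('n)\<close>.\<close>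

definition coord_number :: "'n::{finite,linorder} \<Rightarrow> nat"
  where "coord_number j = card {i. i \<le> j}"

definition elem_sym :: "nat \<Rightarrow> complex ^ 'n \<Rightarrow> complex"
  where "elem_sym k z = (\<Sum>S | S \<subseteq> (UNIV :: 'n set) \<and> card S = k. \<Prod>i\<in>S. z $ i)"

definition symmetrized_polydisc :: "(complex ^ ('n::{finite,linorder})) set"
  where "symmetrized_polydisc =
    (\<lambda>z :: complex ^ ('n::{finite,linorder}). \<chi> j. elem_sym (coord_number j) z) ` {z. \<forall>i. cmod (z $ i) < 1}"

text \<open>Solves \<open>\<chi>\<^sub>A(\<lambda>) = \<lambda>\<^sup>n + (\<Sum>j = 1..n. (-1)\<^sup>j \<pi>\<^sub>j(A) \<lambda>\<^sup>n\<^sup>-\<^sup>j)\<close> for the \<open>\<pi>\<^sub>j(A)\<close>.\<close>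

definition spectral_fibration ::
    "complex ^ ('n::{finite,linorder}) ^ ('n::{finite,linorder}) \<Rightarrow> complex ^ ('n::{finite,linorder})"
  where "spectral_fibration A =
    (\<chi> j. (-1) ^ coord_number j * coeff (matrix_charpoly A) (CARD('n) - coord_number j))"

end

theory Submission
  imports Defs "HOL-Complex_Analysis.Cauchy_Integral_Formula"
    "HOL-Computational_Algebra.Fundamental_Theorem_Algebra"
begin

text \<open>
  The spectral ball is balanced, so a vertical holomorphic field is on compact sets the uniform limit
  of the sums of its homogeneous parts, and these are polynomial and again vertical, where
  verticality of \<open>\<Theta>\<close> means \<open>trace (A\<^sup>j \<Theta>(A)) = 0\<close> for all \<open>j\<close>. It therefore suffices that every
  vertical polynomial field on the matrix space lies in the Lie algebra.

  Such a field is a commutator \<open>[A, F(A)]\<close> with \<open>F\<close> polynomial. By a graded Nakayama argument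
  this may be checked on the three-dimensional space of the matrices
  \<open>A = x N + y N\<^sup>T + z diag(1, \<dots>, n)\<close> with \<open>N\<close> the lower shift. There \<open>x\<^sup>m \<Theta>\<close> is a
  commutator for large \<open>m\<close>, because \<open>e\<^sub>1\<close> is cyclic for \<open>x \<noteq> 0\<close>, and \<open>x\<close> can be cancelled,
  because on \<open>x = 0\<close> the polynomial maps commuting with \<open>A\<close> are polynomials in \<open>A\<close>.

  Write \<open>\<delta>\<^sub>B(A) = [A, B]\<close> and \<open>\<phi>(A) = trace (X A)\<close>, where \<open>X\<close> has distinct eigenvalues. With the
  rank-one matrices \<open>E\<^sub>i\<^sub>j\<close> of an eigenbasis of \<open>X\<close>, the fields \<open>\<phi>\<^sup>d \<delta>\<close> for \<open>E\<^sub>i\<^sub>i\<close> and the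
  overshears \<open>\<phi> \<delta>\<close> for \<open>E\<^sub>i\<^sub>j\<close> are complete, and brackets with \<open>\<phi> \<delta>\<^sub>X\<close> raise the power of \<open>\<phi>\<close>. So
  \<open>\<phi>\<^sup>d \<delta>\<^sub>B\<close> lies in the Lie algebra for all \<open>B\<close>, and the powers \<open>\<phi>\<^sup>d\<close> span the polynomials.
\<close>

text \<open>The trace conditions do not suffice pointwise: at \<open>A = 0\<close> they only force
  the trace of \<Theta>(0) to vanish, while every commutator with 0 is 0. The obstacle is the set of
  matrices without a cyclic vector, where the trace conditions become dependent. It has codimension
  3, and the slice is a three-dimensional space that meets it only in the origin: for x \<noteq> 0
  the first basis vector is cyclic, for y \<noteq> 0 the last one, and for x = y = 0, z \<noteq> 0
  the diagonal entries are distinct. Without the parameter z the cancellation of x would fail: on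
  the line of matrices y N^T the constant map N^T commutes with A, but as a polynomial in A it needs
  the coefficient 1 / y. With z present, the coefficients are seen to vanish on y = 0, and such
  denominators cancel. Degrees are tracked throughout because the Nakayama induction stops when the
  degree becomes negative.\<close>

type_synonym 'n cmatrix = "((complex, 'n) vec, 'n) vec"

section \<open>Complex scalar multiples and matrix algebra\<close>

lemma scaleC_vec_nth [simp]: "(c *\<^sub>C (x :: 'a::complex_normed_space ^ 'n)) $ i = c *\<^sub>C (x $ i)"
  by (simp add: scaleC_vec_def)

lemma scaleC_complex [simp]: "c *\<^sub>C (z :: complex) = c * z"
  by (simp add: scaleC_complex_def)

lemma scaleC_zero_right [simp]: "c *\<^sub>C (0 :: 'a::complex_normed_space) = 0"
  using norm_scaleC[of c "0 :: 'a"] by simp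

lemma scaleC_zero_left [simp]: "0 *\<^sub>C (x :: 'a::complex_normed_space) = 0"
  using norm_scaleC[of 0 x] by simp

lemma scaleC_one [simp]: "1 *\<^sub>C (x :: 'a::complex_normed_space) = x"
  using scaleC_of_real[of 1 x] by simp

lemma scaleC_minus_left [simp]: "(- c) *\<^sub>C (x :: 'a::complex_normed_space) = - (c *\<^sub>C x)"
  by (rule eq_neg_iff_add_eq_0[THEN iffD2]) (simp flip: scaleC_add_left)

lemma matrix_scaleC_left [simp]:
  "(c *\<^sub>C A) ** B = c *\<^sub>C (A ** B :: complex ^ 'n ^ 'm)" for A :: "complex ^ 'k ^ 'm"
  by (simp add: vec_eq_iff matrix_matrix_mult_def sum_distrib_left mult.assoc)

lemma matrix_scaleC_right [simp]:
  "A ** (c *\<^sub>C B) = c *\<^sub>C (A ** B :: complex ^ 'n ^ 'm)" for A :: "complex ^ 'k ^ 'm"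
  by (simp add: vec_eq_iff matrix_matrix_mult_def sum_distrib_left mult.left_commute)

lemma matrix_diff_ldistrib: "A ** (B - C) = A ** B - A ** C" for A :: "'a::ring_1 ^ 'n ^ 'm"
  by (simp add: vec_eq_iff matrix_matrix_mult_def right_diff_distrib sum_subtractf)

lemma matrix_diff_rdistrib: "(A - B) ** C = A ** C - B ** C" for A :: "'a::ring_1 ^ 'n ^ 'm"
  by (simp add: vec_eq_iff matrix_matrix_mult_def left_diff_distrib sum_subtractf)

lemma matrix_add_rdistrib: "(A + B) ** C = A ** C + B ** C" for A :: "'a::semiring_1 ^ 'n ^ 'm"
  by (simp add: vec_eq_iff matrix_matrix_mult_def distrib_right sum.distrib)

lemmas matrix_distribs =
  matrix_add_ldistrib matrix_add_rdistrib matrix_diff_ldistrib matrix_diff_rdistrib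

lemma matrix_zero_left [simp]: "0 ** A = (0 :: 'a::semiring_1 ^ 'n ^ 'm)"
  by (simp add: vec_eq_iff matrix_matrix_mult_def)

lemma matrix_zero_right [simp]: "A ** 0 = (0 :: 'a::semiring_1 ^ 'n ^ 'm)"
  by (simp add: vec_eq_iff matrix_matrix_mult_def)

lemma matrix_sum_right: "A ** (\<Sum>i\<in>I. f i) = (\<Sum>i\<in>I. A ** f i)"
  for A :: "'a::semiring_1 ^ 'n ^ 'm"
  by (induction I rule: infinite_finite_induct) (auto simp: matrix_add_ldistrib)

lemma matrix_sum_left: "(\<Sum>i\<in>I. f i) ** A = (\<Sum>i\<in>I. f i ** A)"
  for A :: "'a::semiring_1 ^ 'n ^ 'm"
  by (induction I rule: infinite_finite_induct) (auto simp: matrix_add_rdistrib)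

lemma trace_scaleC [simp]: "trace (c *\<^sub>C A) = c * trace A" for A :: "complex ^ 'n ^ 'n"
  by (simp add: trace_def sum_distrib_left)

section \<open>Commutators and powers of a matrix\<close>

definition mcomm :: "complex ^ 'n ^ 'n \<Rightarrow> complex ^ 'n ^ 'n \<Rightarrow> complex ^ 'n ^ 'n"
  where "mcomm A B = A ** B - B ** A"

lemma mcomm_add_right: "mcomm A (B + C) = mcomm A B + mcomm A C"
  by (simp add: mcomm_def matrix_add_ldistrib matrix_add_rdistrib)

lemma mcomm_diff_right: "mcomm A (B - C) = mcomm A B - mcomm A C"
  by (simp add: mcomm_def matrix_diff_ldistrib matrix_diff_rdistrib)

lemma scaleC_diff_right: "c *\<^sub>C (x - y) = c *\<^sub>C x - c *\<^sub>C (y :: 'a::complex_normed_space)"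
  using scaleC_add_right[of c "x - y" y] by simp

lemma scaleC_sum_right: "c *\<^sub>C (\<Sum>i\<in>I. f i) = (\<Sum>i\<in>I. c *\<^sub>C (f i :: 'a::complex_normed_space))"
  by (induction I rule: infinite_finite_induct) (auto simp: scaleC_add_right)

lemma mcomm_scaleC_right [simp]: "mcomm A (c *\<^sub>C B) = c *\<^sub>C mcomm A B"
  by (simp add: mcomm_def scaleC_diff_right)

lemma mcomm_scaleC_left [simp]: "mcomm (c *\<^sub>C A) B = c *\<^sub>C mcomm A B"
  by (simp add: mcomm_def scaleC_diff_right)

lemma mcomm_zero_right [simp]: "mcomm A 0 = 0"
  by (simp add: mcomm_def)

lemma mcomm_sum_right: "mcomm A (\<Sum>i\<in>I. f i) = (\<Sum>i\<in>I. mcomm A (f i))"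
  by (simp add: mcomm_def matrix_sum_left matrix_sum_right sum_subtractf)

fun mat_pow :: "complex ^ 'n ^ 'n \<Rightarrow> nat \<Rightarrow> complex ^ 'n ^ 'n" where
  "mat_pow A 0 = mat 1"
| "mat_pow A (Suc j) = A ** mat_pow A j"

lemma mat_pow_commute: "A ** mat_pow A j = mat_pow A j ** A"
proof (induction j)
  case (Suc j)
  have "A ** (A ** mat_pow A j) = A ** (mat_pow A j ** A)"
    by (simp add: Suc.IH)
  then show ?case by (simp add: matrix_mul_assoc)
qed simp

text \<open>\<open>A\<close> commutes with its powers and the trace is cyclic. This is the easy
  direction: commutators satisfy the conditions that verticality imposes.\<close>

lemma trace_mat_pow_mcomm: "trace (mat_pow A j ** mcomm A F) = 0"
proof -
  have "trace (mat_pow A j ** (A ** F)) = trace ((A ** mat_pow A j) ** F)"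
    by (simp add: matrix_mul_assoc mat_pow_commute)
  also have "\<dots> = trace (A ** (mat_pow A j ** F))"
    by (simp add: matrix_mul_assoc)
  also have "\<dots> = trace ((mat_pow A j ** F) ** A)"
    by (rule trace_mul_sym)
  finally have "trace (mat_pow A j ** (A ** F)) = trace (mat_pow A j ** (F ** A))"
    by (simp add: matrix_mul_assoc)
  then show ?thesis by (simp add: mcomm_def matrix_diff_ldistrib trace_sub)
qed

section \<open>Homogeneous polynomial functions of a matrix\<close>

text \<open>The degree is an integer, so that the degree \<open>d - 1\<close> makes sense for every \<open>d\<close>;
  in negative degrees only the zero function remains.\<close>

inductive hom_poly :: "int \<Rightarrow> (complex ^ 'n ^ 'n \<Rightarrow> complex) \<Rightarrow> bool" where
  hp_zero: "hom_poly d (\<lambda>A. 0)"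
| hp_const: "hom_poly 0 (\<lambda>A. c)"
| hp_coord: "hom_poly d P \<Longrightarrow> hom_poly (d + 1) (\<lambda>A. A $ i $ j * P A)"
| hp_add: "hom_poly d P \<Longrightarrow> hom_poly d Q \<Longrightarrow> hom_poly d (\<lambda>A. P A + Q A)"

lemma hp_cmult: "hom_poly d P \<Longrightarrow> hom_poly d (\<lambda>A. c * P A)"
proof (induction rule: hom_poly.induct)
  case (hp_coord d P i j)
  from hom_poly.hp_coord[OF hp_coord.IH, of i j] show ?case by (simp add: mult.left_commute)
qed (auto simp: distrib_left intro: hom_poly.intros)

lemma hp_diff: "hom_poly d P \<Longrightarrow> hom_poly d Q \<Longrightarrow> hom_poly d (\<lambda>A. P A - Q A)"
  using hp_add[OF _ hp_cmult[of d Q "-1"], of P] by simp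

lemma hp_sum: "(\<And>i. i \<in> I \<Longrightarrow> hom_poly d (P i)) \<Longrightarrow> hom_poly d (\<lambda>A. \<Sum>i\<in>I. P i A)"
  by (induction I rule: infinite_finite_induct) (auto intro: hom_poly.intros)

lemma hp_nth: "hom_poly 1 (\<lambda>A. A $ i $ j)"
  using hp_coord[OF hp_const[of 1]] by simp

lemma hp_mult: "hom_poly d P \<Longrightarrow> hom_poly e Q \<Longrightarrow> hom_poly (d + e) (\<lambda>A. P A * Q A)"
proof (induction rule: hom_poly.induct)
  case (hp_coord d P i j)
  from hom_poly.hp_coord[OF hp_coord.IH[OF hp_coord.prems], of i j] show ?case
    by (simp add: mult.assoc algebra_simps)
qed (auto simp: distrib_right intro: hom_poly.intros hp_cmult)

lemma hp_mult': "hom_poly d P \<Longrightarrow> hom_poly e Q \<Longrightarrow> f = d + e \<Longrightarrow> hom_poly f (\<lambda>A. P A * Q A)"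
  using hp_mult by blast

lemma hp_power: "hom_poly d P \<Longrightarrow> hom_poly (int m * d) (\<lambda>A. P A ^ m)"
  by (induction m) (auto intro: hp_const hp_mult' simp: algebra_simps)

lemma hp_nth_power: "hom_poly (int m) (\<lambda>A. A $ i $ j ^ m)"
  using hp_power[OF hp_nth] by simp

lemma hp_negative: "hom_poly d P \<Longrightarrow> d < 0 \<Longrightarrow> P A = 0"
  by (induction rule: hom_poly.induct) auto

lemma hp_subst:
  assumes g: "\<And>i j. hom_poly 1 (\<lambda>A. g A $ i $ j)"
  shows "hom_poly d P \<Longrightarrow> hom_poly d (\<lambda>A. P (g A))"
  by (induction rule: hom_poly.induct) (auto intro: hom_poly.intros hp_mult' g)

lemma hp_homogeneous: "hom_poly (int d) P \<Longrightarrow> P (s *\<^sub>C A) = s ^ d * P A"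
proof (induction "int d" P arbitrary: d rule: hom_poly.induct)
  case (hp_coord e P i j)
  show ?case
  proof (cases "e < 0")
    case True
    then show ?thesis using hp_negative[OF hp_coord.hyps(1)] by simp
  next
    case False
    then obtain m where "e = int m" by (metis nonneg_eq_int not_less)
    with hp_coord show ?thesis
      by (cases d) (auto simp: mult_ac)
  qed
qed (auto simp: distrib_left)

text \<open>Division with remainder by a linear form. When \<open>l\<close> takes the value 1 at
  \<open>c\<close>, the argument \<open>A - l A *\<^sub>C c\<close> is the projection of
  \<open>A\<close> to the hyperplane \<open>l = 0\<close> along \<open>c\<close>, so a
  \<open>P\<close> that vanishes on the hyperplane is divisible by \<open>l\<close>.\<close>

lemma hp_divide:
  assumes l: "hom_poly 1 l"
  shows "hom_poly d P \<Longrightarrow>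
    \<exists>P'. hom_poly (d - 1) P' \<and> (\<forall>A. P A = P (A - l A *\<^sub>C c) + l A * P' A)"
proof (induction rule: hom_poly.induct)
  case (hp_coord d P i j)
  then obtain P' where P': "hom_poly (d - 1) P'" "\<And>A. P A = P (A - l A *\<^sub>C c) + l A * P' A"
    by blast
  have "hom_poly 1 (\<lambda>A. A $ i $ j - c $ i $ j * l A)" for i j
    by (intro hp_diff hp_nth hp_cmult l)
  then have s: "hom_poly 1 (\<lambda>A. (A - l A *\<^sub>C c) $ i $ j)" for i j
    by (simp add: mult.commute)
  have sub: "hom_poly d (\<lambda>A. P (A - l A *\<^sub>C c))"
    by (rule hp_subst[OF s hp_coord.hyps])
  let ?Q = "\<lambda>A. c $ i $ j * P (A - l A *\<^sub>C c) + A $ i $ j * P' A"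
  have "hom_poly d ?Q"
    using hom_poly.hp_coord[OF P'(1)] by (intro hp_add hp_cmult sub) simp
  moreover have "A $ i $ j * P A = (A - l A *\<^sub>C c) $ i $ j * P (A - l A *\<^sub>C c) + l A * ?Q A" for A
    by (subst P'(2)) (simp add: algebra_simps)
  ultimately show ?case by (intro exI[of _ ?Q]) auto
next
  case (hp_add d P Q)
  then obtain P' Q' where PQ:
    "hom_poly (d - 1) P'" "\<And>A. P A = P (A - l A *\<^sub>C c) + l A * P' A"
    "hom_poly (d - 1) Q'" "\<And>A. Q A = Q (A - l A *\<^sub>C c) + l A * Q' A"
    by blast
  have "P A + Q A = P (A - l A *\<^sub>C c) + Q (A - l A *\<^sub>C c) + l A * (P' A + Q' A)" for A
    using PQ(2)[of A] PQ(4)[of A] by (simp add: algebra_simps)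
  then show ?case
    using hom_poly.hp_add[OF PQ(1,3)] by blast
qed (auto intro: exI[of _ "\<lambda>A. 0"] hom_poly.intros)

lemma hp_continuous: "hom_poly d P \<Longrightarrow> continuous_on S P"
  by (induction rule: hom_poly.induct) (auto intro!: continuous_intros)

lemma continuous_on_scaleC [continuous_intros]:
  fixes M :: "complex ^ 'n ^ 'm"
  shows "continuous_on S f \<Longrightarrow> continuous_on S (\<lambda>s. f s *\<^sub>C M)"
  unfolding scaleC_vec_def by (auto intro!: continuous_intros)

text \<open>Continuity along a punctured line. It carries identities obtained by dividing by a
  nonzero quantity to the points where that quantity vanishes.\<close>

lemma hp_zero_extend:
  assumes P: "hom_poly d P" and s: "\<And>s. s \<noteq> 0 \<Longrightarrow> P (A + s *\<^sub>C c) = 0"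
  shows "P A = 0"
proof -
  have c: "continuous_on UNIV (\<lambda>s::complex. P (A + s *\<^sub>C c))"
    by (rule continuous_on_compose2[OF hp_continuous[OF P, of UNIV]]) (auto intro!: continuous_intros)
  then have "((\<lambda>s. P (A + s *\<^sub>C c)) \<longlongrightarrow> P (A + 0 *\<^sub>C c)) (at 0)"
    by (metis UNIV_I continuous_on_def)
  moreover have "((\<lambda>s. P (A + s *\<^sub>C c)) \<longlongrightarrow> 0) (at 0)"
    by (rule tendsto_eventually) (auto simp: eventually_at_filter s)
  ultimately show ?thesis
    using tendsto_unique[OF at_neq_bot[of "0::complex"]] by fastforce
qed

section \<open>Matrices with homogeneous polynomial entries\<close>

definition hom_poly_mat :: "int \<Rightarrow> (complex ^ 'n ^ 'n \<Rightarrow> complex ^ 'm ^ 'k) \<Rightarrow> bool"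
  where "hom_poly_mat d F \<longleftrightarrow> (\<forall>i j. hom_poly d (\<lambda>A. F A $ i $ j))"

lemma hpm_nth: "hom_poly_mat d F \<Longrightarrow> hom_poly d (\<lambda>A. F A $ i $ j)"
  by (simp add: hom_poly_mat_def)

lemma hpm_zero: "hom_poly_mat d (\<lambda>A. 0)"
  by (simp add: hom_poly_mat_def hp_zero)

lemma hpm_const: "hom_poly_mat 0 (\<lambda>A. C)"
  by (simp add: hom_poly_mat_def hp_const)

lemma hpm_id: "hom_poly_mat 1 (\<lambda>A. A)"
  by (simp add: hom_poly_mat_def hp_nth)

lemma hpm_add: "hom_poly_mat d F \<Longrightarrow> hom_poly_mat d G \<Longrightarrow> hom_poly_mat d (\<lambda>A. F A + G A)"
  by (simp add: hom_poly_mat_def hp_add)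

lemma hpm_diff: "hom_poly_mat d F \<Longrightarrow> hom_poly_mat d G \<Longrightarrow> hom_poly_mat d (\<lambda>A. F A - G A)"
  by (simp add: hom_poly_mat_def hp_diff)

lemma hpm_sum: "(\<And>i. i \<in> I \<Longrightarrow> hom_poly_mat d (F i)) \<Longrightarrow> hom_poly_mat d (\<lambda>A. \<Sum>i\<in>I. F i A)"
  by (simp add: hom_poly_mat_def hp_sum)

lemma hpm_scaleC: "hom_poly d P \<Longrightarrow> hom_poly_mat e F \<Longrightarrow> f = d + e \<Longrightarrow> hom_poly_mat f (\<lambda>A. P A *\<^sub>C F A)"
  by (auto simp: hom_poly_mat_def intro: hp_mult)

lemma hpm_mult: "hom_poly_mat d F \<Longrightarrow> hom_poly_mat e G \<Longrightarrow> f = d + e \<Longrightarrow> hom_poly_mat f (\<lambda>A. F A ** G A)"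
  by (auto simp: hom_poly_mat_def matrix_matrix_mult_def intro!: hp_sum hp_mult')

lemma hpm_mcomm:
  "hom_poly_mat d F \<Longrightarrow> hom_poly_mat e G \<Longrightarrow> f = d + e \<Longrightarrow> hom_poly_mat f (\<lambda>A. mcomm (F A) (G A))"
  unfolding mcomm_def by (intro hpm_diff hpm_mult[of d F e G] hpm_mult[of e G d F]) auto

lemma hpm_mat_pow: "hom_poly_mat (int j) (\<lambda>A. mat_pow A j)"
  by (induction j) (auto intro!: hpm_const hpm_mult[OF hpm_id])

lemma hp_trace: "hom_poly_mat d F \<Longrightarrow> hom_poly d (\<lambda>A. trace (F A))"
  by (auto simp: trace_def hom_poly_mat_def intro: hp_sum)

lemma hpm_negative: "hom_poly_mat d F \<Longrightarrow> d < 0 \<Longrightarrow> F A = 0"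
  by (auto simp: vec_eq_iff hom_poly_mat_def dest: hp_negative)

lemma hpm_zero_extend:
  assumes "hom_poly_mat d F" "\<And>s. s \<noteq> 0 \<Longrightarrow> F (A + s *\<^sub>C c) = 0"
  shows "F A = 0"
  using hp_zero_extend[OF hpm_nth[OF assms(1)], of A c] assms(2) by (simp add: vec_eq_iff)

text \<open>\<open>l\<close> grows with unit speed along \<open>c\<close>, so a point of
  \<open>V\<close> with \<open>l = 0\<close> is a limit of points of \<open>V\<close> off the
  hyperplane. Used to divide identities on a slice by a matrix entry.\<close>

lemma hpm_zero_if_zero_off_hyperplane:
  assumes G: "hom_poly_mat d G" and A: "A \<in> V"
    and V: "\<And>A s. A \<in> V \<Longrightarrow> A + s *\<^sub>C c \<in> V" and l: "\<And>s. l (A + s *\<^sub>C c) = l A + s"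
    and nz: "\<And>A. A \<in> V \<Longrightarrow> l A \<noteq> (0 :: complex) \<Longrightarrow> G A = 0"
  shows "G A = 0"
proof (cases "l A = 0")
  case True
  show ?thesis
    by (rule hpm_zero_extend[OF G, of _ c], rule nz) (use True V A l in auto)
qed (rule nz[OF A])

lemma hpm_divide:
  assumes l: "hom_poly 1 l" and F: "hom_poly_mat d F"
  obtains F' where "hom_poly_mat (d - 1) F'" "\<And>A. F A = F (A - l A *\<^sub>C c) + l A *\<^sub>C F' A"
proof -
  have "\<forall>i j. \<exists>P. hom_poly (d - 1) P \<and>
      (\<forall>A. F A $ i $ j = F (A - l A *\<^sub>C c) $ i $ j + l A * P A)"
    using hp_divide[OF l hpm_nth[OF F]] by auto
  then obtain P where P: "\<And>i j. hom_poly (d - 1) (P i j)"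
    "\<And>i j A. F A $ i $ j = F (A - l A *\<^sub>C c) $ i $ j + l A * P i j A"
    by metis
  show thesis
  proof (rule that[of "\<lambda>A. \<chi> i j. P i j A"])
    show "hom_poly_mat (d - 1) (\<lambda>A. \<chi> i j. P i j A)"
      using P(1) by (simp add: hom_poly_mat_def)
    show "F A = F (A - l A *\<^sub>C c) + l A *\<^sub>C (\<chi> i j. P i j A)" for A
      unfolding vec_eq_iff by (intro allI, subst P(2)) simp
  qed
qed

section \<open>Numbering the indices\<close>

lemma coord_number_less: "i < j \<Longrightarrow> coord_number i < coord_number (j :: 'n::{finite,linorder})"
  unfolding coord_number_def by (rule psubset_card_mono) (use linorder_not_less in \<open>auto simp: psubset_eq set_eq_iff intro: less_le_trans\<close>)

lemma coord_number_inj [simp]: "coord_number i = coord_number j \<longleftrightarrow> i = (j :: 'n::{finite,linorder})"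
  by (metis coord_number_less less_irrefl linorder_cases)

lemma coord_number_pos: "1 \<le> coord_number (i :: 'n::{finite,linorder})"
proof -
  have "{j. j \<le> i} \<noteq> {}" by auto
  then show ?thesis by (simp add: coord_number_def Suc_le_eq card_gt_0_iff)
qed

lemma coord_number_le: "coord_number (i :: 'n::{finite,linorder}) \<le> CARD('n)"
  unfolding coord_number_def by (rule card_mono) auto

lemma range_coord_number: "range (coord_number :: 'n::{finite,linorder} \<Rightarrow> nat) = {1..CARD('n)}"
  by (rule card_subset_eq)
    (use coord_number_le coord_number_pos in \<open>auto simp: card_image inj_on_def\<close>)

definition idx :: "nat \<Rightarrow> 'n::{finite,linorder}"
  where "idx k = inv coord_number k"

lemma coord_number_idx: "1 \<le> k \<Longrightarrow> k \<le> CARD('n) \<Longrightarrow> coord_number (idx k :: 'n::{finite,linorder}) = k"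
  unfolding idx_def by (rule f_inv_into_f) (simp add: range_coord_number)

lemma idx_coord_number [simp]: "idx (coord_number i) = i"
  by (metis coord_number_idx coord_number_inj coord_number_le coord_number_pos)

section \<open>Linear slices and the reduction to a three-dimensional one\<close>

abbreviation sub_entry :: "('n::{finite,linorder}) cmatrix \<Rightarrow> complex" where
  "sub_entry A \<equiv> A $ idx 2 $ idx 1"
abbreviation sup_entry :: "('n::{finite,linorder}) cmatrix \<Rightarrow> complex" where
  "sup_entry A \<equiv> A $ idx 1 $ idx 2"
abbreviation diag_entry :: "('n::{finite,linorder}) cmatrix \<Rightarrow> complex" where
  "diag_entry A \<equiv> A $ idx 1 $ idx 1"

text \<open>The slice for \<open>S = UNIV\<close> consists of the matrices \<open>x N + y N\<^sup>T + z diag(1, \<dots>, n)\<close>, with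
  \<open>x\<close>, \<open>y\<close>, \<open>z\<close> read off at \<open>sub_entry\<close>, \<open>sup_entry\<close>, \<open>diag_entry\<close>; a
  smaller \<open>S\<close> frees the remaining entries.\<close>

definition slice_entry :: "('n::{finite,linorder}) cmatrix \<Rightarrow> 'n \<Rightarrow> 'n \<Rightarrow> complex"
  where "slice_entry A a b =
    (if coord_number a = coord_number b + 1 then sub_entry A
     else if a = b then of_nat (coord_number a) * diag_entry A
     else if coord_number b = coord_number a + 1 then sup_entry A else 0)"

definition slice :: "('n \<times> 'n) set \<Rightarrow> ('n::{finite,linorder}) cmatrix set"
  where "slice S = {A. \<forall>(a, b)\<in>S. A $ a $ b = slice_entry A a b}"

text \<open>\<open>\<Theta>\<close> and \<open>F\<close> are polynomials on the whole matrix space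
  that are only compared on \<open>V\<close>. A polynomial on a linear subspace extends to the whole
  space, so no separate notion of polynomials on slices is required.\<close>

definition exact_on :: "('n::{finite,linorder}) cmatrix set \<Rightarrow> bool"
  where "exact_on V \<longleftrightarrow> (\<forall>k \<Theta>. hom_poly_mat k \<Theta> \<longrightarrow>
    (\<forall>A\<in>V. \<forall>j. trace (mat_pow A j ** \<Theta> A) = 0) \<longrightarrow>
    (\<exists>F. hom_poly_mat (k - 1) F \<and> (\<forall>A\<in>V. \<Theta> A = mcomm A (F A))))"

definition matrix_unit :: "'n \<Rightarrow> 'n \<Rightarrow> complex ^ 'n ^ 'n"
  where "matrix_unit i j = (\<chi> a b. if a = i \<and> b = j then 1 else 0)"

lemma slice_entry_lin:
  "slice_entry (A + s *\<^sub>C B) a b = slice_entry A a b + s * slice_entry B a b"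
  by (auto simp: slice_entry_def algebra_simps)

lemma slice_add: "A \<in> slice S \<Longrightarrow> B \<in> slice S \<Longrightarrow> A + s *\<^sub>C B \<in> slice S"
  by (fastforce simp: slice_def slice_entry_lin)

lemma hp_if: "hom_poly d P \<Longrightarrow> hom_poly d Q \<Longrightarrow> hom_poly d (\<lambda>A. if b then P A else Q A)"
  by (cases b) simp_all

lemma hp_slice_entry: "hom_poly 1 (\<lambda>A. slice_entry A a b)"
proof -
  have "hom_poly 1 (\<lambda>A. of_nat (coord_number a) * diag_entry A)" "hom_poly 1 (\<lambda>A. 0)"
    by (rule hp_cmult[OF hp_nth] hp_zero)+
  then show ?thesis
    unfolding slice_entry_def by (intro hp_if hp_nth)
qed

text \<open>A graded Nakayama argument: if \<open>\<Theta>\<close> is a commutator on the hyperplane \<open>l = 0\<close>, then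
  subtracting that commutator leaves \<open>l \<cdot> \<Theta>'\<close> with \<open>\<Theta>'\<close> of smaller degree.\<close>

lemma exact_on_hyperplane:
  fixes V :: "('n::{finite,linorder}) cmatrix set"
  assumes l: "hom_poly 1 l" and lin: "\<And>A s. l (A + s *\<^sub>C c) = l A + s"
    and V: "\<And>A s. A \<in> V \<Longrightarrow> A + s *\<^sub>C c \<in> V"
    and ex: "exact_on {A \<in> V. l A = 0}"
  shows "exact_on V"
proof -
  have red: "A - l A *\<^sub>C c \<in> {A \<in> V. l A = 0}" if "A \<in> V" for A
  proof -
    show ?thesis using V[OF that, of "- l A"] lin[of A "- l A"] by simp
  qed
  have "\<exists>F. hom_poly_mat (k - 1) F \<and> (\<forall>A\<in>V. \<Theta> A = mcomm A (F A))"
    if "hom_poly_mat k \<Theta>" "\<And>A j. A \<in> V \<Longrightarrow> trace (mat_pow A j ** \<Theta> A) = 0" for k \<Theta>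
    using that
  \<comment> \<open>The measure is 0 exactly for negative degrees, where \<open>\<Theta>\<close>
    vanishes.\<close>
  proof (induction "nat (k + 1)" arbitrary: k \<Theta>)
    case 0
    then show ?case
      by (intro exI[of _ "\<lambda>_. 0"]) (simp add: hpm_zero hpm_negative)
  next
    case (Suc m)
    have "\<forall>A\<in>{A \<in> V. l A = 0}. \<forall>j. trace (mat_pow A j ** \<Theta> A) = 0"
      using Suc.prems(2) by blast
    then obtain F0 where F0: "hom_poly_mat (k - 1) F0"
      "\<And>A. A \<in> V \<Longrightarrow> l A = 0 \<Longrightarrow> \<Theta> A = mcomm A (F0 A)"
      using ex[unfolded exact_on_def, rule_format, OF Suc.prems(1)] by blast
    have "hom_poly_mat k (\<lambda>A. \<Theta> A - mcomm A (F0 A))"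
      by (intro hpm_diff Suc.prems hpm_mcomm[OF hpm_id F0(1)]) simp
    then obtain T where T: "hom_poly_mat (k - 1) T" "\<And>A. \<Theta> A - mcomm A (F0 A) =
        (\<Theta> (A - l A *\<^sub>C c) - mcomm (A - l A *\<^sub>C c) (F0 (A - l A *\<^sub>C c))) + l A *\<^sub>C T A"
      by (rule hpm_divide[OF l, where c = c]) blast
    have T2: "\<Theta> A = mcomm A (F0 A) + l A *\<^sub>C T A" if "A \<in> V" for A
      using T(2)[of A] F0(2) red[OF that] by (simp add: algebra_simps)
    \<comment> \<open>\<open>T\<close> inherits the trace conditions from \<open>\<Theta>\<close>:
      commutators contribute nothing, and the factor \<open>l A\<close> is cancelled where it is
      nonzero; the rest is continuity.\<close>
    have "trace (mat_pow A j ** T A) = 0" if A: "A \<in> V" for A j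
    proof -
      have nz: "trace (mat_pow A j ** T A) = 0" if A: "A \<in> V" "l A \<noteq> 0" for A
        using Suc.prems(2)[OF A(1), of j] A(2)
        by (simp add: T2[OF A(1)] matrix_add_ldistrib trace_add trace_mat_pow_mcomm)
      show ?thesis
      proof (cases "l A = 0")
        case True
        have "hom_poly (int j + (k - 1)) (\<lambda>A. trace (mat_pow A j ** T A))"
          by (intro hp_trace hpm_mult[OF hpm_mat_pow T(1)]) simp
        then show ?thesis
          by (rule hp_zero_extend[where c = c]) (rule nz, auto simp: lin True V A)
      qed (simp add: nz A)
    qed
    moreover have "m = nat (k - 1 + 1)"
      using Suc.hyps(2) by simp
    ultimately obtain F1 where F1: "hom_poly_mat (k - 1 - 1) F1"
      "\<And>A. A \<in> V \<Longrightarrow> T A = mcomm A (F1 A)"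
      using Suc.hyps(1)[OF _ T(1)] by blast
    have "hom_poly_mat (k - 1) (\<lambda>A. F0 A + l A *\<^sub>C F1 A)"
      by (intro hpm_add F0 hpm_scaleC[OF l F1(1)]) simp
    then show ?case
      using T2 F1(2) by (intro exI[of _ "\<lambda>A. F0 A + l A *\<^sub>C F1 A"]) (simp add: mcomm_add_right)
  qed
  then show ?thesis unfolding exact_on_def by blast
qed

text \<open>Prescribing one more entry cuts the slice with a hyperplane. As \<open>(a, b)\<close> is
  none of the three parameter positions, moving along \<open>matrix_unit a b\<close> changes no
  parameter, so the defining linear form grows with unit speed.\<close>

lemma slice_insert_exact:
  fixes a b :: "'n::{finite,linorder}"
  assumes n: "CARD('n) \<ge> 2" and ab: "(a, b) \<notin> S"
    "(a, b) \<noteq> (idx 2, idx 1)" "(a, b) \<noteq> (idx 1, idx 2)" "(a, b) \<noteq> (idx 1, idx 1)"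
    and ex: "exact_on (slice (insert (a, b) S))"
  shows "exact_on (slice S)"
proof -
  let ?l = "\<lambda>A. A $ a $ b - slice_entry A a b" and ?c = "matrix_unit a b"
  have c: "slice_entry ?c i j = 0" for i j
  proof -
    have "sub_entry ?c = 0" "sup_entry ?c = 0" "diag_entry ?c = 0"
      unfolding matrix_unit_def vec_lambda_beta using ab by metis+
    then show ?thesis by (simp add: slice_entry_def)
  qed
  have eq: "slice (insert (a, b) S) = {A \<in> slice S. ?l A = 0}"
    by (auto simp: slice_def)
  show ?thesis
  proof (rule exact_on_hyperplane)
    show "hom_poly 1 ?l" by (intro hp_diff hp_nth hp_slice_entry)
    show "?l (A + s *\<^sub>C ?c) = ?l A + s" for A s
      using c by (simp add: slice_entry_lin) (simp add: matrix_unit_def)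
    have "?c \<in> slice S"
      using c ab(1) by (auto simp: slice_def) (auto simp: matrix_unit_def)
    then show "A + s *\<^sub>C ?c \<in> slice S" if "A \<in> slice S" for A s
      using slice_add that by blast
    show "exact_on {A \<in> slice S. ?l A = 0}"
      using ex eq by simp
  qed
qed

text \<open>The entries are freed one at a time. The three positions in \<open>?R\<close>, from
  which the parameters are read, need no freeing: there the slice condition is trivial.\<close>

lemma exact_on_UNIV_if_slice:
  assumes n: "CARD('n::{finite,linorder}) \<ge> 2" and ex: "exact_on (slice (UNIV :: ('n \<times> 'n) set))"
  shows "exact_on (UNIV :: ('n::{finite,linorder}) cmatrix set)"
proof -
  let ?R = "{(idx 2, idx 1), (idx 1, idx 2), (idx 1, idx 1)} :: ('n \<times> 'n) set"
  have step: "exact_on (slice S) \<Longrightarrow> S \<inter> ?R = {} \<Longrightarrow> exact_on (slice ({} :: ('n \<times> 'n) set))" if "finite S" for S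
    using that
  proof (induction S rule: finite_induct)
    case (insert p S)
    obtain a b where p: "p = (a, b)" by force
    have "exact_on (slice S)"
      by (rule slice_insert_exact[OF n, of a b]) (use insert p in auto)
    then show ?case using insert by auto
  qed simp
  have i: "coord_number (idx 1 :: 'n) = 1" "coord_number (idx 2 :: 'n) = 2"
    using n by (auto intro: coord_number_idx)
  have "(idx 1 :: 'n) \<noteq> idx 2"
  proof
    assume "(idx 1 :: 'n) = idx 2"
    with i show False by simp
  qed
  have ref: "slice_entry A a b = A $ a $ b" if r: "(a, b) \<in> ?R" for A a b
  proof -
    consider "a = idx 2 \<and> b = idx 1" | "a = idx 1 \<and> b = idx 2" | "a = idx 1 \<and> b = idx 1"
      using r by blast
    then show ?thesis
      by cases (use i \<open>(idx 1 :: 'n) \<noteq> idx 2\<close> in \<open>simp_all add: slice_entry_def\<close>)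
  qed
  have "A \<in> slice UNIV" if "A \<in> slice (UNIV - ?R)" for A
    unfolding slice_def mem_Collect_eq
  proof (intro ballI, clarify)
    fix a b
    show "A $ a $ b = slice_entry A a b"
    proof (cases "(a, b) \<in> ?R")
      case False
      with that show ?thesis unfolding slice_def by blast
    qed (rule ref[symmetric])
  qed
  moreover have "slice UNIV \<subseteq> slice (UNIV - ?R)"
    by (auto simp: slice_def)
  ultimately have "slice (UNIV - ?R) = slice UNIV" by blast
  with step[of "UNIV - ?R"] ex have "exact_on (slice ({} :: ('n \<times> 'n) set))"
    by auto
  then show ?thesis by (simp add: slice_def)
qed

section \<open>Reduction to a single row\<close>

definition row_matrix :: "'n \<Rightarrow> complex ^ 'n \<Rightarrow> complex ^ 'n ^ 'n"
  where "row_matrix i w = (\<chi> a b. if a = i then w $ b else 0)"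

definition hom_poly_vec :: "int \<Rightarrow> (complex ^ 'n ^ 'n \<Rightarrow> complex ^ 'n) \<Rightarrow> bool"
  where "hom_poly_vec d w \<longleftrightarrow> (\<forall>i. hom_poly d (\<lambda>A. w A $ i))"

lemma row_matrix_zero [simp]: "row_matrix i 0 = 0"
  by (simp add: row_matrix_def vec_eq_iff)

lemma row_matrix_add: "row_matrix i (v + w) = row_matrix i v + row_matrix i w"
  by (simp add: row_matrix_def vec_eq_iff)

lemma row_matrix_diff: "row_matrix i (v - w) = row_matrix i v - row_matrix i w"
  by (simp add: row_matrix_def vec_eq_iff)

lemma row_matrix_scaleC [simp]: "row_matrix i (c *\<^sub>C w) = c *\<^sub>C row_matrix i w"
  by (simp add: row_matrix_def vec_eq_iff)

lemma hpm_row_matrix: "hom_poly_vec d w \<Longrightarrow> hom_poly_mat d (\<lambda>A. row_matrix i (w A))"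
  unfolding hom_poly_mat_def hom_poly_vec_def row_matrix_def vec_lambda_beta
  by (intro allI hp_if hp_zero) blast

lemma sum_row_matrix: "(\<Sum>i\<in>UNIV. row_matrix i (C $ i)) = C"
  by (simp add: row_matrix_def vec_eq_iff)

lemma row_matrix_mult_right: "row_matrix i w ** B = row_matrix i (w v* B)"
  by (auto simp: row_matrix_def vec_eq_iff matrix_matrix_mult_def vector_matrix_mult_def
      if_distrib if_distribR mult.commute cong: if_cong)

lemma mult_row_matrix_nth: "(B ** row_matrix i w) $ a $ b = B $ a $ i * w $ b"
  by (simp add: row_matrix_def matrix_matrix_mult_def if_distrib cong: if_cong)

lemma trace_zero [simp]: "trace (0 :: complex ^ 'n ^ 'n) = 0"
  by (simp add: trace_def)

lemma trace_row_matrix: "trace (row_matrix i w) = w $ i"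
  by (simp add: trace_def row_matrix_def if_distrib cong: if_cong)

lemma hpv_add: "hom_poly_vec d v \<Longrightarrow> hom_poly_vec d w \<Longrightarrow> hom_poly_vec d (\<lambda>A. v A + w A)"
  by (simp add: hom_poly_vec_def hp_add)

lemma hpv_diff: "hom_poly_vec d v \<Longrightarrow> hom_poly_vec d w \<Longrightarrow> hom_poly_vec d (\<lambda>A. v A - w A)"
  by (simp add: hom_poly_vec_def hp_diff)

lemma hpv_scaleC:
  "hom_poly d P \<Longrightarrow> hom_poly_vec e w \<Longrightarrow> f = d + e \<Longrightarrow> hom_poly_vec f (\<lambda>A. P A *\<^sub>C w A)"
  by (auto simp: hom_poly_vec_def intro: hp_mult)

lemma hpv_zero: "hom_poly_vec d (\<lambda>A. 0)"
  by (simp add: hom_poly_vec_def hp_zero)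

lemma hpv_vector_matrix: "hom_poly_vec d w \<Longrightarrow> hom_poly_vec (d + 1) (\<lambda>A. w A v* A)"
  by (auto simp: hom_poly_vec_def vector_matrix_mult_def add.commute intro!: hp_sum hp_mult' hp_nth)

abbreviation (input) full_slice :: "('n::{finite,linorder}) cmatrix set"
  where "full_slice \<equiv> slice UNIV"

lemma full_slice_nth: "A \<in> full_slice \<Longrightarrow> A $ a $ b = slice_entry A a b"
  by (auto simp: slice_def)

text \<open>For \<open>p = 1\<close> there is no row above the first one; \<open>max\<close> only keeps the index valid.\<close>

lemma mult_row_matrix_slice:
  fixes A :: "('n::{finite,linorder}) cmatrix"
  assumes A: "A \<in> full_slice" and p: "1 \<le> p" "Suc p \<le> CARD('n)"
  shows "A ** row_matrix (idx p) w = sub_entry A *\<^sub>C row_matrix (idx (Suc p)) w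
    + (of_nat p * diag_entry A) *\<^sub>C row_matrix (idx p) w
    + row_matrix (idx (max 1 (p - 1))) (if 2 \<le> p then sup_entry A *\<^sub>C w else 0)"
  (is "?l = ?r")
proof -
  define i where "i = (idx p :: 'n)"
  define j where "j = (idx (Suc p) :: 'n)"
  define l where "l = (idx (max 1 (p - 1)) :: 'n)"
  have ijl: "coord_number i = p" "coord_number j = Suc p" "coord_number l = max 1 (p - 1)"
    unfolding i_def j_def l_def using p by (auto intro!: coord_number_idx)
  then have e: "b = i \<longleftrightarrow> coord_number b = p" "b = j \<longleftrightarrow> coord_number b = Suc p"
    "b = l \<longleftrightarrow> coord_number b = max 1 (p - 1)" for b
    by (metis coord_number_inj)+
  have "A $ a $ i = (if coord_number a = Suc p then sub_entry A
      else if coord_number a = p then of_nat p * diag_entry A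
      else if 2 \<le> p \<and> coord_number a = p - 1 then sup_entry A else 0)" for a
    unfolding full_slice_nth[OF A, of a] slice_entry_def e(1) ijl
    using p coord_number_pos[of a] by auto
  then have "?l $ a $ b = ?r $ a $ b" for a b
    unfolding mult_row_matrix_nth i_def[symmetric] j_def[symmetric] l_def[symmetric]
    by (auto simp: row_matrix_def e)
  then show ?thesis by (simp add: vec_eq_iff)
qed

text \<open>Reduction modulo commutators, up to a power of \<open>sub_entry A\<close>, to a matrix
  supported in the first row. Where \<open>sub_entry A \<noteq> 0\<close> the first basis vector is
  cyclic, and the first-row matrices form a complement to the commutators with
  \<open>A\<close>.\<close>

definition row_reducible :: "int \<Rightarrow> (('n::{finite,linorder}) cmatrix \<Rightarrow> 'n cmatrix) \<Rightarrow> bool"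
  where "row_reducible k C \<longleftrightarrow> (\<exists>m v F. hom_poly_vec (k + int m) v \<and> hom_poly_mat (k + int m - 1) F \<and>
    (\<forall>A\<in>full_slice. sub_entry A ^ m *\<^sub>C C A = mcomm A (F A) + row_matrix (idx 1) (v A)))"

lemma row_reducible_row: "hom_poly_vec k v \<Longrightarrow> row_reducible k (\<lambda>A. row_matrix (idx 1) (v A))"
  unfolding row_reducible_def
  by (intro exI[of _ 0] exI[of _ v] exI[of _ "\<lambda>_. 0"]) (simp add: hpm_zero)

lemma row_reducible_mcomm: "hom_poly_mat (k - 1) F \<Longrightarrow> row_reducible k (\<lambda>A. mcomm A (F A))"
  unfolding row_reducible_def
  by (intro exI[of _ 0] exI[of _ "\<lambda>_. 0"] exI[of _ F]) (simp add: hpv_zero)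

lemma row_reducible_cong:
  "row_reducible k C \<Longrightarrow> (\<And>A. A \<in> full_slice \<Longrightarrow> C A = D A) \<Longrightarrow> row_reducible k D"
  unfolding row_reducible_def by metis

lemma row_reducible_cancel:
  assumes "row_reducible (k + 1) (\<lambda>A. sub_entry A *\<^sub>C C A)"
  shows "row_reducible k C"
proof -
  obtain m v F where "hom_poly_vec (k + 1 + int m) v" "hom_poly_mat (k + 1 + int m - 1) F"
    "\<forall>A\<in>full_slice. sub_entry A ^ m *\<^sub>C sub_entry A *\<^sub>C C A = mcomm A (F A) + row_matrix (idx 1) (v A)"
    using assms unfolding row_reducible_def by blast
  then show ?thesis
    unfolding row_reducible_def
    by (intro exI[of _ "Suc m"] exI[of _ v] exI[of _ F]) (simp add: scaleC_scaleC mult.commute add_ac)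
qed

lemma row_reducible_add:
  assumes "row_reducible k C" "row_reducible k D"
  shows "row_reducible k (\<lambda>A. C A + c *\<^sub>C D A)"
proof -
  obtain m v F where 1: "hom_poly_vec (k + int m) v" "hom_poly_mat (k + int m - 1) F"
    "\<And>A. A \<in> full_slice \<Longrightarrow> sub_entry A ^ m *\<^sub>C C A = mcomm A (F A) + row_matrix (idx 1) (v A)"
    using assms(1) unfolding row_reducible_def by blast
  obtain l w G where 2: "hom_poly_vec (k + int l) w" "hom_poly_mat (k + int l - 1) G"
    "\<And>A. A \<in> full_slice \<Longrightarrow> sub_entry A ^ l *\<^sub>C D A = mcomm A (G A) + row_matrix (idx 1) (w A)"
    using assms(2) unfolding row_reducible_def by blast
  let ?v = "\<lambda>A. sub_entry A ^ l *\<^sub>C v A + (c * sub_entry A ^ m) *\<^sub>C w A"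
  let ?F = "\<lambda>A. sub_entry A ^ l *\<^sub>C F A + (c * sub_entry A ^ m) *\<^sub>C G A"
  have "hom_poly_vec (k + int (m + l)) ?v" "hom_poly_mat (k + int (m + l) - 1) ?F"
    by (intro hpv_add hpm_add hpv_scaleC[OF hp_nth_power 1(1)] hpm_scaleC[OF hp_nth_power 1(2)]
        hpv_scaleC[OF hp_cmult[OF hp_nth_power] 2(1)] hpm_scaleC[OF hp_cmult[OF hp_nth_power] 2(2)]; simp)+
  moreover have "sub_entry A ^ (m + l) *\<^sub>C (C A + c *\<^sub>C D A) = mcomm A (?F A) + row_matrix (idx 1) (?v A)"
    if A: "A \<in> full_slice" for A
  proof -
    have "sub_entry A ^ (m + l) *\<^sub>C (C A + c *\<^sub>C D A) = sub_entry A ^ l *\<^sub>C sub_entry A ^ m *\<^sub>C C A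
        + (c * sub_entry A ^ m) *\<^sub>C sub_entry A ^ l *\<^sub>C D A"
      by (simp add: scaleC_add_right scaleC_scaleC power_add mult_ac)
    then show ?thesis
      unfolding 1(3)[OF A] 2(3)[OF A] by (simp add: scaleC_add_right mcomm_add_right row_matrix_add)
  qed
  ultimately show ?thesis unfolding row_reducible_def by blast
qed

text \<open>The commutator of \<open>A\<close> with a matrix supported in row \<open>q\<close> has
  entries in the rows \<open>q - 1\<close>, \<open>q\<close> and \<open>q + 1\<close>, and its row
  \<open>q + 1\<close> is \<open>sub_entry A *\<^sub>C w\<close>. Solving for that row pushes the
  support upwards at the cost of one factor \<open>sub_entry A\<close>.\<close>

lemma row_reducible_row_matrix:
  fixes w :: "('n::{finite,linorder}) cmatrix \<Rightarrow> complex ^ ('n::{finite,linorder})"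
  assumes "1 \<le> p" "p \<le> CARD('n)" "hom_poly_vec k w"
  shows "row_reducible k (\<lambda>A. row_matrix (idx p) (w A))"
  using assms
proof (induction p arbitrary: k w rule: less_induct)
  case (less p)
  show ?case
  proof (cases "p = 1")
    case True
    then show ?thesis using row_reducible_row[OF less.prems(3)] by simp
  next
    case False
    define q where "q = p - 1"
    then have q: "p = Suc q" "1 \<le> q" using False less.prems by auto
    define w1 where "w1 = (\<lambda>A. w A v* A - (of_nat q * diag_entry A) *\<^sub>C w A)"
    define w2 where "w2 = (\<lambda>A. if 2 \<le> q then sup_entry A *\<^sub>C w A else 0)"
    have w1: "hom_poly_vec (k + 1) w1"
      unfolding w1_def
      by (intro hpv_diff hpv_vector_matrix hpv_scaleC[OF hp_cmult[OF hp_nth] less.prems(3)] less.prems(3)) simp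
    have "hom_poly_vec (k + 1) (\<lambda>A. sup_entry A *\<^sub>C w A)"
      by (rule hpv_scaleC[OF hp_nth less.prems(3)]) simp
    then have w2: "hom_poly_vec (k + 1) w2"
      unfolding w2_def by (cases "2 \<le> q") (simp_all add: hpv_zero)
    have q': "q < p" "q \<le> CARD('n)" "max 1 (q - 1) < p" "1 \<le> max 1 (q - 1)" "max 1 (q - 1) \<le> CARD('n)"
      using q less.prems by auto
    have F: "hom_poly_mat (k + 1 - 1) (\<lambda>A. row_matrix (idx q) (w A))"
      using hpm_row_matrix[OF less.prems(3)] by simp
    show ?thesis
    proof (rule row_reducible_cancel, rule row_reducible_cong)
      show "row_reducible (k + 1) (\<lambda>A. mcomm A (row_matrix (idx q) (w A))
          + 1 *\<^sub>C row_matrix (idx q) (w1 A) + (- 1) *\<^sub>C row_matrix (idx (max 1 (q - 1))) (w2 A))"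
        by (intro row_reducible_add row_reducible_mcomm[OF F] less.IH[OF q'(1) q(2) q'(2) w1]
            less.IH[OF q'(3-5) w2])
      fix A :: "'n cmatrix" assume A: "A \<in> full_slice"
      show "mcomm A (row_matrix (idx q) (w A)) + 1 *\<^sub>C row_matrix (idx q) (w1 A)
          + (- 1) *\<^sub>C row_matrix (idx (max 1 (q - 1))) (w2 A) = sub_entry A *\<^sub>C row_matrix (idx p) (w A)"
        using mult_row_matrix_slice[OF A, of q "w A"] q less.prems
        by (simp add: w2_def mcomm_def w1_def row_matrix_diff row_matrix_mult_right algebra_simps)
    qed
  qed
qed

lemma row_reducible_hpm:
  assumes "hom_poly_mat k C"
  shows "row_reducible k C"
proof -
  have "row_reducible k (\<lambda>A. \<Sum>i\<in>I. row_matrix i (C A $ i))" if "finite I" for I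
    using that
  proof (induction I rule: finite_induct)
    case empty
    show ?case using row_reducible_row[OF hpv_zero, of k] by simp
  next
    case (insert i I)
    have "hom_poly_vec k (\<lambda>A. C A $ i)"
      using assms by (simp add: hom_poly_vec_def hom_poly_mat_def)
    from row_reducible_row_matrix[OF coord_number_pos coord_number_le this, of i]
    have "row_reducible k (\<lambda>A. row_matrix i (C A $ i))" by simp
    from row_reducible_add[OF this insert.IH, of 1] show ?case
      using insert.hyps by simp
  qed
  from this[of UNIV] show ?thesis by (simp add: sum_row_matrix)
qed

text \<open>The hypothesis says that \<open>w\<close> annihilates all \<open>A^j e_1\<close>, and
  \<open>e_1\<close> is cyclic. Concretely, multiplication by \<open>A\<close> propagates the
  condition from row \<open>q\<close> to row \<open>q + 1\<close>, and \<open>j = 0\<close> then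
  reads off each entry of \<open>w\<close>.\<close>

lemma first_row_zero:
  fixes A :: "('n::{finite,linorder}) cmatrix"
  assumes A: "A \<in> full_slice" and x: "sub_entry A \<noteq> 0"
    and t: "\<And>j. trace (mat_pow A j ** row_matrix (idx 1) w) = 0"
  shows "w = 0"
proof -
  have "\<forall>j. trace (mat_pow A j ** row_matrix (idx p) w) = 0" if "1 \<le> p" "p \<le> CARD('n)" for p
    using that
  proof (induction p rule: less_induct)
    case (less p)
    show ?case
    proof (cases "p = 1")
      case False
      define q where "q = p - 1"
      then have q: "p = Suc q" "1 \<le> q" using False less.prems by auto
      have 1: "trace (mat_pow A j ** row_matrix (idx q) w) = 0" for j
        using less.IH[of q] q less.prems by auto
      have 2: "trace (mat_pow A j ** row_matrix (idx (max 1 (q - 1))) (if 2 \<le> q then sup_entry A *\<^sub>C w else 0)) = 0" for j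
        using less.IH[of "max 1 (q - 1)"] q less.prems by auto
      have "trace (mat_pow A j ** row_matrix (idx p) w) = 0" for j
      proof -
        have "0 = trace (mat_pow A (Suc j) ** row_matrix (idx q) w)"
          by (simp only: 1)
        also have "\<dots> = trace (mat_pow A j ** (A ** row_matrix (idx q) w))"
          by (simp add: mat_pow_commute matrix_mul_assoc)
        also have "\<dots> = sub_entry A * trace (mat_pow A j ** row_matrix (idx p) w)"
          using mult_row_matrix_slice[OF A, of q w] q less.prems 1[of j] 2[of j]
          by (simp add: matrix_add_ldistrib trace_add)
        finally show ?thesis using x by simp
      qed
      then show ?thesis by blast
    qed (use t in simp)
  qed
  from this[OF coord_number_pos coord_number_le] have "w $ i = 0" for i
    by (metis idx_coord_number mat_pow.simps(1) matrix_mul_lid trace_row_matrix)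
  then show ?thesis by (simp add: vec_eq_iff)
qed

section \<open>Matrices commuting with an upper bidiagonal one\<close>

text \<open>Together with \<open>sup_shift\<close> and \<open>ramp_matrix\<close> the basis of the
  full slice that is dual to \<open>sub_entry\<close>, \<open>sup_entry\<close>,
  \<open>diag_entry\<close>. These are the directions in which lines leave the coordinate
  hyperplanes.\<close>

definition sub_shift :: "('n::{finite,linorder}) cmatrix"
  where "sub_shift = (\<chi> a b. if coord_number a = coord_number b + 1 then 1 else 0)"

definition sup_shift :: "('n::{finite,linorder}) cmatrix"
  where "sup_shift = (\<chi> a b. if coord_number b = coord_number a + 1 then 1 else 0)"

definition ramp_matrix :: "('n::{finite,linorder}) cmatrix"
  where "ramp_matrix = (\<chi> a b. if a = b then of_nat (coord_number a) else 0)"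

definition bidiag_slice :: "('n::{finite,linorder}) cmatrix set"
  where "bidiag_slice = {A \<in> full_slice. sub_entry A = 0}"

lemma shift_entries:
  assumes n: "CARD('n::{finite,linorder}) \<ge> 2"
  defines "L \<equiv> sub_shift :: ('n::{finite,linorder}) cmatrix"
    and "R \<equiv> sup_shift :: 'n cmatrix" and "D \<equiv> ramp_matrix :: 'n cmatrix"
  shows sub_shift_entries: "sub_entry L = 1" "sup_entry L = 0" "diag_entry L = 0" "L \<in> full_slice"
    and sup_shift_entries: "sub_entry R = 0" "sup_entry R = 1" "diag_entry R = 0" "R \<in> full_slice"
    and ramp_matrix_entries: "sub_entry D = 0" "sup_entry D = 0" "diag_entry D = 1" "D \<in> full_slice"
proof -
  have i: "coord_number (idx 1 :: 'n) = 1" "coord_number (idx 2 :: 'n) = 2"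
    using n by (auto intro: coord_number_idx)
  then have "(idx 2 :: 'n) \<noteq> idx 1"
    by (metis numeral_eq_one_iff semiring_norm(85))
  then show e: "sub_entry L = 1" "sup_entry L = 0" "diag_entry L = 0"
      "sub_entry R = 0" "sup_entry R = 1" "diag_entry R = 0"
      "sub_entry D = 0" "sup_entry D = 0" "diag_entry D = 1"
    using i by (simp_all add: L_def R_def D_def sub_shift_def sup_shift_def ramp_matrix_def del: One_nat_def)
  have "L $ a $ b = slice_entry L a b" "R $ a $ b = slice_entry R a b" "D $ a $ b = slice_entry D a b" for a b
    unfolding slice_entry_def e
    unfolding L_def R_def D_def sub_shift_def sup_shift_def ramp_matrix_def vec_lambda_beta by auto
  then show "L \<in> full_slice" "R \<in> full_slice" "D \<in> full_slice"
    by (auto simp: slice_def)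
qed

lemma bidiag_slice_add:
  fixes A :: "('n::{finite,linorder}) cmatrix"
  assumes "CARD('n) \<ge> 2" "A \<in> bidiag_slice"
  shows "A + s *\<^sub>C sup_shift \<in> bidiag_slice" "A + s *\<^sub>C ramp_matrix \<in> bidiag_slice"
  using assms(2) slice_add[of A UNIV _ s] sup_shift_entries(1,4)[OF assms(1)] ramp_matrix_entries(1,4)[OF assms(1)]
  by (simp_all add: bidiag_slice_def)

text \<open>The Newton basis at the diagonal entries \<open>n z\<close>, \<open>(n - 1) z\<close>,
  ... of a matrix in \<open>bidiag_slice\<close>, taken from the last one backwards, with
  \<open>z = diag_entry A\<close>. Unlike the powers of \<open>A\<close> it is triangular both with
  respect to the last column, for \<open>y \<noteq> 0\<close>, and with respect to the diagonal, for
  \<open>y = 0\<close>.\<close>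

fun lin_prod :: "nat \<Rightarrow> ('n::{finite,linorder}) cmatrix \<Rightarrow> 'n cmatrix" where
  "lin_prod 0 A = mat 1"
| "lin_prod (Suc j) A = (A - (of_nat (CARD('n) - j) * diag_entry A) *\<^sub>C mat 1) ** lin_prod j A"

lemma hpm_lin_prod: "hom_poly_mat (int j) (lin_prod j)"
proof (induction j)
  case (Suc j)
  have "hom_poly_mat 1 (\<lambda>A :: ('n::{finite,linorder}) cmatrix.
      A - (of_nat (CARD('n) - j) * diag_entry A) *\<^sub>C mat 1)"
    by (intro hpm_diff hpm_id hpm_scaleC[OF hp_cmult[OF hp_nth] hpm_const]) simp
  from hpm_mult[OF this Suc.IH] show ?case by simp
qed (simp add: hpm_const)

lemma lin_prod_commute:
  assumes "A ** B = B ** A"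
  shows "lin_prod j A ** B = B ** lin_prod j A"
proof (induction j)
  case (Suc j)
  let ?C = "A - (of_nat (CARD('a) - j) * diag_entry A) *\<^sub>C mat 1"
  have "?C ** B = B ** ?C"
    by (simp add: matrix_diff_ldistrib matrix_diff_rdistrib assms)
  then show ?case
    using Suc.IH by (metis lin_prod.simps(2) matrix_mul_assoc)
qed simp

lemma bidiag_slice_nth:
  "A \<in> bidiag_slice \<Longrightarrow> A $ a $ b = (if a = b then of_nat (coord_number a) * diag_entry A
     else if coord_number b = coord_number a + 1 then sup_entry A else 0)"
  using full_slice_nth[of A a b] by (auto simp: bidiag_slice_def slice_entry_def)

text \<open>The last basis vector is cyclic as long as \<open>sup_entry A\<close> does not vanish.\<close>

lemma lin_prod_last_column:
  fixes A :: "('n::{finite,linorder}) cmatrix"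
  assumes A: "A \<in> bidiag_slice"
  shows "j < CARD('n) \<Longrightarrow>
    lin_prod j A $ a $ idx (CARD('n)) = (if a = idx (CARD('n) - j) then sup_entry A ^ j else 0)"
proof (induction j arbitrary: a)
  case 0
  then show ?case by (simp add: mat_def)
next
  case (Suc j)
  let ?n = "CARD('n)"
  define b where "b = (idx (?n - j) :: 'n)"
  define b' where "b' = (idx (?n - Suc j) :: 'n)"
  have c: "coord_number b = ?n - j" "coord_number b' = ?n - Suc j"
    unfolding b_def b'_def using Suc.prems by (auto intro!: coord_number_idx)
  have e: "a = b \<longleftrightarrow> coord_number a = ?n - j" "a = b' \<longleftrightarrow> coord_number a = ?n - Suc j"
    using c by (metis coord_number_inj)+
  have IH: "lin_prod j A $ i $ idx ?n = (if i = b then sup_entry A ^ j else 0)" for i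
    using Suc by (simp add: b_def)
  have "lin_prod (Suc j) A $ a $ idx ?n =
      (A $ a $ b - (if a = b then of_nat (?n - j) * diag_entry A else 0)) * sup_entry A ^ j"
  proof -
    have "lin_prod (Suc j) A $ a $ idx ?n
        = (\<Sum>i\<in>UNIV. if i = b then (A $ a $ b - (if a = b then of_nat (?n - j) * diag_entry A else 0)) * sup_entry A ^ j else 0)"
      unfolding lin_prod.simps matrix_matrix_mult_def vec_lambda_beta IH
      by (rule sum.cong) (auto simp: mat_def)
    then show ?thesis by simp
  qed
  \<comment> \<open>The new factor subtracts exactly the diagonal entry in column \<open>b\<close>;
    only the superdiagonal entry, in row \<open>b'\<close>, survives.\<close>
  also have "A $ a $ b - (if a = b then of_nat (?n - j) * diag_entry A else 0)
      = (if a = b' then sup_entry A else 0)"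
  proof -
    have "coord_number b = coord_number a + 1 \<longleftrightarrow> a = b'" "a = b \<Longrightarrow> a \<noteq> b'"
      unfolding e c using Suc.prems by linarith+
    then show ?thesis
      unfolding bidiag_slice_nth[OF A, of a b] by (cases "a = b") (simp_all add: c)
  qed
  finally show ?case by (simp add: b'_def)
qed

text \<open>For \<open>y \<noteq> 0\<close> the last basis vector is cyclic, so a matrix commuting
  with \<open>A\<close> is determined by its last column; it is enough to match that column by a
  combination of the \<open>lin_prod j A\<close>.\<close>

lemma bidiag_centralizer_power:
  fixes F :: "('n::{finite,linorder}) cmatrix \<Rightarrow> 'n cmatrix"
  assumes n: "CARD('n) \<ge> 2" and F: "hom_poly_mat k F"
    and comm: "\<And>A. A \<in> bidiag_slice \<Longrightarrow> mcomm A (F A) = 0"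
  obtains q where "\<And>j. j < CARD('n) \<Longrightarrow> hom_poly (k + int (CARD('n) - 1) - int j) (q j)"
    "\<And>A. A \<in> bidiag_slice \<Longrightarrow>
      sup_entry A ^ (CARD('n) - 1) *\<^sub>C F A = (\<Sum>j<CARD('n). q j A *\<^sub>C lin_prod j A)"
proof -
  let ?n = "CARD('n)"
  note V = bidiag_slice_add[OF n]
  \<comment> \<open>The last column of \<open>lin_prod j A\<close> is \<open>sup_entry A ^ j\<close>
    in row \<open>n - j\<close>; the exponent \<open>n - 1 - j\<close> completes this to
    \<open>n - 1\<close> for every row.\<close>
  define q where "q = (\<lambda>j A. sup_entry A ^ (?n - 1 - j) * F A $ idx (?n - j) $ idx ?n)"
  have q: "hom_poly (k + int (?n - 1) - int j) (q j)" if "j < ?n" for j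
    unfolding q_def using that by (intro hp_mult'[OF hp_nth_power hpm_nth[OF F]]) auto
  define G where "G = (\<lambda>A. (\<Sum>j<?n. q j A *\<^sub>C lin_prod j A) - sup_entry A ^ (?n - 1) *\<^sub>C F A)"
  have hG: "hom_poly_mat (k + int (?n - 1)) G"
    unfolding G_def
    by (intro hpm_diff hpm_sum hpm_scaleC[OF q hpm_lin_prod] hpm_scaleC[OF hp_nth_power F]) auto
  have nz: "G A = 0" if A: "A \<in> bidiag_slice" and y: "sup_entry A \<noteq> 0" for A
  proof -
    have "mcomm A (lin_prod j A) = 0" for j
      using lin_prod_commute[of A A j] by (simp add: mcomm_def)
    then have "mcomm A (G A) = 0"
      unfolding G_def by (simp add: mcomm_diff_right mcomm_sum_right comm[OF A])
    then have AG: "lin_prod j A ** G A = G A ** lin_prod j A" for j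
      by (intro lin_prod_commute) (simp add: mcomm_def)
    have last: "G A $ a $ idx ?n = 0" for a
    proof -
      define i where "i = ?n - coord_number a"
      have i: "i < ?n" "idx (?n - i) = a" "\<And>j. j < ?n \<Longrightarrow> a = idx (?n - j) \<Longrightarrow> j = i"
        using coord_number_le[of a] coord_number_pos[of a]
        by (auto simp: i_def coord_number_idx)
      have "(\<Sum>j<?n. q j A *\<^sub>C lin_prod j A) $ a $ idx ?n
          = (\<Sum>j<?n. q j A * (if a = idx (?n - j) then sup_entry A ^ j else 0))"
        by (simp add: lin_prod_last_column[OF A])
      also have "\<dots> = (\<Sum>j<?n. if j = i then q j A * sup_entry A ^ j else 0)"
      proof (rule sum.cong)
        fix j assume "j \<in> {..<?n}"
        then have "a = idx (?n - j) \<longleftrightarrow> j = i"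
          using i(2,3) by auto
        then show "q j A * (if a = idx (?n - j) then sup_entry A ^ j else 0)
            = (if j = i then q j A * sup_entry A ^ j else 0)"
          by (simp only:) simp
      qed simp
      also have "\<dots> = q i A * sup_entry A ^ i"
        using i(1) by simp
      also have "\<dots> = sup_entry A ^ (?n - 1 - i + i) * F A $ a $ idx ?n"
        by (simp only: q_def i(2) power_add mult_ac)
      also have "?n - 1 - i + i = ?n - 1"
        using i(1) by simp
      finally show ?thesis by (simp add: G_def)
    qed
    \<comment> \<open>Up to the factor \<open>sup_entry A ^ j\<close>, column \<open>b\<close> of
      \<open>G A\<close> is \<open>G A\<close> applied to the last column of
      \<open>lin_prod j A\<close>. Commuting the two leaves the last column of \<open>G A\<close>,
      which is 0.\<close>
    have "G A $ a $ b = 0" for a b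
    proof -
      define j where "j = ?n - coord_number b"
      have j: "j < ?n" "idx (?n - j) = b"
        using coord_number_le[of b] coord_number_pos[of b] by (auto simp: j_def)
      have "G A $ a $ b * sup_entry A ^ j = (G A ** lin_prod j A) $ a $ idx ?n"
        using j by (simp add: matrix_matrix_mult_def lin_prod_last_column[OF A] if_distrib cong: if_cong)
      also have "\<dots> = (lin_prod j A ** G A) $ a $ idx ?n"
        by (simp add: AG)
      also have "\<dots> = 0"
        by (simp add: matrix_matrix_mult_def last)
      finally show ?thesis using y by simp
    qed
    then show ?thesis by (simp add: vec_eq_iff)
  qed
  have "G A = 0" if "A \<in> bidiag_slice" for A
    using hpm_zero_if_zero_off_hyperplane[OF hG that V(1) _ nz, of "\<lambda>A. sup_entry A"] sup_shift_entries[OF n] by simp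
  with q show thesis
    by (intro that[of q]) (auto simp: G_def)
qed

lemma lin_prod_diagonal:
  fixes A :: "('n::{finite,linorder}) cmatrix"
  assumes A: "A \<in> bidiag_slice" and y: "sup_entry A = 0"
  shows "lin_prod j A $ a $ a =
    diag_entry A ^ j * (\<Prod>l<j. of_nat (coord_number a) - of_nat (CARD('n) - l))"
proof (induction j)
  case (Suc j)
  have "A $ a $ b = (if a = b then of_nat (coord_number a) * diag_entry A else 0)" for b
    using bidiag_slice_nth[OF A, of a b] y by simp
  then have "lin_prod (Suc j) A $ a $ a
      = (\<Sum>b\<in>UNIV. if a = b then (of_nat (coord_number a) - of_nat (CARD('n) - j)) * diag_entry A * lin_prod j A $ b $ a else 0)"
    unfolding lin_prod.simps matrix_matrix_mult_def vec_lambda_beta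
    by (intro sum.cong) (auto simp: mat_def algebra_simps)
  then show ?case
    using Suc.IH by simp
qed (simp add: mat_def)

text \<open>A triangular system: in the diagonal position numbered \<open>n - j\<close> all products
  with \<open>i > j\<close> contain a zero factor. The pivot is nonzero because the diagonal entries
  of \<open>A\<close> are distinct.\<close>

lemma lin_prod_coeff_zero:
  fixes A :: "('n::{finite,linorder}) cmatrix"
  assumes A: "A \<in> bidiag_slice" "sup_entry A = 0" "diag_entry A \<noteq> 0"
    and sum: "(\<Sum>j<CARD('n). c j *\<^sub>C lin_prod j A) = 0"
  shows "j < CARD('n) \<Longrightarrow> c j = 0"
proof (induction j rule: less_induct)
  case (less j)
  let ?n = "CARD('n)"
  define a where "a = (idx (?n - j) :: 'n)"
  have a: "coord_number a = ?n - j"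
    using less.prems unfolding a_def by (intro coord_number_idx) auto
  have d: "lin_prod i A $ a $ a = diag_entry A ^ i * (\<Prod>l<i. of_nat (?n - j) - of_nat (?n - l))" for i
    using lin_prod_diagonal[OF A(1,2), of i a] a by simp
  have "0 = (\<Sum>i<?n. c i *\<^sub>C lin_prod i A) $ a $ a"
    by (simp add: sum)
  also have "\<dots> = (\<Sum>i<?n. c i * lin_prod i A $ a $ a)"
    by simp
  also have "\<dots> = (\<Sum>i<?n. if i = j then c j * lin_prod j A $ a $ a else 0)"
  proof (rule sum.cong)
    fix i assume "i \<in> {..<?n}"
    consider "i < j" | "i = j" | "j < i" by linarith
    then show "c i * lin_prod i A $ a $ a = (if i = j then c j * lin_prod j A $ a $ a else 0)"
    proof cases
      case 3
      have "(\<Prod>l<i. of_nat (?n - j) - of_nat (?n - l)) = (0 :: complex)"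
        by (rule prod_zero) (use 3 in auto)
      then show ?thesis using 3 by (simp add: d)
    qed (use less in auto)
  qed simp
  also have "\<dots> = c j * lin_prod j A $ a $ a"
    using less.prems by simp
  finally have "c j * lin_prod j A $ a $ a = 0" by simp
  moreover have "of_nat (?n - j) \<noteq> (of_nat (?n - l) :: complex)" if "l < j" for l
    using that less.prems unfolding of_nat_eq_iff by linarith
  then have "lin_prod j A $ a $ a \<noteq> 0"
    using A(3) by (simp add: d)
  ultimately show ?case by simp
qed

text \<open>On \<open>y = 0\<close> the left side vanishes as long as \<open>m > 0\<close>, hence so
  do the coefficients: by independence for \<open>z \<noteq> 0\<close>, and by continuity in
  direction \<open>ramp_matrix\<close> for \<open>z = 0\<close>. Each coefficient is therefore
  divisible by \<open>y\<close>, and \<open>m\<close> drops by one.\<close>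

lemma bidiag_centralizer_cancel:
  fixes F :: "('n::{finite,linorder}) cmatrix \<Rightarrow> 'n cmatrix"
  assumes n: "CARD('n) \<ge> 2" and F: "hom_poly_mat k F"
    and "\<And>j. j < CARD('n) \<Longrightarrow> hom_poly (k + int m - int j) (q j)"
    "\<And>A. A \<in> bidiag_slice \<Longrightarrow> sup_entry A ^ m *\<^sub>C F A = (\<Sum>j<CARD('n). q j A *\<^sub>C lin_prod j A)"
  shows "\<exists>q. (\<forall>j<CARD('n). hom_poly (k - int j) (q j)) \<and>
    (\<forall>A\<in>bidiag_slice. F A = (\<Sum>j<CARD('n). q j A *\<^sub>C lin_prod j A))"
  using assms(3-)
proof (induction m arbitrary: q)
  case 0
  then show ?case by (intro exI[of _ q]) simp
next
  case (Suc m)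
  let ?n = "CARD('n)"
  note V = bidiag_slice_add[OF n]
  have q0: "q j A = 0" if A: "A \<in> bidiag_slice" "sup_entry A = 0" and j: "j < ?n" for A j
  proof -
    have nz: "q j A = 0" if A: "A \<in> bidiag_slice" "sup_entry A = 0" "diag_entry A \<noteq> 0" for A
      using lin_prod_coeff_zero[OF A, of "\<lambda>j. q j A"] Suc.prems(2)[OF A(1)] j A(2) by simp
    show ?thesis
    proof (cases "diag_entry A = 0")
      case True
      show ?thesis
        by (rule hp_zero_extend[OF Suc.prems(1)[OF j], of _ ramp_matrix], rule nz)
          (use A True ramp_matrix_entries[OF n] V in auto)
    qed (rule nz[OF A])
  qed
  have "\<forall>j. \<exists>r. j < ?n \<longrightarrow> hom_poly (k + int m - int j) r \<and>
      (\<forall>A\<in>bidiag_slice. q j A = sup_entry A * r A)"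
  proof safe
    fix j
    show "\<exists>r. j < ?n \<longrightarrow> hom_poly (k + int m - int j) r \<and> (\<forall>A\<in>bidiag_slice. q j A = sup_entry A * r A)"
    proof (cases "j < ?n")
      case True
      obtain r where r: "hom_poly (k + int (Suc m) - int j - 1) r"
        "\<And>A. q j A = q j (A - sup_entry A *\<^sub>C sup_shift) + sup_entry A * r A"
        using hp_divide[OF hp_nth Suc.prems(1)[OF True]] by metis
      have "q j A = sup_entry A * r A" if A: "A \<in> bidiag_slice" for A
        using r(2)[of A] q0[OF V(1)[OF A, of "- sup_entry A"] _ True] sup_shift_entries[OF n]
        by simp
      then show ?thesis using r(1) by (intro exI[of _ r]) (simp add: algebra_simps)
    qed simp
  qed
  then obtain r where r: "\<And>j. j < ?n \<Longrightarrow> hom_poly (k + int m - int j) (r j)"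
    "\<And>j A. j < ?n \<Longrightarrow> A \<in> bidiag_slice \<Longrightarrow> q j A = sup_entry A * r j A"
    by metis
  define G where "G = (\<lambda>A. sup_entry A ^ m *\<^sub>C F A - (\<Sum>j<?n. r j A *\<^sub>C lin_prod j A))"
  have hG: "hom_poly_mat (k + int m) G"
    unfolding G_def
    by (intro hpm_diff hpm_sum hpm_scaleC[OF r(1) hpm_lin_prod] hpm_scaleC[OF hp_nth_power F]) auto
  have nz: "G A = 0" if A: "A \<in> bidiag_slice" and y: "sup_entry A \<noteq> 0" for A
  proof -
    have "sup_entry A *\<^sub>C G A = sup_entry A ^ Suc m *\<^sub>C F A - (\<Sum>j<?n. q j A *\<^sub>C lin_prod j A)"
      by (simp add: G_def scaleC_diff_right scaleC_sum_right scaleC_scaleC r(2) A)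
    then have "sup_entry A *\<^sub>C G A = 0"
      using Suc.prems(2)[OF A] by simp
    then show ?thesis using y by (simp add: vec_eq_iff)
  qed
  have "G A = 0" if "A \<in> bidiag_slice" for A
    using hpm_zero_if_zero_off_hyperplane[OF hG that V(1) _ nz, of "\<lambda>A. sup_entry A"] sup_shift_entries[OF n] by simp
  then show ?case
    by (intro Suc.IH[OF r(1)]) (auto simp: G_def)
qed

lemma bidiag_centralizer:
  fixes F :: "('n::{finite,linorder}) cmatrix \<Rightarrow> 'n cmatrix"
  assumes n: "CARD('n) \<ge> 2" and F: "hom_poly_mat k F"
    and comm: "\<And>A. A \<in> bidiag_slice \<Longrightarrow> mcomm A (F A) = 0"
  obtains q where "\<And>j. j < CARD('n) \<Longrightarrow> hom_poly (k - int j) (q j)"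
    "\<And>A. A \<in> bidiag_slice \<Longrightarrow> F A = (\<Sum>j<CARD('n). q j A *\<^sub>C lin_prod j A)"
proof -
  obtain q where q: "\<And>j. j < CARD('n) \<Longrightarrow> hom_poly (k + int (CARD('n) - 1) - int j) (q j)"
    "\<And>A. A \<in> bidiag_slice \<Longrightarrow>
      sup_entry A ^ (CARD('n) - 1) *\<^sub>C F A = (\<Sum>j<CARD('n). q j A *\<^sub>C lin_prod j A)"
    using bidiag_centralizer_power[OF n F comm] by blast
  from bidiag_centralizer_cancel[OF n F q] show thesis
    using that by blast
qed

section \<open>Vertical polynomial fields are commutators\<close>

text \<open>On \<open>x = 0\<close> the map \<open>F\<close> commutes with \<open>A\<close>, so it
  is a combination of the \<open>lin_prod j A\<close> there. Subtracting this combination changes no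
  commutator and leaves a map vanishing on \<open>x = 0\<close>, that is, a multiple of
  \<open>x\<close>.\<close>

lemma mcomm_cancel_sub_entry:
  fixes C :: "('n::{finite,linorder}) cmatrix \<Rightarrow> 'n cmatrix"
  assumes n: "CARD('n) \<ge> 2" and C: "hom_poly_mat k C" and F: "hom_poly_mat k F"
    and eq: "\<And>A. A \<in> full_slice \<Longrightarrow> sub_entry A *\<^sub>C C A = mcomm A (F A)"
  obtains F' where "hom_poly_mat (k - 1) F'" "\<And>A. A \<in> full_slice \<Longrightarrow> C A = mcomm A (F' A)"
proof -
  let ?n = "CARD('n)"
  have "mcomm A (F A) = 0" if "A \<in> bidiag_slice" for A
    using eq[of A] that by (auto simp: bidiag_slice_def)
  then obtain q where q: "\<And>j. j < ?n \<Longrightarrow> hom_poly (k - int j) (q j)"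
    "\<And>A. A \<in> bidiag_slice \<Longrightarrow> F A = (\<Sum>j<?n. q j A *\<^sub>C lin_prod j A)"
    using bidiag_centralizer[OF n F] by blast
  define Z where "Z = (\<lambda>A. F A - (\<Sum>j<?n. q j A *\<^sub>C lin_prod j A))"
  have "hom_poly_mat k Z"
    unfolding Z_def by (intro hpm_diff hpm_sum F hpm_scaleC[OF q(1) hpm_lin_prod]) auto
  then obtain F' where F': "hom_poly_mat (k - 1) F'"
    "\<And>A. Z A = Z (A - sub_entry A *\<^sub>C sub_shift) + sub_entry A *\<^sub>C F' A"
    using hpm_divide[OF hp_nth] by blast
  note V = slice_add[OF _ sub_shift_entries(4)[OF n]]
  have Z: "Z A = sub_entry A *\<^sub>C F' A" if A: "A \<in> full_slice" for A
  proof -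
    have "A - sub_entry A *\<^sub>C sub_shift \<in> bidiag_slice"
      using V[OF A, of "- sub_entry A"] sub_shift_entries[OF n] by (simp add: bidiag_slice_def)
    then have "Z (A - sub_entry A *\<^sub>C sub_shift) = 0"
      by (simp add: Z_def q(2))
    then show ?thesis using F'(2)[of A] by simp
  qed
  define G where "G = (\<lambda>A. C A - mcomm A (F' A))"
  have hG: "hom_poly_mat k G"
    unfolding G_def by (intro hpm_diff C hpm_mcomm[OF hpm_id F'(1)]) simp
  have nz: "G A = 0" if A: "A \<in> full_slice" and x: "sub_entry A \<noteq> 0" for A
  proof -
    have "mcomm A (lin_prod j A) = 0" for j
      using lin_prod_commute[of A A j] by (simp add: mcomm_def)
    then have "mcomm A (F A) = mcomm A (Z A)"
      by (simp add: Z_def mcomm_diff_right mcomm_sum_right)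
    then have "sub_entry A *\<^sub>C G A = 0"
      using eq[OF A] Z[OF A] by (simp add: G_def scaleC_diff_right)
    then show ?thesis using x by (simp add: vec_eq_iff)
  qed
  have "G A = 0" if "A \<in> full_slice" for A
    using hpm_zero_if_zero_off_hyperplane[OF hG that V(1) _ nz, of "\<lambda>A. sub_entry A"] sub_shift_entries[OF n] by simp
  then show thesis by (intro that[OF F'(1)]) (simp add: G_def)
qed

lemma exact_on_full_slice:
  assumes n: "CARD('n::{finite,linorder}) \<ge> 2"
  shows "exact_on (full_slice :: ('n::{finite,linorder}) cmatrix set)"
  unfolding exact_on_def
proof (intro allI impI)
  fix k and \<Theta> :: "'n cmatrix \<Rightarrow> 'n cmatrix"
  assume T: "hom_poly_mat k \<Theta>" and tr: "\<forall>A\<in>full_slice. \<forall>j. trace (mat_pow A j ** \<Theta> A) = 0"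
  obtain m v F where F: "hom_poly_vec (k + int m) v" "hom_poly_mat (k + int m - 1) F"
    "\<And>A. A \<in> full_slice \<Longrightarrow> sub_entry A ^ m *\<^sub>C \<Theta> A = mcomm A (F A) + row_matrix (idx 1) (v A)"
    using row_reducible_hpm[OF T] unfolding row_reducible_def by blast
  note V = slice_add[OF _ sub_shift_entries(4)[OF n]]
  \<comment> \<open>The remainder in the first row. It satisfies the trace conditions, so it
    vanishes for \<open>x \<noteq> 0\<close> by cyclicity and then on the whole slice.\<close>
  define G where "G = (\<lambda>A. sub_entry A ^ m *\<^sub>C \<Theta> A - mcomm A (F A))"
  have hG: "hom_poly_mat (k + int m) G"
    unfolding G_def by (intro hpm_diff hpm_scaleC[OF hp_nth_power T] hpm_mcomm[OF hpm_id F(2)]) auto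
  have nz: "G A = 0" if A: "A \<in> full_slice" and x: "sub_entry A \<noteq> 0" for A
  proof -
    have G: "G A = row_matrix (idx 1) (v A)"
      using F(3)[OF A] by (simp add: G_def)
    have "trace (mat_pow A j ** G A) = 0" for j
      using tr A by (simp add: G_def matrix_diff_ldistrib trace_sub trace_mat_pow_mcomm)
    then have "v A = 0"
      using first_row_zero[OF A x, of "v A"] by (simp add: G)
    then show ?thesis by (simp add: G)
  qed
  have "G A = 0" if "A \<in> full_slice" for A
    using hpm_zero_if_zero_off_hyperplane[OF hG that V(1) _ nz, of "\<lambda>A. sub_entry A"] sub_shift_entries[OF n] by simp
  then have eq: "sub_entry A ^ m *\<^sub>C \<Theta> A = mcomm A (F A)" if "A \<in> full_slice" for A
    using that by (simp add: G_def)
  have "\<exists>F. hom_poly_mat (k - 1) F \<and> (\<forall>A\<in>full_slice. \<Theta> A = mcomm A (F A))"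
    if "hom_poly_mat (k + int m - 1) F" "\<And>A. A \<in> full_slice \<Longrightarrow> sub_entry A ^ m *\<^sub>C \<Theta> A = mcomm A (F A)" for m F
    using that
  proof (induction m arbitrary: F)
    case 0
    then show ?case by auto
  next
    case (Suc m)
    have C: "hom_poly_mat (k + int m) (\<lambda>A. sub_entry A ^ m *\<^sub>C \<Theta> A)"
      by (intro hpm_scaleC[OF hp_nth_power T]) simp
    have F: "hom_poly_mat (k + int m) F"
      using Suc.prems(1) by (simp add: algebra_simps)
    have "sub_entry A *\<^sub>C sub_entry A ^ m *\<^sub>C \<Theta> A = mcomm A (F A)" if "A \<in> full_slice" for A
      using Suc.prems(2)[OF that] by (simp add: scaleC_scaleC)
    from mcomm_cancel_sub_entry[OF n C F this] obtain F' where
      "hom_poly_mat (k + int m - 1) F'"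
      "\<And>A. A \<in> full_slice \<Longrightarrow> sub_entry A ^ m *\<^sub>C \<Theta> A = mcomm A (F' A)"
      by blast
    then show ?case by (rule Suc.IH)
  qed
  from this[OF F(2) eq] show "\<exists>F. hom_poly_mat (k - 1) F \<and> (\<forall>A\<in>full_slice. \<Theta> A = mcomm A (F A))" .
qed

theorem vertical_poly_is_mcomm:
  fixes \<Theta> :: "('n::{finite,linorder}) cmatrix \<Rightarrow> 'n cmatrix"
  assumes T: "hom_poly_mat k \<Theta>" and tr: "\<And>A j. trace (mat_pow A j ** \<Theta> A) = 0"
  obtains F where "hom_poly_mat (k - 1) F" "\<And>A. \<Theta> A = mcomm A (F A)"
proof (cases "CARD('n) \<ge> 2")
  case True
  have "\<exists>F. hom_poly_mat (k - 1) F \<and> (\<forall>A\<in>UNIV. \<Theta> A = mcomm A (F A))"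
    by (rule exact_on_UNIV_if_slice[OF True exact_on_full_slice[OF True],
          unfolded exact_on_def, rule_format, OF T]) (rule tr)
  then show thesis using that by blast
next
  case False
  \<comment> \<open>For \<open>n = 1\<close> there is no second index to build a slice from. All
    commutators are 0, and so is \<open>\<Theta>\<close>, by the trace condition with
    \<open>j = 0\<close>.\<close>
  have "0 < CARD('n)" by simp
  with False have "CARD('n) = 1" by linarith
  then obtain o1 :: 'n where o1: "UNIV = {o1}" by (auto simp: card_1_singleton_iff)
  have "\<Theta> A $ i $ j = 0" for A i j
  proof -
    have "i = o1" "j = o1" using o1 by auto
    moreover have "\<Theta> A $ o1 $ o1 = 0"
      using tr[of A 0] by (simp add: trace_def o1)
    ultimately show ?thesis by simp
  qed
  then show thesis by (intro that[of "\<lambda>_. 0"]) (auto simp: hpm_zero vec_eq_iff)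
qed

section \<open>The characteristic polynomial\<close>

lemma poly_det: "poly (det M) x = det (\<chi> i j. poly (M $ i $ j) x)"
  for M :: "complex poly ^ 'n ^ 'n"
  by (simp add: det_def poly_sum poly_prod)

lemma poly_matrix_charpoly: "poly (matrix_charpoly A) x = det (mat x - A)"
proof -
  have "(\<chi> i j. poly ((\<chi> i j. (if i = j then [:0, 1:] else 0) - [:A $ i $ j:]) $ i $ j) x) = mat x - A"
    by (simp add: vec_eq_iff mat_def)
  then show ?thesis
    unfolding matrix_charpoly_def poly_det by simp
qed

lemma matrix_eigenvalue_iff_det: "matrix_eigenvalue A k \<longleftrightarrow> det (mat k - A) = 0"
proof -
  have m: "mat k *v v = k *s v" for v :: "complex ^ 'n"
    by (simp add: vec_eq_iff matrix_vector_mult_def mat_def if_distrib if_distribR cong: if_cong)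
  have "det (mat k - A) \<noteq> 0 \<longleftrightarrow> (\<forall>v. (mat k - A) *v v = 0 \<longrightarrow> v = 0)"
    by (simp add: invertible_det_nz[symmetric] invertible_left_inverse matrix_left_invertible_ker)
  also have "\<dots> \<longleftrightarrow> \<not> matrix_eigenvalue A k"
    by (auto simp: matrix_eigenvalue_def matrix_vector_mult_diff_rdistrib m)
  finally show ?thesis by blast
qed

text \<open>In the Leibniz sum the degree of a term is at most the number of fixed points of the
  permutation, and only the identity fixes all indices.\<close>

lemma matrix_charpoly_monic:
  fixes A :: "complex ^ 'n ^ 'n"
  shows "degree (matrix_charpoly A) \<le> CARD('n)" "coeff (matrix_charpoly A) (CARD('n)) = 1"
proof -
  let ?n = "CARD('n)"
  let ?M = "\<lambda>i j. (if i = j then [:0, 1:] else 0) - [:A $ i $ j:]"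
  let ?t = "\<lambda>p. of_int (sign p) * (\<Prod>i\<in>UNIV. ?M i (p i))"
  have cp: "matrix_charpoly A = (\<Sum>p | p permutes UNIV. ?t p)"
    by (simp add: matrix_charpoly_def det_def)
  have dt: "degree (?t p) \<le> degree (\<Prod>i\<in>UNIV. ?M i (p i))" for p
    by (rule order_trans[OF degree_mult_le]) simp
  have dp: "degree (?t p) \<le> card {i. p i = i}" for p
  proof -
    have "degree (\<Prod>i\<in>UNIV. ?M i (p i)) \<le> (\<Sum>i\<in>UNIV. degree (?M i (p i)))"
      using degree_prod_sum_le[of UNIV "\<lambda>i. ?M i (p i)"] by (simp add: o_def)
    also have "\<dots> \<le> (\<Sum>i\<in>UNIV. if p i = i then 1 else 0)"
      by (intro sum_mono) auto
    finally show ?thesis using dt[of p] by (simp add: sum.If_cases)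
  qed
  have card: "card {i. p i = i} \<le> ?n" for p :: "'n \<Rightarrow> 'n"
    by (rule card_mono) auto
  show "degree (matrix_charpoly A) \<le> ?n"
    unfolding cp by (intro degree_sum_le order_trans[OF dp card]) auto
  have "coeff (?t p) ?n = 0" if "p permutes UNIV" "p \<noteq> id" for p
  proof -
    have "card {i. p i = i} < ?n"
      by (rule psubset_card_mono) (use that(2) in \<open>auto simp: fun_eq_iff\<close>)
    then show ?thesis using dp[of p] by (intro coeff_eq_0) simp
  qed
  then have "coeff (matrix_charpoly A) ?n = (\<Sum>p\<in>{id}. coeff (?t p) ?n)"
    unfolding cp coeff_sum by (intro sum.mono_neutral_right) (auto simp: permutes_id)
  also have "\<dots> = coeff (\<Prod>i\<in>UNIV. [:- A $ i $ i, 1:]) ?n"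
    by simp
  also have "\<dots> = 1"
  proof -
    have "degree (\<Prod>i\<in>UNIV. [:- A $ i $ i, 1:]) = ?n"
      by (subst degree_prod_eq_sum_degree) auto
    moreover have "lead_coeff (\<Prod>i\<in>UNIV. [:- A $ i $ i, 1:]) = 1"
      by (simp add: lead_coeff_prod)
    ultimately show ?thesis by simp
  qed
  finally show "coeff (matrix_charpoly A) ?n = 1" .
qed

text \<open>With the sign convention of \<^const>\<open>spectral_fibration\<close>, the reversed characteristic
  polynomial \<open>det (1 - \<mu> A)\<close> is \<open>rev_eval (spectral_fibration A) \<mu>\<close>.\<close>

definition rev_eval :: "complex ^ ('n::{finite,linorder}) \<Rightarrow> complex \<Rightarrow> complex"
  where "rev_eval c \<mu> = 1 + (\<Sum>j\<in>UNIV. (-1) ^ coord_number j * c $ j * \<mu> ^ coord_number j)"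

lemma sum_coord_number: "(\<Sum>j\<in>(UNIV :: 'n::{finite,linorder} set). f (coord_number j)) = (\<Sum>k=1..CARD('n). f k)"
proof -
  have "(\<Sum>k\<in>range (coord_number :: 'n \<Rightarrow> nat). f k) = (\<Sum>j\<in>(UNIV :: 'n set). f (coord_number j))"
    by (subst sum.reindex) (auto simp: inj_on_def)
  then show ?thesis by (simp add: range_coord_number)
qed

lemma rev_eval_nth: "rev_eval c \<mu> = 1 + (\<Sum>k=1..CARD('n). (-1) ^ k * c $ idx k * \<mu> ^ k)"
  for c :: "complex ^ ('n::{finite,linorder})"
  unfolding rev_eval_def sum_coord_number[where 'n = 'n, symmetric] by simp

text \<open>\<open>c\<close> consists, up to signs, of the coefficients of a polynomial in
  \<open>\<mu>\<close> with constant term 1. Equalities of values of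
  \<open>spectral_fibration\<close> thereby reduce to equalities of determinants.\<close>

lemma rev_eval_inj:
  fixes c c' :: "complex ^ ('n::{finite,linorder})"
  assumes "\<And>\<mu>. \<mu> \<noteq> 0 \<Longrightarrow> rev_eval c \<mu> = rev_eval c' \<mu>"
  shows "c = c'"
proof -
  define P where "P = (\<lambda>c :: complex ^ ('n::{finite,linorder}). 1 + (\<Sum>k=1..CARD('n). monom ((-1) ^ k * c $ idx k) k))"
  have "poly (P c) \<mu> = rev_eval c \<mu>" for c \<mu>
    by (simp add: P_def rev_eval_nth poly_sum poly_monom)
  moreover have "rev_eval c 0 = rev_eval c' 0"
    using coord_number_pos by (simp add: rev_eval_nth)
  ultimately have "P c = P c'"
    using assms by (intro poly_ext) metis
  moreover have "coeff (P c) (coord_number j) = (-1) ^ coord_number j * c $ j" for c j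
    using coord_number_pos[of j] coord_number_le[of j]
    by (simp add: P_def coeff_sum coeff_1 if_distrib cong: if_cong)
  ultimately have "(-1) ^ coord_number j * c $ j = (-1) ^ coord_number j * c' $ j" for j
    by metis
  then show ?thesis by (simp add: vec_eq_iff)
qed

lemma det_scaleC: "det (x *\<^sub>C A) = x ^ CARD('n) * det A" for A :: "complex ^ 'n ^ 'n"
  by (simp add: det_def prod.distrib sum_distrib_left mult_ac)

lemma rev_eval_spectral_fibration:
  fixes A :: "('n::{finite,linorder}) cmatrix"
  shows "rev_eval (spectral_fibration A) \<mu> = det (mat 1 - \<mu> *\<^sub>C A)"
proof (cases "\<mu> = 0")
  case True
  have "(\<Sum>k = Suc 0..CARD('n). (- 1) ^ k * spectral_fibration A $ idx k * 0 ^ k) = 0"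
    by (rule sum.neutral) simp
  then show ?thesis using True by (simp add: rev_eval_nth)
next
  case False
  let ?n = "CARD('n)" and ?c = "coeff (matrix_charpoly A)"
  have "mat 1 - \<mu> *\<^sub>C A = \<mu> *\<^sub>C (mat (1 / \<mu>) - A)"
    using False by (simp add: vec_eq_iff mat_def right_diff_distrib)
  then have "det (mat 1 - \<mu> *\<^sub>C A) = \<mu> ^ ?n * poly (matrix_charpoly A) (1 / \<mu>)"
    by (simp add: det_scaleC poly_matrix_charpoly)
  also have "poly (matrix_charpoly A) (1 / \<mu>) = (\<Sum>k\<le>?n. ?c k * (1 / \<mu>) ^ k)"
    unfolding poly_altdef using matrix_charpoly_monic(1)[of A]
    by (intro sum.mono_neutral_left) (auto simp: coeff_eq_0 not_le)
  also have "\<mu> ^ ?n * \<dots> = (\<Sum>k\<le>?n. ?c k * \<mu> ^ (?n - k))"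
    unfolding sum_distrib_left by (intro sum.cong) (use False in \<open>auto simp: power_diff power_divide\<close>)
  also have "\<dots> = (\<Sum>k\<le>?n. ?c (?n - k) * \<mu> ^ k)"
    by (rule sum.reindex_bij_witness[where i = "\<lambda>k. ?n - k" and j = "\<lambda>k. ?n - k"]) auto
  also have "\<dots> = 1 + (\<Sum>k=1..?n. ?c (?n - k) * \<mu> ^ k)"
    by (simp add: atMost_atLeast0 sum.atLeast_Suc_atMost matrix_charpoly_monic(2))
  also have "\<dots> = 1 + (\<Sum>k=1..?n. (-1) ^ k * spectral_fibration A $ idx k * \<mu> ^ k)"
  proof -
    have "(-1) ^ k * spectral_fibration A $ idx k = ?c (?n - k)" if "k \<in> {1..?n}" for k
    proof -
      have "coord_number (idx k :: 'n) = k" using that by (intro coord_number_idx) auto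
      then show ?thesis
        by (simp add: spectral_fibration_def mult.assoc[symmetric] flip: power_add)
    qed
    then show ?thesis by simp
  qed
  finally show ?thesis by (simp add: rev_eval_nth)
qed

section \<open>The spectral ball and the symmetrized polydisc\<close>

definition elem_sym_vec :: "complex ^ ('n::{finite,linorder}) \<Rightarrow> complex ^ 'n::{finite,linorder}"
  where "elem_sym_vec z = (\<chi> j. elem_sym (coord_number j) z)"

lemma rev_eval_elem_sym:
  fixes z :: "complex ^ ('n::{finite,linorder})"
  shows "rev_eval (elem_sym_vec z) \<mu> = (\<Prod>i\<in>UNIV. 1 - \<mu> * z $ i)"
proof -
  let ?n = "CARD('n)"
  have "(\<Prod>i\<in>UNIV. 1 - \<mu> * z $ i) = (\<Prod>i\<in>UNIV. - \<mu> * z $ i + 1)"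
    by simp
  also have "\<dots> = (\<Sum>S\<in>Pow UNIV. \<Prod>i\<in>S. - \<mu> * z $ i)"
    by (subst prod_add) auto
  also have "\<dots> = (\<Sum>k\<le>?n. \<Sum>S | S \<in> Pow UNIV \<and> card S = k. \<Prod>i\<in>S. - \<mu> * z $ i)"
    by (rule sum.group[symmetric]) (auto intro: card_mono)
  also have "\<dots> = (\<Sum>k\<le>?n. (- \<mu>) ^ k * elem_sym k z)"
    unfolding elem_sym_def sum_distrib_left prod.distrib by (intro sum.cong) auto
  also have "\<dots> = 1 + (\<Sum>k=1..?n. (- \<mu>) ^ k * elem_sym k z)"
  proof -
    have "{S :: 'n set. S \<subseteq> UNIV \<and> card S = 0} = {{}}" by auto
    then have "elem_sym 0 z = 1" by (simp add: elem_sym_def)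
    then show ?thesis by (simp add: atMost_atLeast0 sum.atLeast_Suc_atMost)
  qed
  also have "(\<Sum>k=1..?n. (- \<mu>) ^ k * elem_sym k z) = (\<Sum>k=1..?n. (-1) ^ k * elem_sym_vec z $ idx k * \<mu> ^ k)"
    by (rule sum.cong) (auto simp: elem_sym_vec_def coord_number_idx power_minus[of \<mu>])
  finally show ?thesis by (simp add: rev_eval_nth)
qed

text \<open>The coordinates of \<open>z\<close> are the roots of the monic polynomial whose
  coefficients are those of \<open>c\<close> with alternating signs.\<close>

lemma elem_sym_vec_surj:
  fixes c :: "complex ^ ('n::{finite,linorder})"
  obtains z where "c = elem_sym_vec z"
proof -
  let ?n = "CARD('n)"
  define r where "r = (\<Sum>k=1..?n. monom ((-1) ^ k * c $ idx k) (?n - k))"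
  define P where "P = monom 1 ?n + r"
  have "coeff r ?n = 0"
    unfolding r_def coeff_sum by (rule sum.neutral) auto
  moreover have "degree r \<le> ?n"
    unfolding r_def by (rule degree_sum_le) (auto intro: order_trans[OF degree_monom_le])
  ultimately have P: "degree P = ?n" "lead_coeff P = 1"
  proof -
    have "degree P \<le> ?n"
      unfolding P_def using \<open>degree r \<le> ?n\<close> by (intro degree_add_le degree_monom_le)
    moreover have "coeff P ?n = 1"
      using \<open>coeff r ?n = 0\<close> by (simp add: P_def)
    ultimately show "degree P = ?n" "lead_coeff P = 1"
      by (metis le_antisym le_degree one_neq_zero)+
  qed
  then have "P \<noteq> 0" by auto
  from alg_closed_imp_factorization[OF this] P obtain R
    where R: "size R = ?n" "P = (\<Prod>x\<in>#R. [:- x, 1:])" by auto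
  obtain xs where xs: "mset xs = R" using ex_mset by blast
  then have len: "length xs = ?n" using R(1) by auto
  \<comment> \<open>\<open>coord_number\<close> starts at 1, the list of roots at 0.\<close>
  define z :: "complex ^ ('n::{finite,linorder})" where "z = (\<chi> i. xs ! (coord_number i - 1))"
  have "rev_eval c \<mu> = rev_eval (elem_sym_vec z) \<mu>" if "\<mu> \<noteq> 0" for \<mu>
  proof -
    have "(\<Prod>i\<in>UNIV. 1 / \<mu> - z $ i) = (\<Prod>k\<in>range (coord_number :: 'n \<Rightarrow> nat). 1 / \<mu> - xs ! (k - 1))"
      by (subst prod.reindex) (auto simp: z_def inj_on_def)
    also have "\<dots> = (\<Prod>k=1..?n. 1 / \<mu> - xs ! (k - 1))"
      by (simp add: range_coord_number)
    also have "\<dots> = (\<Prod>k<?n. 1 / \<mu> - xs ! k)"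
      by (rule prod.reindex_bij_witness[where i = Suc and j = "\<lambda>k. k - 1"]) auto
    also have "\<dots> = (\<Prod>x\<leftarrow>xs. 1 / \<mu> - x)"
      by (simp add: prod.list_conv_set_nth len atLeast0LessThan)
    also have "\<dots> = poly P (1 / \<mu>)"
      unfolding R(2) xs[symmetric] by (simp add: poly_prod_mset prod_mset_prod_list[symmetric] del: prod_mset_prod_list) 
    finally have "\<mu> ^ ?n * poly P (1 / \<mu>) = (\<Prod>i\<in>UNIV. \<mu> * (1 / \<mu> - z $ i))"
      by (simp add: prod.distrib)
    also have "\<dots> = (\<Prod>i\<in>UNIV. 1 - \<mu> * z $ i)"
      using that by (simp add: right_diff_distrib)
    also have "\<mu> ^ ?n * poly P (1 / \<mu>) = rev_eval c \<mu>"
      unfolding P_def r_def rev_eval_nth poly_add poly_sum poly_monom distrib_left sum_distrib_left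
      using that by (intro arg_cong2[where f = "(+)"] sum.cong)
        (auto simp: power_divide power_diff field_simps)
    finally show ?thesis by (simp add: rev_eval_elem_sym)
  qed
  then show thesis using that rev_eval_inj by blast
qed

text \<open>The \<open>Max\<close> in the spectral radius needs a finite nonempty set. The
  eigenvalues are the roots of the characteristic polynomial, which is neither zero nor
  constant.\<close>

lemma spectral_ball_iff:
  "(A :: complex ^ 'n ^ 'n) \<in> spectral_ball \<longleftrightarrow> (\<forall>k. matrix_eigenvalue A k \<longrightarrow> cmod k < 1)"
proof -
  have "matrix_charpoly A \<noteq> 0"
    using matrix_charpoly_monic(2)[of A] by auto
  then have fin: "finite {k. matrix_eigenvalue A k}"
    using poly_roots_finite[of "matrix_charpoly A"]
    by (simp add: poly_matrix_charpoly matrix_eigenvalue_iff_det)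
  have "degree (matrix_charpoly A) \<noteq> 0"
    using matrix_charpoly_monic(2)[of A] by (metis le_degree zero_less_card_finite not_le one_neq_zero)
  then have "\<exists>k. matrix_eigenvalue A k"
    using alg_closed_imp_poly_has_root[of "matrix_charpoly A"]
    by (auto simp: poly_matrix_charpoly matrix_eigenvalue_iff_det)
  with fin show ?thesis
    by (auto simp: spectral_ball_def matrix_spectral_radius_def)
qed

text \<open>A zero \<open>\<mu>\<close> of the determinant is the reciprocal of a nonzero
  eigenvalue. Passing to reciprocals replaces the unbounded region outside the disc by a compact
  disc, as the proof of openness requires.\<close>

lemma spectral_ball_iff_det:
  "(A :: complex ^ 'n ^ 'n) \<in> spectral_ball \<longleftrightarrow> (\<forall>\<mu>\<in>cball 0 1. det (mat 1 - \<mu> *\<^sub>C A) \<noteq> 0)"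
proof -
  have eq: "det (mat 1 - \<mu> *\<^sub>C A) = \<mu> ^ CARD('n) * det (mat (1 / \<mu>) - A)" if "\<mu> \<noteq> 0" for \<mu>
  proof -
    have "mat 1 - \<mu> *\<^sub>C A = \<mu> *\<^sub>C (mat (1 / \<mu>) - A)"
      using that by (simp add: vec_eq_iff mat_def right_diff_distrib)
    then show ?thesis by (simp add: det_scaleC)
  qed
  show ?thesis
    unfolding spectral_ball_iff matrix_eigenvalue_iff_det
  proof safe
    fix \<mu> assume *: "\<forall>k. det (mat k - A) = 0 \<longrightarrow> cmod k < 1" "\<mu> \<in> cball 0 1" "det (mat 1 - \<mu> *\<^sub>C A) = 0"
    then have "\<mu> \<noteq> 0" by auto
    with *(3) eq have "det (mat (1 / \<mu>) - A) = 0" by simp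
    with * have "cmod (1 / \<mu>) < 1" by blast
    with \<open>\<mu> \<noteq> 0\<close> *(2) show False by (simp add: norm_divide)
  next
    fix k assume *: "\<forall>\<mu>\<in>cball 0 1. det (mat 1 - \<mu> *\<^sub>C A) \<noteq> 0" "det (mat k - A) = 0"
    show "cmod k < 1"
    proof (rule ccontr)
      assume "\<not> cmod k < 1"
      then have k: "1 / k \<in> cball 0 1" "1 / k \<noteq> 0"
        by (auto simp: norm_divide divide_le_eq_1)
      then show False using *(1)[rule_format, OF k(1)] eq[OF k(2)] *(2) by simp
    qed
  qed
qed

lemma symmetrized_polydisc_iff:
  "(c :: complex ^ ('n::{finite,linorder})) \<in> symmetrized_polydisc \<longleftrightarrow> (\<forall>\<mu>\<in>cball 0 1. rev_eval c \<mu> \<noteq> 0)"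
proof
  assume "c \<in> symmetrized_polydisc"
  then obtain z where c: "c = elem_sym_vec z" and z: "\<And>i. cmod (z $ i) < 1"
    by (auto simp: symmetrized_polydisc_def elem_sym_vec_def)
  show "\<forall>\<mu>\<in>cball 0 1. rev_eval c \<mu> \<noteq> 0"
  proof (rule ballI, rule notI)
    fix \<mu> assume mu: "\<mu> \<in> cball 0 1" "rev_eval c \<mu> = 0"
    then obtain i where "\<mu> * z $ i = 1"
      by (auto simp: c rev_eval_elem_sym)
    then have "cmod \<mu> * cmod (z $ i) = 1" by (metis norm_mult norm_one)
    moreover have "cmod \<mu> * cmod (z $ i) \<le> 1 * cmod (z $ i)"
      using mu by (intro mult_right_mono) auto
    ultimately show False using z[of i] by simp
  qed
next
  assume c: "\<forall>\<mu>\<in>cball 0 1. rev_eval c \<mu> \<noteq> 0"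
  obtain z where z: "c = elem_sym_vec z" using elem_sym_vec_surj .
  have "cmod (z $ i) < 1" for i
  proof (rule ccontr)
    assume "\<not> cmod (z $ i) < 1"
    then have k: "1 / z $ i \<in> cball 0 1" "z $ i \<noteq> 0"
      by (auto simp: norm_divide divide_le_eq_1)
    have "(\<Prod>j\<in>UNIV. 1 - 1 / z $ i * z $ j) = 0"
      by (rule prod_zero) (use k in auto)
    then have "rev_eval c (1 / z $ i) = 0"
      by (simp only: z rev_eval_elem_sym)
    then show False using c k(1) by blast
  qed
  then show "c \<in> symmetrized_polydisc"
    unfolding symmetrized_polydisc_def z elem_sym_vec_def by blast
qed

text \<open>The ball is a union of full fibres, so every flow that preserves
  \<open>spectral_fibration\<close> stays inside it.\<close>

lemma spectral_ball_iff_fibration: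
  "(A :: ('n::{finite,linorder}) cmatrix) \<in> spectral_ball \<longleftrightarrow> spectral_fibration A \<in> symmetrized_polydisc"
  by (simp add: spectral_ball_iff_det symmetrized_polydisc_iff rev_eval_spectral_fibration)

lemma spectral_fibration_image:
  "spectral_fibration ` (spectral_ball :: ('n::{finite,linorder}) cmatrix set) = symmetrized_polydisc"
proof
  show "spectral_fibration ` (spectral_ball :: 'n cmatrix set) \<subseteq> symmetrized_polydisc"
    using spectral_ball_iff_fibration by auto
  show "(symmetrized_polydisc :: (complex ^ ('n::{finite,linorder})) set) \<subseteq> spectral_fibration ` spectral_ball"
  proof
    fix c :: "complex ^ ('n::{finite,linorder})" assume c: "c \<in> symmetrized_polydisc"
    obtain z where z: "c = elem_sym_vec z" using elem_sym_vec_surj .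
    define A :: "'n cmatrix"
      where "A = (\<chi> i j. if i = j then z $ i else 0)"
    have "spectral_fibration A = c"
    proof (rule rev_eval_inj)
      fix \<mu>
      have "det (mat 1 - \<mu> *\<^sub>C A) = (\<Prod>i\<in>UNIV. (mat 1 - \<mu> *\<^sub>C A) $ i $ i)"
        by (rule det_diagonal) (simp add: A_def mat_def)
      then show "rev_eval (spectral_fibration A) \<mu> = rev_eval c \<mu>"
        by (simp add: rev_eval_spectral_fibration z rev_eval_elem_sym A_def mat_def)
    qed
    with c spectral_ball_iff_fibration[of A] show "c \<in> spectral_fibration ` spectral_ball"
      by (auto intro: image_eqI[of _ _ A])
  qed
qed

text \<open>The complement is the projection of a closed set along a compact factor, hence
  closed.\<close>

lemma open_nonvanishing_on_disc:
  fixes f :: "'a::euclidean_space \<times> complex \<Rightarrow> complex"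
  assumes "continuous_on UNIV f"
  shows "open {x. \<forall>\<mu>\<in>cball 0 1. f (x, \<mu>) \<noteq> 0}"
proof -
  have c: "continuous_on UNIV (\<lambda>(\<mu>, x). f (x, \<mu>))"
    unfolding case_prod_beta
    by (rule continuous_on_compose2[OF assms]) (auto intro!: continuous_intros)
  have "closed ((\<lambda>(\<mu>, x). f (x, \<mu>)) -` {0})"
    by (rule continuous_closed_vimage[OF closed_singleton c[unfolded continuous_on_eq_continuous_at[OF open_UNIV], rule_format, OF UNIV_I]])
  from closed_compact_projection[OF compact_cball this, of 0 1]
  have "closed {x. \<exists>\<mu>\<in>cball 0 1. f (x, \<mu>) = 0}"
    by (simp add: Bex_def)
  then have "open (- {x. \<exists>\<mu>\<in>cball 0 1. f (x, \<mu>) = 0})" by (rule open_Compl)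
  also have "- {x. \<exists>\<mu>\<in>cball 0 1. f (x, \<mu>) = 0} = {x. \<forall>\<mu>\<in>cball 0 1. f (x, \<mu>) \<noteq> 0}" by auto
  finally show ?thesis .
qed

lemma open_spectral_ball: "open (spectral_ball :: (complex ^ 'n ^ 'n) set)"
proof -
  have "(spectral_ball :: (complex ^ 'n ^ 'n) set)
      = {A. \<forall>\<mu>\<in>cball 0 1. (\<lambda>(A, \<mu>). det (mat 1 - \<mu> *\<^sub>C A)) (A, \<mu>) \<noteq> 0}"
    using spectral_ball_iff_det by auto
  also have "open \<dots>"
    unfolding det_def split_beta
    by (intro open_nonvanishing_on_disc) (auto intro!: continuous_intros)
  finally show ?thesis .
qed

lemma open_symmetrized_polydisc: "open (symmetrized_polydisc :: (complex ^ ('n::{finite,linorder})) set)"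
proof -
  have "(symmetrized_polydisc :: (complex ^ ('n::{finite,linorder})) set)
      = {c. \<forall>\<mu>\<in>cball 0 1. (\<lambda>(c, \<mu>). rev_eval c \<mu>) (c, \<mu>) \<noteq> 0}"
    using symmetrized_polydisc_iff by auto
  also have "open \<dots>"
    unfolding rev_eval_def split_beta
    by (intro open_nonvanishing_on_disc) (auto intro!: continuous_intros)
  finally show ?thesis .
qed

lemma scaleC_minus_right [simp]: "c *\<^sub>C (- x) = - (c *\<^sub>C (x :: 'a::complex_normed_space))"
  using scaleC_diff_right[of c 0 x] by simp

lemma matrix_minus_right [simp]: "A ** (- B) = - (A ** B)" for A :: "'a::ring_1 ^ 'n ^ 'm"
  using matrix_diff_ldistrib[of A 0 B] by simp

lemma matrix_minus_left [simp]: "(- A) ** B = - (A ** B)" for A :: "'a::ring_1 ^ 'n ^ 'm"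
  using matrix_diff_rdistrib[of 0 A B] by simp

section \<open>Derivatives of polynomial maps\<close>

lemma scaleC_scaleR: "(r *\<^sub>R c) *\<^sub>C (x :: 'a::complex_normed_space) = r *\<^sub>R c *\<^sub>C x"
  "c *\<^sub>C r *\<^sub>R x = r *\<^sub>R c *\<^sub>C x"
proof -
  show "(r *\<^sub>R c) *\<^sub>C x = r *\<^sub>R c *\<^sub>C x"
    by (simp add: scaleR_conv_of_real flip: scaleC_of_real scaleC_scaleC)
  show "c *\<^sub>C r *\<^sub>R x = r *\<^sub>R c *\<^sub>C x"
    by (simp add: scaleC_scaleC mult.commute flip: scaleC_of_real)
qed

lemma bounded_bilinear_scaleC: "bounded_bilinear ((*\<^sub>C) :: complex \<Rightarrow> 'a \<Rightarrow> 'a::complex_normed_space)"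
  by unfold_locales
    (auto simp: scaleC_add_left scaleC_add_right scaleC_scaleR norm_scaleC intro: exI[of _ 1])

lemmas has_derivative_scaleC = bounded_bilinear.FDERIV[OF bounded_bilinear_scaleC]

lemma complex_linear_mapD:
  assumes "complex_linear_map f"
  shows "f (x + y) = f x + f y" "f (c *\<^sub>C x) = c *\<^sub>C f x" "f 0 = 0" "f (x - y) = f x - f y"
proof -
  show 1: "f (x + y) = f x + f y" "f (c *\<^sub>C x) = c *\<^sub>C f x" for x y c
    using assms by (auto simp: complex_linear_map_def)
  show "f 0 = 0" using 1(2)[of 0 0] by simp
  show "f (x - y) = f x - f y" using 1(1)[of "x - y" y] by simp
qed

lemma complex_linear_map_sum: "complex_linear_map f \<Longrightarrow> f (\<Sum>i\<in>I. g i) = (\<Sum>i\<in>I. f (g i))"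
  by (induction I rule: infinite_finite_induct) (auto simp: complex_linear_mapD)

lemma has_derivative_vec_lambda:
  fixes f :: "'a::real_normed_vector \<Rightarrow> 'b::real_normed_vector ^ 'n"
  assumes "\<And>i. ((\<lambda>x. f x $ i) has_derivative (\<lambda>h. f' h $ i)) F"
  shows "(f has_derivative f') F"
proof -
  have ax: "bounded_linear (axis i :: 'b \<Rightarrow> 'b ^ 'n)" for i
  proof (rule bounded_linear_intro)
    show "norm (axis i x :: 'b ^ 'n) \<le> norm x * 1" for x
    proof -
      have "norm (axis i x :: 'b ^ 'n) \<le> (\<Sum>j\<in>UNIV. norm ((axis i x :: 'b ^ 'n) $ j))"
        by (simp add: norm_vec_def L2_set_le_sum)
      also have "\<dots> = norm x"
        by (simp add: axis_def if_distrib cong: if_cong)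
      finally show ?thesis by simp
    qed
  qed (auto simp: vec_eq_iff axis_def)
  have "((\<lambda>x. \<Sum>i\<in>UNIV. axis i (f x $ i)) has_derivative (\<lambda>h. \<Sum>i\<in>UNIV. axis i (f' h $ i))) F"
    by (intro has_derivative_sum bounded_linear.has_derivative[OF ax] assms)
  moreover have "(\<Sum>i\<in>UNIV. axis i (x $ i)) = x" for x :: "'b ^ 'n"
    by (simp add: vec_eq_iff axis_def if_distrib cong: if_cong)
  ultimately show ?thesis by simp
qed

text \<open>Polynomials of mixed degree, for functions whose homogeneity is not visible or only
  proved later.\<close>

inductive poly_fun :: "(complex ^ 'n ^ 'n \<Rightarrow> complex) \<Rightarrow> bool" where
  pf_hom: "hom_poly d P \<Longrightarrow> poly_fun P"
| pf_add: "poly_fun P \<Longrightarrow> poly_fun Q \<Longrightarrow> poly_fun (\<lambda>A. P A + Q A)"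

lemma pf_const: "poly_fun (\<lambda>A. c)"
  by (rule pf_hom[OF hp_const])

lemma pf_sum: "(\<And>i. i \<in> I \<Longrightarrow> poly_fun (P i)) \<Longrightarrow> poly_fun (\<lambda>A. \<Sum>i\<in>I. P i A)"
  by (induction I rule: infinite_finite_induct) (auto intro: pf_const pf_add)

lemma pf_mult: "poly_fun P \<Longrightarrow> poly_fun Q \<Longrightarrow> poly_fun (\<lambda>A. P A * Q A)"
proof (induction rule: poly_fun.induct)
  case (pf_hom d P)
  from pf_hom.prems pf_hom.hyps show ?case
    by (induction rule: poly_fun.induct)
      (auto simp: distrib_left intro: poly_fun.intros hp_mult)
qed (auto simp: distrib_right intro: poly_fun.intros)

lemma pf_cmult: "poly_fun P \<Longrightarrow> poly_fun (\<lambda>A. c * P A)"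
  by (intro pf_mult pf_const)

lemma hp_has_derivative:
  "hom_poly d P \<Longrightarrow> \<exists>D. (P has_derivative D) (at A) \<and> complex_linear_map D"
proof (induction rule: hom_poly.induct)
  case (hp_coord d P i j)
  then obtain D where D: "(P has_derivative D) (at A)" "complex_linear_map D" by blast
  have "((\<lambda>A. A $ i $ j * P A) has_derivative (\<lambda>h. A $ i $ j * D h + h $ i $ j * P A)) (at A)"
    by (intro has_derivative_mult D bounded_linear_imp_has_derivative
        bounded_linear_compose[OF bounded_linear_vec_nth bounded_linear_vec_nth])
  moreover have "complex_linear_map (\<lambda>h. A $ i $ j * D h + h $ i $ j * P A)"
    using D(2) by (auto simp: complex_linear_map_def algebra_simps)
  ultimately show ?case by blast
next
  case (hp_add d P Q)
  then obtain D E where "(P has_derivative D) (at A)" "complex_linear_map D"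
    "(Q has_derivative E) (at A)" "complex_linear_map E" by blast
  then show ?case
    by (intro exI[of _ "\<lambda>h. D h + E h"])
      (auto intro: has_derivative_add simp: complex_linear_map_def algebra_simps)
qed (auto intro!: exI[of _ "\<lambda>_. 0"] simp: complex_linear_map_def)

lemma pf_has_derivative:
  "poly_fun P \<Longrightarrow> \<exists>D. (P has_derivative D) (at A) \<and> complex_linear_map D"
proof (induction rule: poly_fun.induct)
  case (pf_add P Q)
  then obtain D E where "(P has_derivative D) (at A)" "complex_linear_map D"
    "(Q has_derivative E) (at A)" "complex_linear_map E" by blast
  then show ?case
    by (intro exI[of _ "\<lambda>h. D h + E h"])
      (auto intro: has_derivative_add simp: complex_linear_map_def algebra_simps)
qed (rule hp_has_derivative)

lemma holomorphic_map_on_vec: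
  fixes f :: "'a::complex_normed_space \<Rightarrow> 'b::complex_normed_space ^ 'm"
  assumes "\<And>i. holomorphic_map_on (\<lambda>x. f x $ i) U"
  shows "holomorphic_map_on f U"
  unfolding holomorphic_map_on_def
proof
  fix x assume "x \<in> U"
  then have "\<forall>i. \<exists>D. ((\<lambda>x. f x $ i) has_derivative D) (at x) \<and> complex_linear_map D"
    using assms by (auto simp: holomorphic_map_on_def)
  then obtain D where D: "\<And>i. ((\<lambda>x. f x $ i) has_derivative D i) (at x)" "\<And>i. complex_linear_map (D i)"
    by metis
  have "(f has_derivative (\<lambda>h. \<chi> i. D i h)) (at x)"
    by (rule has_derivative_vec_lambda) (simp add: D)
  moreover have "complex_linear_map (\<lambda>h. \<chi> i. D i h)"
    using D(2) by (simp add: complex_linear_map_def vec_eq_iff)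
  ultimately show "\<exists>D. (f has_derivative D) (at x) \<and> complex_linear_map D" by blast
qed

lemma holomorphic_map_on_hpm: "hom_poly_mat d F \<Longrightarrow> holomorphic_map_on F U"
  by (intro holomorphic_map_on_vec)
    (use hp_has_derivative[OF hpm_nth] in \<open>auto simp: holomorphic_map_on_def\<close>)

lemma pf_coeff_prod:
  assumes "finite I"
  shows "poly_fun (\<lambda>A. coeff (\<Prod>i\<in>I. (if i = p i then [:0, 1:] else 0) - [:A $ i $ p i:]) k)"
  using assms
proof (induction I arbitrary: k rule: finite_induct)
  case (insert i I)
  let ?Q = "\<lambda>A. \<Prod>i\<in>I. (if i = p i then [:0, 1:] else 0) - [:A $ i $ p i:]"
  let ?d = "if i = p i then 1 else 0 :: complex"
  have "coeff (\<Prod>i\<in>insert i I. (if i = p i then [:0, 1:] else 0) - [:A $ i $ p i:]) k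
      = ?d * (case k of 0 \<Rightarrow> 0 | Suc m \<Rightarrow> coeff (?Q A) m) + -1 * (A $ i $ p i * coeff (?Q A) k)" for A
    using insert.hyps by (simp add: coeff_pCons split: nat.split)
  moreover have "poly_fun (\<lambda>A. ?d * (case k of 0 \<Rightarrow> 0 | Suc m \<Rightarrow> coeff (?Q A) m) + -1 * (A $ i $ p i * coeff (?Q A) k))"
    by (intro pf_add pf_cmult pf_mult pf_hom[OF hp_nth] insert.IH)
      (cases k, simp_all add: pf_const insert.IH)
  ultimately show ?case by simp
qed (simp add: pf_const)

lemma pf_coeff_charpoly: "poly_fun (\<lambda>A. coeff (matrix_charpoly A) k)"
proof -
  have "coeff (of_int s * q) k = of_int s * coeff q k" for s and q :: "complex poly"
    by (simp add: of_int_poly)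
  then show ?thesis
    unfolding matrix_charpoly_def det_def coeff_sum vec_lambda_beta
    by (auto intro!: pf_sum pf_cmult pf_coeff_prod)
qed

lemma holomorphic_spectral_fibration: "holomorphic_map_on spectral_fibration U"
  using pf_has_derivative[OF pf_cmult[OF pf_coeff_charpoly]]
  by (intro holomorphic_map_on_vec) (auto simp: spectral_fibration_def holomorphic_map_on_def)

lemma frechet_spectral_fibration:
  obtains D where "(spectral_fibration has_derivative D) (at A)" "complex_linear_map D"
    "D = frechet_derivative spectral_fibration (at A)"
proof -
  obtain D where D: "(spectral_fibration has_derivative D) (at A)" "complex_linear_map D"
    using holomorphic_spectral_fibration[of UNIV] by (auto simp: holomorphic_map_on_def)
  from that[OF D frechet_derivative_at[OF D(1)]] show thesis .
qed

section \<open>Vertical fields annihilate the traces of powers\<close>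

text \<open>A permutation other than the identity moves at least two indices, so its Leibniz term
  vanishes to second order at 0.\<close>

lemma det_derivative_at_one:
  fixes X :: "complex ^ 'n ^ 'n"
  shows "((\<lambda>t. det (mat 1 + t *\<^sub>C X)) has_field_derivative trace X) (at 0)"
proof -
  let ?d = "\<lambda>p i. if i = p i then 1 else 0 :: complex"
  let ?D = "\<lambda>p. \<Sum>i\<in>UNIV. X $ i $ p i * (\<Prod>j\<in>UNIV - {i}. ?d p j)"
  have m: "(mat 1 + t *\<^sub>C X) $ i $ j = (if i = j then 1 else 0) + t * X $ i $ j" for t i j
    by (simp add: mat_def)
  have "((\<lambda>t. det (mat 1 + t *\<^sub>C X)) has_field_derivative
      (\<Sum>p | p permutes UNIV. of_int (sign p) * ?D p)) (at 0)"
    unfolding det_def m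
  proof (intro DERIV_sum DERIV_cmult)
    fix p :: "'n \<Rightarrow> 'n"
    have "((\<lambda>t. \<Prod>i\<in>UNIV. ?d p i + t * X $ i $ p i) has_field_derivative
        (\<Sum>i\<in>UNIV. X $ i $ p i * (\<Prod>j\<in>UNIV - {i}. ?d p j + 0 * X $ j $ p j))) (at 0)"
      by (rule has_field_derivative_prod) (auto intro!: derivative_eq_intros)
    then show "((\<lambda>t. \<Prod>i\<in>UNIV. ?d p i + t * X $ i $ p i) has_field_derivative ?D p) (at 0)"
      by simp
  qed
  moreover have "?D p = 0" if p: "p permutes UNIV" "p \<noteq> id" for p
  proof (rule sum.neutral, rule ballI)
    fix i
    have "\<exists>j. j \<noteq> i \<and> p j \<noteq> j"
    proof (rule ccontr)
      assume *: "\<not> ?thesis"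
      have "p i = i"
      proof (rule ccontr)
        assume "p i \<noteq> i"
        with * have "p (p i) = p i" by blast
        then show False using permutes_inj[OF p(1)] \<open>p i \<noteq> i\<close> by (auto dest: injD)
      qed
      with * p(2) show False by (auto simp: fun_eq_iff)
    qed
    then obtain j where "j \<noteq> i" "p j \<noteq> j" by blast
    then have "(\<Prod>j\<in>UNIV - {i}. ?d p j) = 0"
      by (intro prod_zero) (auto intro!: bexI[of _ j])
    then show "X $ i $ p i * (\<Prod>j\<in>UNIV - {i}. ?d p j) = 0" by simp
  qed
  then have "(\<Sum>p | p permutes UNIV. of_int (sign p) * ?D p) = (\<Sum>p\<in>{id}. of_int (sign p) * ?D p)"
    by (intro sum.mono_neutral_right) (auto simp: permutes_id)
  then have "(\<Sum>p | p permutes UNIV. of_int (sign p) * ?D p) = trace X"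
    by (simp add: trace_def)
  ultimately show ?thesis by simp
qed

text \<open>The entrywise l1 norm: submultiplicative and a bound for the trace, as the resolvent
  estimate requires.\<close>

definition entry_sum :: "complex ^ 'n ^ 'n \<Rightarrow> real"
  where "entry_sum A = (\<Sum>i\<in>UNIV. \<Sum>j\<in>UNIV. cmod (A $ i $ j))"

lemma entry_sum_nonneg: "0 \<le> entry_sum A"
  by (simp add: entry_sum_def sum_nonneg)

lemma entry_sum_mult: "entry_sum (A ** B) \<le> entry_sum A * entry_sum B"
proof -
  have "entry_sum (A ** B) \<le> (\<Sum>i\<in>UNIV. \<Sum>j\<in>UNIV. \<Sum>k\<in>UNIV. cmod (A $ i $ k) * cmod (B $ k $ j))"
    unfolding entry_sum_def matrix_matrix_mult_def vec_lambda_beta norm_mult[symmetric]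
    by (intro sum_mono norm_sum)
  also have "\<dots> = (\<Sum>i\<in>UNIV. \<Sum>k\<in>UNIV. cmod (A $ i $ k) * (\<Sum>j\<in>UNIV. cmod (B $ k $ j)))"
    unfolding sum_distrib_left by (intro sum.cong refl sum.swap)
  also have "\<dots> \<le> (\<Sum>i\<in>UNIV. \<Sum>k\<in>UNIV. cmod (A $ i $ k) * entry_sum B)"
    unfolding entry_sum_def
    by (intro sum_mono mult_left_mono member_le_sum) (auto simp: sum_nonneg)
  also have "\<dots> = entry_sum A * entry_sum B"
    by (simp add: entry_sum_def sum_distrib_right)
  finally show ?thesis .
qed

lemma entry_sum_add: "entry_sum (A + B) \<le> entry_sum A + entry_sum B"
  unfolding entry_sum_def sum.distrib[symmetric] by (intro sum_mono) (simp add: norm_triangle_ineq)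

lemma entry_sum_scaleC: "entry_sum (c *\<^sub>C A) = cmod c * entry_sum A"
  by (simp add: entry_sum_def norm_mult sum_distrib_left)

lemma norm_trace_le: "cmod (trace A) \<le> entry_sum A"
proof -
  have "cmod (trace A) \<le> (\<Sum>i\<in>UNIV. cmod (A $ i $ i))"
    unfolding trace_def by (rule norm_sum)
  also have "\<dots> \<le> entry_sum A"
    unfolding entry_sum_def by (intro sum_mono member_le_sum) auto
  finally show ?thesis .
qed

text \<open>\<open>det (1 - \<mu> A)\<close> depends on \<open>A\<close> only through
  \<open>spectral_fibration A\<close>, so its derivative along \<open>T\<close> is 0. By Jacobi's
  formula that derivative is \<open>- \<mu> det (1 - \<mu> A) trace (R T)\<close>.\<close>

lemma resolvent_trace_zero:
  fixes A T :: "('n::{finite,linorder}) cmatrix"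
  assumes v: "frechet_derivative spectral_fibration (at A) T = 0"
    and mu: "\<mu> \<noteq> 0" and R: "(mat 1 - \<mu> *\<^sub>C A) ** R = mat 1"
  shows "trace (R ** T) = 0"
proof -
  obtain D where D: "(spectral_fibration has_derivative D) (at A)" "complex_linear_map D"
    "D = frechet_derivative spectral_fibration (at A)"
    by (rule frechet_spectral_fibration)
  let ?M = "mat 1 - \<mu> *\<^sub>C A"
  have lin: "((\<lambda>t. A + t *\<^sub>C T) has_derivative (\<lambda>h. h *\<^sub>C T)) (at 0)"
    using has_derivative_add[OF has_derivative_const has_derivative_scaleC[OF has_derivative_ident has_derivative_const]]
    by fastforce
  have "((\<lambda>t. spectral_fibration (A + t *\<^sub>C T)) has_derivative (\<lambda>h. D (h *\<^sub>C T))) (at 0)"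
    by (rule has_derivative_compose[OF lin]) (use D(1) in simp)
  then have "((\<lambda>t. spectral_fibration (A + t *\<^sub>C T)) has_derivative (\<lambda>h. 0)) (at 0)"
    using v D by (simp add: complex_linear_mapD(2))
  then have c: "((\<lambda>t. spectral_fibration (A + t *\<^sub>C T) $ j) has_derivative (\<lambda>h. 0)) (at 0)" for j
    using bounded_linear.has_derivative[OF bounded_linear_vec_nth] by fastforce
  have "((\<lambda>t. rev_eval (spectral_fibration (A + t *\<^sub>C T)) \<mu>) has_derivative (\<lambda>h. 0)) (at 0)"
    unfolding rev_eval_def by (auto intro!: derivative_eq_intros c)
  then have 1: "((\<lambda>t. det (mat 1 - \<mu> *\<^sub>C (A + t *\<^sub>C T))) has_field_derivative 0) (at 0)"
    by (simp add: rev_eval_spectral_fibration has_field_derivative_def lambda_zero)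
  have eq: "mat 1 - \<mu> *\<^sub>C (A + t *\<^sub>C T) = ?M ** (mat 1 + t *\<^sub>C ((- \<mu>) *\<^sub>C (R ** T)))" for t
  proof -
    have "?M ** (mat 1 + t *\<^sub>C ((- \<mu>) *\<^sub>C (R ** T))) = ?M - (t * \<mu>) *\<^sub>C (?M ** (R ** T))"
      by (simp add: matrix_diff_ldistrib scaleC_scaleC)
    also have "?M ** (R ** T) = T"
      by (simp add: matrix_mul_assoc R)
    finally show ?thesis
      by (simp add: scaleC_add_right scaleC_scaleC mult.commute)
  qed
  have "((\<lambda>t. det (mat 1 - \<mu> *\<^sub>C (A + t *\<^sub>C T))) has_field_derivative det ?M * trace ((- \<mu>) *\<^sub>C (R ** T))) (at 0)"
    unfolding eq det_mul by (intro DERIV_cmult det_derivative_at_one)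
  from DERIV_unique[OF 1 this] have "det ?M * (\<mu> * trace (R ** T)) = 0"
    unfolding trace_scaleC by simp
  moreover have "det ?M \<noteq> 0"
    using arg_cong[OF R, of det] by (auto simp: det_mul)
  ultimately show ?thesis using mu by simp
qed

text \<open>By the Neumann series, \<open>trace (R T)\<close> is the generating function of the
  numbers \<open>trace (A^j T)\<close>. Instead of expanding it, the identity
  \<open>R = 1 + \<mu> A R\<close> peels off one coefficient at a time, and \<open>\<mu>\<close>
  tends to 0.\<close>

theorem vertical_trace_zero:
  fixes A T :: "('n::{finite,linorder}) cmatrix"
  assumes v: "frechet_derivative spectral_fibration (at A) T = 0"
  shows "trace (mat_pow A N ** T) = 0"
proof (induction N rule: less_induct)
  case (less N)
  let ?s = "entry_sum"
  \<comment> \<open>The factor 2 bounds the resolvent: \<open>cmod \<mu> * entry_sum A < 1/2\<close>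
    gives \<open>entry_sum R \<le> 2 * entry_sum (mat 1)\<close>.\<close>
  define K where "K = ?s (mat_pow A (Suc N)) * (2 * ?s (mat 1 :: 'n cmatrix)) * ?s T"
  have ev: "\<forall>\<^sub>F \<mu> in at 0. cmod (trace (mat_pow A N ** T)) \<le> cmod \<mu> * K"
  proof -
    have "continuous_on UNIV (\<lambda>\<mu>. det (mat 1 - \<mu> *\<^sub>C A))"
      unfolding det_def by (auto intro!: continuous_intros)
    then have "((\<lambda>\<mu>. det (mat 1 - \<mu> *\<^sub>C A)) \<longlongrightarrow> det (mat 1 - 0 *\<^sub>C A)) (at 0)"
      by (metis UNIV_I continuous_on_def)
    then have e1: "\<forall>\<^sub>F \<mu> in at 0. det (mat 1 - \<mu> *\<^sub>C A) \<noteq> 0"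
      by (rule tendsto_imp_eventually_ne) simp
    have "((\<lambda>\<mu>. cmod \<mu> * ?s A) \<longlongrightarrow> cmod 0 * ?s A) (at 0)"
      by (intro tendsto_intros)
    then have e2: "\<forall>\<^sub>F \<mu> in at 0. cmod \<mu> * ?s A < 1/2"
      by (rule order_tendstoD(2)) simp
    have e3: "\<forall>\<^sub>F \<mu> in at (0::complex). \<mu> \<noteq> 0"
      by (simp add: eventually_at_filter)
    show ?thesis using e1 e2 e3
    proof eventually_elim
      case (elim \<mu>)
      obtain R where R: "(mat 1 - \<mu> *\<^sub>C A) ** R = mat 1"
        using elim(1) by (meson invertible_det_nz invertible_right_inverse)
      have R1: "R = mat 1 + \<mu> *\<^sub>C (A ** R)"
        using R by (simp add: matrix_diff_rdistrib algebra_simps)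
      have "?s R \<le> ?s (mat 1 :: 'n cmatrix) + cmod \<mu> * (?s A * ?s R)"
        using arg_cong[OF R1, of ?s] entry_sum_add[of "mat 1" "\<mu> *\<^sub>C (A ** R)"]
          mult_left_mono[OF entry_sum_mult[of A R] norm_ge_zero, of \<mu>]
        unfolding entry_sum_scaleC by linarith
      moreover have "cmod \<mu> * ?s A * ?s R \<le> 1/2 * ?s R"
        using elim(2) by (intro mult_right_mono entry_sum_nonneg) simp
      ultimately have sR: "?s R \<le> 2 * ?s (mat 1 :: 'n cmatrix)"
        by (simp add: mult.assoc)
      have split: "trace (mat_pow A m ** (R ** T)) =
          trace (mat_pow A m ** T) + \<mu> * trace (mat_pow A (Suc m) ** (R ** T))" for m
        by (subst R1) (simp add: matrix_add_rdistrib matrix_add_ldistrib matrix_mul_assoc mat_pow_commute trace_add)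
      have "trace (mat_pow A m ** (R ** T)) = 0" if "m \<le> N" for m
        using that
      proof (induction m)
        case 0
        then show ?case using resolvent_trace_zero[OF v elim(3) R] by simp
      next
        case (Suc m)
        then show ?case
          using split[of m] less.IH[of m] elim(3) by (simp del: mat_pow.simps)
      qed
      then have "trace (mat_pow A N ** T) = - \<mu> * trace (mat_pow A (Suc N) ** (R ** T))"
        using split[of N] by (simp add: eq_neg_iff_add_eq_0 del: mat_pow.simps)
      then have "cmod (trace (mat_pow A N ** T)) \<le> cmod \<mu> * ?s (mat_pow A (Suc N) ** (R ** T))"
        by (simp add: norm_mult mult_left_mono norm_trace_le del: mat_pow.simps)
      also have "\<dots> \<le> cmod \<mu> * K"
      proof (rule mult_left_mono)
        have "?s (mat_pow A (Suc N) ** (R ** T)) \<le> ?s (mat_pow A (Suc N)) * ?s (R ** T)"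
          by (rule entry_sum_mult)
        also have "\<dots> \<le> ?s (mat_pow A (Suc N)) * (?s R * ?s T)"
          by (intro mult_left_mono entry_sum_mult entry_sum_nonneg)
        also have "\<dots> \<le> K"
          unfolding K_def mult.assoc
          by (intro mult_left_mono mult_right_mono sR[unfolded mult.assoc] entry_sum_nonneg
              order_trans[OF mult_right_mono[OF sR entry_sum_nonneg]]) simp
        finally show "?s (mat_pow A (Suc N) ** (R ** T)) \<le> K" .
      qed simp
      finally show ?case .
    qed
  qed
  have "((\<lambda>\<mu>. cmod \<mu> * K) \<longlongrightarrow> cmod 0 * K) (at (0::complex))"
    by (intro tendsto_intros)
  then have "cmod (trace (mat_pow A N ** T)) \<le> cmod 0 * K"
    by (rule tendsto_lowerbound[OF _ ev at_neq_bot])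
  then show ?case by simp
qed

section \<open>Complete vertical fields\<close>

lemma spectral_fibration_conj:
  fixes A :: "('n::{finite,linorder}) cmatrix"
  assumes "P ** Q = mat 1"
  shows "spectral_fibration (Q ** A ** P) = spectral_fibration A"
proof (rule rev_eval_inj)
  fix \<mu>
  have QP: "Q ** P = mat 1" using assms matrix_left_right_inverse by blast
  have "mat 1 - \<mu> *\<^sub>C (Q ** A ** P) = Q ** (mat 1 - \<mu> *\<^sub>C A) ** P"
    by (simp add: matrix_diff_ldistrib matrix_diff_rdistrib QP)
  moreover have "det Q * det P = 1"
    using arg_cong[OF QP, of det] by (simp add: det_mul)
  then have "det (Q ** (mat 1 - \<mu> *\<^sub>C A) ** P) = det (mat 1 - \<mu> *\<^sub>C A)"
    by (simp add: det_mul)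
  ultimately show "rev_eval (spectral_fibration (Q ** A ** P)) \<mu> = rev_eval (spectral_fibration A) \<mu>"
    by (simp add: rev_eval_spectral_fibration)
qed

text \<open>If \<open>B\<^sup>2 = \<beta> B\<close> with \<open>\<beta> \<in> {0, 1}\<close>, then \<open>exp (s B) = 1 + exp_coeff \<beta> s B\<close>, which
  avoids the matrix exponential.\<close>

definition exp_coeff :: "complex \<Rightarrow> complex \<Rightarrow> complex"
  where "exp_coeff \<beta> s = (if \<beta> = 0 then s else exp s - 1)"

definition conj_flow :: "complex \<Rightarrow> complex ^ 'n ^ 'n \<Rightarrow> complex \<Rightarrow> complex ^ 'n ^ 'n \<Rightarrow> complex ^ 'n ^ 'n"
  where "conj_flow \<beta> B s A = (mat 1 + exp_coeff \<beta> (- s) *\<^sub>C B) ** A ** (mat 1 + exp_coeff \<beta> s *\<^sub>C B)"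

lemma exp_coeff_zero [simp]: "exp_coeff \<beta> 0 = 0"
  by (simp add: exp_coeff_def)

text \<open>The law \<open>exp (s B) exp (t B) = exp ((s + t) B)\<close>, read off at the
  coefficient of \<open>B\<close>.\<close>

lemma exp_coeff_inverse:
  assumes "\<beta> = 0 \<or> \<beta> = 1"
  shows "exp_coeff \<beta> s + exp_coeff \<beta> t + exp_coeff \<beta> s * exp_coeff \<beta> t * \<beta> = exp_coeff \<beta> (s + t)"
  using assms by (auto simp: exp_coeff_def algebra_simps exp_add)

lemma exp_coeff_has_derivative:
  assumes "\<beta> = 0 \<or> \<beta> = 1"
  shows "(exp_coeff \<beta> has_field_derivative 1 + \<beta> * exp_coeff \<beta> s) (at s)"
  using assms unfolding exp_coeff_def
  by (cases "\<beta> = 0") (auto intro!: derivative_eq_intros)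

lemma conj_flow_zero [simp]: "conj_flow \<beta> B 0 A = A"
  by (simp add: conj_flow_def)

lemma conj_flow_inverse:
  fixes B :: "complex ^ 'n ^ 'n"
  assumes "\<beta> = 0 \<or> \<beta> = 1" "B ** B = \<beta> *\<^sub>C B"
  shows "(mat 1 + exp_coeff \<beta> s *\<^sub>C B) ** (mat 1 + exp_coeff \<beta> (- s) *\<^sub>C B) = mat 1"
proof -
  have "(mat 1 + exp_coeff \<beta> s *\<^sub>C B) ** (mat 1 + exp_coeff \<beta> (- s) *\<^sub>C B)
      = mat 1 + (exp_coeff \<beta> s + exp_coeff \<beta> (- s) + exp_coeff \<beta> s * exp_coeff \<beta> (- s) * \<beta>) *\<^sub>C B"
    by (simp add: matrix_add_ldistrib matrix_add_rdistrib assms(2) scaleC_add_left scaleC_add_right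
        scaleC_scaleC ac_simps)
  also have "\<dots> = mat 1"
    unfolding exp_coeff_inverse[OF assms(1)] by simp
  finally show ?thesis .
qed

lemma conj_flow_has_derivative:
  assumes b: "\<beta> = 0 \<or> \<beta> = 1" "B ** B = \<beta> *\<^sub>C B"
  shows "((\<lambda>s. conj_flow \<beta> B s A) has_derivative (\<lambda>h. h *\<^sub>C mcomm (conj_flow \<beta> B s A) B)) (at s)"
proof -
  let ?k = "exp_coeff \<beta>"
  let ?P = "A ** B" and ?Q = "B ** A" and ?R = "B ** A ** B"
  \<comment> \<open>The expansion has four fixed matrices with scalar coefficients, so only scalar
    functions have to be differentiated.\<close>
  have exp: "conj_flow \<beta> B s A = A + ?k s *\<^sub>C ?P + ?k (- s) *\<^sub>C ?Q + (?k s * ?k (- s)) *\<^sub>C ?R" for s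
    by (simp add: conj_flow_def matrix_add_ldistrib matrix_add_rdistrib scaleC_add_right scaleC_scaleC
        matrix_mul_assoc ac_simps)
  define k1 where "k1 = 1 + \<beta> * ?k s"
  define k2 where "k2 = 1 + \<beta> * ?k (- s)"
  have d1: "(?k has_field_derivative k1) (at s)"
    unfolding k1_def by (rule exp_coeff_has_derivative[OF b(1)])
  have d2: "((\<lambda>s. ?k (- s)) has_field_derivative - k2) (at s)"
    unfolding k2_def using DERIV_chain'[OF _ exp_coeff_has_derivative[OF b(1)], of uminus "-1" s]
    by (simp add: DERIV_minus DERIV_ident)
  have d3: "((\<lambda>s. ?k s * ?k (- s)) has_field_derivative (k1 * ?k (- s) - k2 * ?k s)) (at s)"
    using DERIV_mult[OF d1 d2] by (simp add: algebra_simps)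
  have sc: "((\<lambda>s. f s *\<^sub>C M) has_derivative (\<lambda>h. (f' * h) *\<^sub>C M)) (at s)"
    if "(f has_field_derivative f') (at s)" for f f' and M :: "complex ^ 'a ^ 'a"
    using has_derivative_scaleC[OF that[unfolded has_field_derivative_def] has_derivative_const] by simp
  have "((\<lambda>s. conj_flow \<beta> B s A) has_derivative
      (\<lambda>h. 0 + (k1 * h) *\<^sub>C ?P + (- k2 * h) *\<^sub>C ?Q + ((k1 * ?k (- s) - k2 * ?k s) * h) *\<^sub>C ?R)) (at s)"
    unfolding exp by (intro has_derivative_add has_derivative_const sc d1 d2 d3)
  moreover have "0 + (k1 * h) *\<^sub>C ?P + (- k2 * h) *\<^sub>C ?Q + ((k1 * ?k (- s) - k2 * ?k s) * h) *\<^sub>C ?R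
      = h *\<^sub>C mcomm (conj_flow \<beta> B s A) B" for h
  proof -
    have "mcomm (conj_flow \<beta> B s A) B = k1 *\<^sub>C ?P - k2 *\<^sub>C ?Q + (k1 * ?k (- s) - k2 * ?k s) *\<^sub>C ?R"
    proof -
      have "conj_flow \<beta> B s A ** B = k1 *\<^sub>C ?P + (k1 * ?k (- s)) *\<^sub>C ?R"
      proof -
        have "?P ** B = \<beta> *\<^sub>C ?P" "?R ** B = \<beta> *\<^sub>C ?R"
          using b(2) by (simp_all flip: matrix_mul_assoc)
        then show ?thesis
          by (simp add: exp k1_def matrix_add_rdistrib scaleC_add_left scaleC_scaleC algebra_simps)
      qed
      moreover have "B ** conj_flow \<beta> B s A = k2 *\<^sub>C ?Q + (k2 * ?k s) *\<^sub>C ?R"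
      proof -
        have "B ** ?P = ?R" "B ** ?Q = \<beta> *\<^sub>C ?Q" "B ** ?R = \<beta> *\<^sub>C ?R"
          using b(2) by (simp_all add: matrix_mul_assoc)
        then show ?thesis
          by (simp add: exp k2_def matrix_add_ldistrib scaleC_add_left scaleC_scaleC algebra_simps)
      qed
      ultimately show ?thesis
        unfolding mcomm_def by (simp add: scaleC_add_left algebra_simps vec_eq_iff)
    qed
    then show ?thesis
      by (simp only:) (simp add: vec_eq_iff algebra_simps)
  qed
  ultimately show ?thesis by simp
qed

text \<open>The field \<open>f \<delta>_B\<close> of the overview.\<close>

definition matrix_field :: "(complex ^ 'n ^ 'n \<Rightarrow> complex) \<Rightarrow> complex ^ 'n ^ 'n \<Rightarrow> complex ^ 'n ^ 'n \<Rightarrow> complex ^ 'n ^ 'n"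
  where "matrix_field f B A = f A *\<^sub>C mcomm A B"

lemma matrix_eq_sum_units: "B = (\<Sum>i\<in>UNIV. \<Sum>j\<in>UNIV. B $ i $ j *\<^sub>C matrix_unit i j)"
proof -
  have "(\<Sum>i\<in>UNIV. \<Sum>j\<in>UNIV. B $ i $ j * (if a = i \<and> b = j then 1 else 0)) = B $ a $ b" for a b
  proof -
    have "(\<Sum>j\<in>UNIV. B $ i $ j * (if a = i \<and> b = j then 1 else 0)) = (if a = i then B $ i $ b else 0)" for i
      by (simp add: if_distrib cong: if_cong)
    then show ?thesis by simp
  qed
  then show ?thesis
    by (simp add: vec_eq_iff matrix_unit_def)
qed

lemma matrix_unit_mult: "matrix_unit i j ** matrix_unit k l = (if j = k then 1 else 0) *\<^sub>C matrix_unit i l"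
proof -
  have "(\<Sum>m\<in>UNIV. (if a = i \<and> m = j then 1 else 0) * (if m = k \<and> b = l then 1 else 0))
      = (if j = k then 1 else 0) * (if a = i \<and> b = l then 1 else 0 :: complex)" for a b
  proof -
    have "(\<Sum>m\<in>UNIV. (if a = i \<and> m = j then 1 else 0) * (if m = k \<and> b = l then 1 else 0))
        = (\<Sum>m\<in>UNIV. if m = j then (if j = k then 1 else 0) * (if a = i \<and> b = l then 1 else 0 :: complex) else 0)"
      by (intro sum.cong) auto
    then show ?thesis by simp
  qed
  then show ?thesis
    by (simp add: vec_eq_iff matrix_matrix_mult_def matrix_unit_def)
qed

text \<open>By linearity \<open>B\<close> may be a matrix unit. Its square is itself or 0, so its
  conjugation flow is explicit, and \<open>spectral_fibration\<close> is constant along it.\<close>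

lemma frechet_fibration_mcomm:
  fixes A :: "('n::{finite,linorder}) cmatrix"
  shows "frechet_derivative spectral_fibration (at A) (mcomm A B) = 0"
proof -
  obtain D where D: "(spectral_fibration has_derivative D) (at A)" "complex_linear_map D"
    "D = frechet_derivative spectral_fibration (at A)"
    by (rule frechet_spectral_fibration)
  have unit: "D (mcomm A (matrix_unit i j)) = 0" for i j
  proof -
    let ?\<beta> = "if i = j then 1 else 0 :: complex" and ?E = "matrix_unit i j"
    have E: "?\<beta> = 0 \<or> ?\<beta> = 1" "?E ** ?E = ?\<beta> *\<^sub>C ?E"
      by (auto simp: matrix_unit_mult)
    have "((\<lambda>s. spectral_fibration (conj_flow ?\<beta> ?E s A)) has_derivative
        (\<lambda>h. D (h *\<^sub>C mcomm (conj_flow ?\<beta> ?E 0 A) ?E))) (at 0)"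
      by (rule has_derivative_compose[OF conj_flow_has_derivative[OF E]]) (use D(1) in simp)
    moreover have "spectral_fibration (conj_flow ?\<beta> ?E s A) = spectral_fibration A" for s
      unfolding conj_flow_def by (rule spectral_fibration_conj[OF conj_flow_inverse[OF E]])
    ultimately have "((\<lambda>s. spectral_fibration A) has_derivative (\<lambda>h. D (h *\<^sub>C mcomm A ?E))) (at 0)"
      by simp
    from has_derivative_unique[OF this has_derivative_const] have "D (1 *\<^sub>C mcomm A ?E) = 0"
      by (rule fun_cong)
    then show ?thesis by simp
  qed
  have "D (mcomm A B) = D (\<Sum>i\<in>UNIV. \<Sum>j\<in>UNIV. B $ i $ j *\<^sub>C mcomm A (matrix_unit i j))"
    by (subst matrix_eq_sum_units[of B]) (simp add: mcomm_sum_right)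
  also have "\<dots> = 0"
    by (simp add: complex_linear_map_sum[OF D(2)] complex_linear_mapD(2)[OF D(2)] unit)
  finally show ?thesis by (simp add: D(3))
qed

abbreviation vertical_fields :: "('n::{finite,linorder}) cmatrix set \<Rightarrow> ('n cmatrix \<Rightarrow> 'n cmatrix) set"
  where "vertical_fields \<equiv> tangent_holomorphic_fields spectral_fibration"

lemma tangent_mcomm:
  fixes F :: "('n::{finite,linorder}) cmatrix \<Rightarrow> 'n cmatrix"
  assumes "hom_poly_mat d F"
  shows "(\<lambda>A. mcomm A (F A)) \<in> vertical_fields U"
  unfolding tangent_holomorphic_fields_def
  using holomorphic_map_on_hpm[OF hpm_mcomm[OF hpm_id assms refl]] by (simp add: frechet_fibration_mcomm)

lemma tangent_matrix_field:
  fixes B :: "('n::{finite,linorder}) cmatrix"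
  assumes "hom_poly d f"
  shows "matrix_field f B \<in> vertical_fields U"
  using tangent_mcomm[OF hpm_scaleC[OF assms hpm_const refl], of B] by (simp add: matrix_field_def[abs_def])

text \<open>Along the conjugation flow of \<open>B\<close> the function \<open>f\<close> is affine in time, so the flow of
  \<open>f\<close> times the conjugation field is a reparametrization by the solution \<open>\<tau>\<close> of
  \<open>\<tau>' = f A + c A \<tau>\<close>.\<close>

lemma complete_matrix_field:
  fixes B :: "('n::{finite,linorder}) cmatrix"
  assumes b: "\<beta> = 0 \<or> \<beta> = 1" "B ** B = \<beta> *\<^sub>C B"
    and f: "\<And>A s. f (conj_flow \<beta> B s A) = f A + s * c A"
  shows "complex_complete_on spectral_ball (matrix_field f B)"
proof -
  define \<tau> where "\<tau> = (\<lambda>A t. f A * (if c A = 0 then t else (exp (c A * t) - 1) / c A))"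
  have dt: "((\<tau> A) has_field_derivative f A + \<tau> A t * c A) (at t)" for A t
    unfolding \<tau>_def by (cases "c A = 0") (auto intro!: derivative_eq_intros simp: field_simps)
  define \<phi> where "\<phi> = (\<lambda>t A. conj_flow \<beta> B (\<tau> A t) A)"
  have "\<phi> 0 A = A" for A
    by (simp add: \<phi>_def \<tau>_def)
  moreover have "\<phi> t A \<in> spectral_ball" if "A \<in> spectral_ball" for A t
  proof -
    have "spectral_fibration (\<phi> t A) = spectral_fibration A"
      unfolding \<phi>_def conj_flow_def by (rule spectral_fibration_conj[OF conj_flow_inverse[OF b]])
    then show ?thesis using that spectral_ball_iff_fibration by metis
  qed
  moreover have "((\<lambda>s. \<phi> s A) has_derivative (\<lambda>h. h *\<^sub>C matrix_field f B (\<phi> t A))) (at t)" for A t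
  proof -
    have "((\<lambda>s. \<phi> s A) has_derivative
        (\<lambda>h. ((f A + \<tau> A t * c A) * h) *\<^sub>C mcomm (conj_flow \<beta> B (\<tau> A t) A) B)) (at t)"
      unfolding \<phi>_def
      by (rule has_derivative_compose[OF dt[unfolded has_field_derivative_def] conj_flow_has_derivative[OF b]])
    then show ?thesis
      by (simp add: matrix_field_def \<phi>_def f scaleC_scaleC mult.commute)
  qed
  ultimately show ?thesis
    unfolding complex_complete_on_def by blast
qed

section \<open>The generated Lie algebra\<close>

abbreviation vertical_algebra :: "(('n::{finite,linorder}) cmatrix \<Rightarrow> 'n cmatrix) set"
  where "vertical_algebra \<equiv> generated_lie_algebra
    {\<Theta> \<in> vertical_fields spectral_ball. complex_complete_on spectral_ball \<Theta>}"

lemma vertical_algebra_sum: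
  "(\<And>i. i \<in> I \<Longrightarrow> V i \<in> vertical_algebra) \<Longrightarrow> (\<lambda>A. \<Sum>i\<in>I. V i A) \<in> vertical_algebra"
  by (induction I rule: infinite_finite_induct)
    (auto intro: generated_lie_algebra.zero generated_lie_algebra.add)

abbreviation trace_form :: "complex ^ 'n ^ 'n \<Rightarrow> complex ^ 'n ^ 'n \<Rightarrow> complex"
  where "trace_form X A \<equiv> trace (X ** A)"

lemma hp_trace_form: "hom_poly 1 (trace_form X)"
  using hp_trace[OF hpm_mult[OF hpm_const hpm_id refl]] by simp

lemma hp_trace_form_power: "hom_poly (int d) (\<lambda>A. trace_form X A ^ d)"
  using hp_power[OF hp_trace_form] by simp

text \<open>The derivative of \<open>trace_form X\<close> along a conjugation field is again a trace
  form. It vanishes for \<open>B = X\<close>, and it is a multiple of \<open>trace_form B\<close>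
  when \<open>B\<close> is an eigenvector of the commutator with \<open>X\<close>.\<close>

lemma trace_form_mcomm: "trace_form X (mcomm A B) = trace_form (mcomm B X) A"
proof -
  have "trace (X ** (A ** B)) = trace (B ** X ** A)"
    by (metis matrix_mul_assoc trace_mul_sym)
  moreover have "trace (X ** (B ** A)) = trace (X ** B ** A)"
    by (simp add: matrix_mul_assoc)
  ultimately show ?thesis
    by (simp add: mcomm_def matrix_diff_ldistrib matrix_diff_rdistrib trace_sub)
qed

lemma trace_form_has_derivative: "(trace_form X has_derivative trace_form X) (at A)"
proof -
  have "linear (trace_form X)"
    by (rule linearI) (simp_all add: matrix_add_ldistrib trace_add flip: scaleC_of_real)
  then show ?thesis by (rule linear_imp_has_derivative)
qed

lemma trace_form_power_has_derivative:
  "((\<lambda>A. trace_form X A ^ d) has_derivative (\<lambda>h. of_nat d * trace_form X h * trace_form X A ^ (d - 1))) (at A)"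
  by (rule has_derivative_power[OF trace_form_has_derivative])

lemma mcomm_add_left: "mcomm (A + B) C = mcomm A C + mcomm B C"
  by (simp add: mcomm_def matrix_add_ldistrib matrix_add_rdistrib)

lemma mcomm_jacobi: "mcomm (mcomm A B) C - mcomm (mcomm A C) B = mcomm A (mcomm B C)"
  by (simp add: mcomm_def matrix_diff_ldistrib matrix_diff_rdistrib matrix_mul_assoc)

lemma matrix_field_has_derivative:
  assumes "(f has_derivative f') (at A)"
  shows "(matrix_field f B has_derivative (\<lambda>h. f A *\<^sub>C mcomm h B + f' h *\<^sub>C mcomm A B)) (at A)"
proof -
  have "linear (\<lambda>A. mcomm A B)"
    by (rule linearI) (simp_all add: mcomm_add_left flip: scaleC_of_real)
  from has_derivative_scaleC[OF assms linear_imp_has_derivative[OF this]]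
  show ?thesis by (simp add: matrix_field_def[abs_def])
qed

text \<open>The product rule: two terms differentiate the coefficients, and the third is the bracket
  of the linear fields, which the Jacobi identity turns into a conjugation field.\<close>

lemma lie_bracket_matrix_field:
  assumes f: "(f has_derivative f') (at A)" and g: "(g has_derivative g') (at A)"
  shows "lie_bracket (matrix_field f B) (matrix_field g C) A =
    g' (matrix_field f B A) *\<^sub>C mcomm A C - f' (matrix_field g C A) *\<^sub>C mcomm A B
    + (f A * g A) *\<^sub>C mcomm A (mcomm B C)"
proof -
  have "lie_bracket (matrix_field f B) (matrix_field g C) A =
      (g A *\<^sub>C mcomm (matrix_field f B A) C + g' (matrix_field f B A) *\<^sub>C mcomm A C)
      - (f A *\<^sub>C mcomm (matrix_field g C A) B + f' (matrix_field g C A) *\<^sub>C mcomm A B)"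
    unfolding lie_bracket_def
    by (simp add: frechet_derivative_at[OF matrix_field_has_derivative[OF f], symmetric]
        frechet_derivative_at[OF matrix_field_has_derivative[OF g], symmetric])
  also have "\<dots> = g' (matrix_field f B A) *\<^sub>C mcomm A C - f' (matrix_field g C A) *\<^sub>C mcomm A B
      + (f A * g A) *\<^sub>C (mcomm (mcomm A B) C - mcomm (mcomm A C) B)"
    by (simp add: matrix_field_def scaleC_scaleC scaleC_diff_right mult.commute)
  finally show ?thesis by (simp add: mcomm_jacobi)
qed

text \<open>If \<open>[X, E] = \<alpha> E\<close>, the brackets of \<open>\<phi> \<delta>\<^sub>X\<close> with \<open>\<phi>\<^sup>d \<delta>\<^sub>E\<close> and of \<open>\<delta>\<^sub>E\<close> with
  \<open>\<phi>\<^sup>d\<^sup>+\<^sup>1 \<delta>\<^sub>X\<close>, where \<open>\<phi> = trace_form X\<close>, are two independent combinations of the fields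
  \<open>\<phi>\<^sup>d\<^sup>+\<^sup>1 \<delta>\<^sub>E\<close> and \<open>\<phi>\<^sup>d (trace_form E) \<delta>\<^sub>X\<close>, provided that \<open>d > 0\<close>.\<close>

lemma trace_power_field_step:
  fixes X E :: "('n::{finite,linorder}) cmatrix"
  assumes XE: "mcomm X E = \<alpha> *\<^sub>C E" and \<alpha>: "\<alpha> \<noteq> 0" and d: "d \<noteq> 0"
    and X: "\<And>d. matrix_field (\<lambda>A. trace_form X A ^ d) X \<in> vertical_algebra"
    and E: "\<And>e. e \<le> d \<Longrightarrow> matrix_field (\<lambda>A. trace_form X A ^ e) E \<in> vertical_algebra"
  shows "matrix_field (\<lambda>A. trace_form X A ^ Suc d) E \<in> vertical_algebra"
proof -
  let ?f = "\<lambda>d A. trace_form X A ^ d"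
  define V where "V = lie_bracket (matrix_field (?f 1) X) (matrix_field (?f d) E)"
  define W where "W = lie_bracket (matrix_field (?f 0) E) (matrix_field (?f (Suc d)) X)"
  have VW: "V \<in> vertical_algebra" "W \<in> vertical_algebra"
    unfolding V_def W_def by (intro generated_lie_algebra.bracket X E; simp)+
  have EX: "mcomm E X = - (\<alpha> *\<^sub>C E)"
    using XE by (simp add: mcomm_def algebra_simps minus_equation_iff)
  have XX: "mcomm X X = 0" by (simp add: mcomm_def)
  have tm: "trace (- M) = - trace M" for M :: "'n cmatrix"
    using trace_scaleC[of "-1" M] by simp
  have mm: "mcomm A (- M) = - mcomm A M" for A M :: "'n cmatrix"
    by (simp add: mcomm_def)
  have V: "V A = (\<alpha> * ?f d A * trace_form E A) *\<^sub>C mcomm A X + (\<alpha> * ?f (Suc d) A) *\<^sub>C mcomm A E" for A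
    unfolding V_def lie_bracket_matrix_field[OF trace_form_power_has_derivative trace_form_power_has_derivative]
    by (simp add: matrix_field_def trace_form_mcomm XX XE EX tm scaleC_scaleC mult_ac)
  have W: "W A = - ((of_nat (Suc d) * \<alpha> * ?f d A * trace_form E A) *\<^sub>C mcomm A X) - (\<alpha> * ?f (Suc d) A) *\<^sub>C mcomm A E" for A
    unfolding W_def lie_bracket_matrix_field[OF trace_form_power_has_derivative trace_form_power_has_derivative]
    by (simp add: matrix_field_def trace_form_mcomm XX XE EX tm mm scaleC_scaleC mult_ac)
  \<comment> \<open>\<open>(d + 1) V + W\<close> eliminates \<open>mcomm A X\<close> and equals
    \<open>d \<alpha>\<close> times the field sought; for \<open>d = 0\<close> it would be
    0.\<close>
  have "matrix_field (?f (Suc d)) E A = (1 / \<alpha> + 1 / (of_nat d * \<alpha>)) *\<^sub>C V A + (1 / (of_nat d * \<alpha>)) *\<^sub>C W A" for A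
    unfolding V W matrix_field_def using \<alpha> d
    by (simp add: vec_eq_iff field_simps)
  then have "matrix_field (?f (Suc d)) E
      = (\<lambda>A. (1 / \<alpha> + 1 / (of_nat d * \<alpha>)) *\<^sub>C V A + (1 / (of_nat d * \<alpha>)) *\<^sub>C W A)"
    by (rule ext)
  then show ?thesis
    using VW by (auto intro: generated_lie_algebra.add generated_lie_algebra.scale)
qed

section \<open>Matrices with distinct eigenvalues\<close>

definition distinct_eigen :: "complex ^ 'n ^ 'n \<Rightarrow> bool"
  where "distinct_eigen X \<longleftrightarrow> (\<exists>\<mu> :: 'n \<Rightarrow> complex. inj \<mu> \<and> (\<forall>i. matrix_eigenvalue X (\<mu> i)))"

definition diag_matrix :: "('n \<Rightarrow> complex) \<Rightarrow> complex ^ 'n ^ 'n"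
  where "diag_matrix \<mu> = (\<chi> i j. if i = j then \<mu> i else 0)"

lemma eigenvectors_independent:
  fixes X :: "complex ^ 'n ^ 'n"
  assumes "finite S" "inj_on \<mu> S"
    "\<And>i. i \<in> S \<Longrightarrow> X *v v i = \<mu> i *s v i" "\<And>i. i \<in> S \<Longrightarrow> v i \<noteq> 0"
    "\<And>a. (\<Sum>i\<in>S. c i * v i $ a) = 0"
  shows "\<forall>i\<in>S. c i = 0"
  using assms
proof (induction S arbitrary: c rule: finite_induct)
  case (insert k S)
  have v: "(\<Sum>b\<in>UNIV. X $ a $ b * v i $ b) = \<mu> i * v i $ a" if "i \<in> insert k S" for i a
    using arg_cong[OF insert.prems(2)[OF that], of "\<lambda>x. x $ a"] by (simp add: matrix_vector_mult_def)
  \<comment> \<open>Applying \<open>X - \<mu> k\<close> to the relation removes the term of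
    \<open>v k\<close>.\<close>
  have "(\<Sum>i\<in>S. (c i * (\<mu> i - \<mu> k)) * v i $ a) = 0" for a
  proof -
    have "0 = (\<Sum>b\<in>UNIV. X $ a $ b * (\<Sum>i\<in>insert k S. c i * v i $ b))"
      unfolding insert.prems(4) by simp
    also have "\<dots> = (\<Sum>i\<in>insert k S. \<Sum>b\<in>UNIV. X $ a $ b * (c i * v i $ b))"
      unfolding sum_distrib_left by (rule sum.swap)
    also have "\<dots> = (\<Sum>i\<in>insert k S. c i * (\<Sum>b\<in>UNIV. X $ a $ b * v i $ b))"
      by (simp only: sum_distrib_left mult.left_commute)
    also have "\<dots> = (\<Sum>i\<in>insert k S. c i * (\<mu> i * v i $ a))"
      by (rule sum.cong) (simp_all add: v)
    finally have "(\<Sum>i\<in>insert k S. c i * (\<mu> i * v i $ a)) - \<mu> k * (\<Sum>i\<in>insert k S. c i * v i $ a) = 0"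
      unfolding insert.prems(4) by simp
    then have "(\<Sum>i\<in>insert k S. (c i * (\<mu> i - \<mu> k)) * v i $ a) = 0"
      by (simp only: sum_distrib_left flip: sum_subtractf) (simp add: algebra_simps)
    then show ?thesis using insert.hyps by simp
  qed
  then have "\<forall>i\<in>S. c i * (\<mu> i - \<mu> k) = 0"
    using insert.prems(1-3) by (intro insert.IH) (auto intro: inj_on_subset)
  moreover have "\<mu> i \<noteq> \<mu> k" if "i \<in> S" for i
    using that insert.hyps(2) insert.prems(1) by (auto simp: inj_on_def)
  ultimately have S: "\<forall>i\<in>S. c i = 0" by fastforce
  have "c k * v k $ a = 0" for a
    using insert.prems(4)[of a] insert.hyps S by simp
  moreover obtain a where "v k $ a \<noteq> 0"
    using insert.prems(3)[of k] by (auto simp: vec_eq_iff)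
  ultimately show ?case using S by auto
qed simp

lemma distinct_eigen_diagonalizable:
  fixes X :: "complex ^ 'n ^ 'n"
  assumes "distinct_eigen X"
  obtains \<mu> :: "'n \<Rightarrow> complex" and g h :: "complex ^ 'n ^ 'n"
  where "inj \<mu>" "g ** h = mat 1" "h ** g = mat 1" "X = g ** diag_matrix \<mu> ** h"
proof -
  obtain \<mu> :: "'n \<Rightarrow> complex" where \<mu>: "inj \<mu>" "\<And>i. matrix_eigenvalue X (\<mu> i)"
    using assms by (auto simp: distinct_eigen_def)
  then obtain v where v: "\<And>i. v i \<noteq> 0" "\<And>i. X *v v i = \<mu> i *s v i"
    unfolding matrix_eigenvalue_def by metis
  define g where "g = (\<chi> a i. v i $ a)"
  have "c = 0" if "g *v c = 0" for c
  proof -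
    have "(\<Sum>i\<in>UNIV. c $ i * v i $ a) = 0" for a
      using arg_cong[OF that, of "\<lambda>x. x $ a"] by (simp add: matrix_vector_mult_def g_def mult.commute)
    then have "\<forall>i\<in>UNIV. c $ i = 0"
      using \<mu>(1) v by (intro eigenvectors_independent) auto
    then show ?thesis by (simp add: vec_eq_iff)
  qed
  then obtain h where h: "h ** g = mat 1"
    using matrix_left_invertible_ker by blast
  then have gh: "g ** h = mat 1" using matrix_left_right_inverse by blast
  have "(X ** g) $ a $ i = (g ** diag_matrix \<mu>) $ a $ i" for a i
  proof -
    have "(X ** g) $ a $ i = \<mu> i * v i $ a"
      using arg_cong[OF v(2)[of i], of "\<lambda>x. x $ a"]
      by (simp add: matrix_vector_mult_def matrix_matrix_mult_def g_def)
    then show ?thesis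
      by (simp add: matrix_matrix_mult_def g_def diag_matrix_def if_distrib mult.commute cong: if_cong)
  qed
  then have "X ** g = g ** diag_matrix \<mu>" by (simp add: vec_eq_iff)
  then have "X = g ** diag_matrix \<mu> ** h"
    using gh by (metis matrix_mul_assoc matrix_mul_rid)
  with \<mu>(1) gh h show thesis by (rule that)
qed

text \<open>The determinant is the product of the differences between \<open>k\<close> and the
  \<open>n\<close> eigenvalues, so one of them must be smaller than \<open>\<eta>\<close>.\<close>

lemma eigenvalue_near:
  fixes Y :: "complex ^ 'n ^ 'n"
  assumes \<eta>: "0 < \<eta>" and det: "cmod (det (mat k - Y)) < \<eta> ^ CARD('n)"
  obtains l where "matrix_eigenvalue Y l" "cmod (l - k) < \<eta>"
proof -
  let ?p = "matrix_charpoly Y"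
  have p: "degree ?p = CARD('n)" "lead_coeff ?p = 1"
    using matrix_charpoly_monic[of Y] by (metis le_antisym le_degree one_neq_zero)+
  then have "?p \<noteq> 0" by auto
  from alg_closed_imp_factorization[OF this] p obtain R
    where R: "size R = CARD('n)" "?p = (\<Prod>x\<in>#R. [:- x, 1:])" by auto
  have prod: "\<eta> ^ size R \<le> cmod (poly (\<Prod>x\<in>#R. [:- x, 1:]) k)" if "\<And>x. x \<in># R \<Longrightarrow> \<eta> \<le> cmod (x - k)" for R
    using that
  proof (induction R)
    case (add x R)
    have "\<eta> \<le> cmod (k - x)"
      using add.prems[of x] by (simp add: norm_minus_commute)
    then have "\<eta> * \<eta> ^ size R \<le> cmod (k - x) * cmod (poly (\<Prod>x\<in>#R. [:- x, 1:]) k)"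
      using add \<eta> by (intro mult_mono) auto
    moreover have "poly (\<Prod>x\<in>#add_mset x R. [:- x, 1:]) k = (k - x) * poly (\<Prod>x\<in>#R. [:- x, 1:]) k"
      by (simp add: algebra_simps)
    ultimately show ?case by (simp only: norm_mult) simp
  qed simp
  have "\<exists>x\<in>#R. cmod (x - k) < \<eta>"
    using prod[of R] R det poly_matrix_charpoly[of Y k] by (metis not_le)
  then obtain l where l: "l \<in># R" "cmod (l - k) < \<eta>" by blast
  from l(1) have "poly ?p l = 0"
    unfolding R(2) by (simp add: poly_prod_mset prod_mset_zero_iff)
  then show thesis
    using that l(2) by (simp add: poly_matrix_charpoly matrix_eigenvalue_iff_det)
qed

text \<open>Discs around the eigenvalues whose radius is at most half of their least distance are
  disjoint, and for small \<open>t\<close> each of them contains an eigenvalue of the perturbed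
  matrix.\<close>

lemma distinct_eigen_perturb:
  fixes X C :: "complex ^ 'n ^ 'n"
  assumes "distinct_eigen X"
  shows "\<forall>\<^sub>F t in at 0. distinct_eigen (X + t *\<^sub>C C)"
proof -
  obtain \<mu> :: "'n \<Rightarrow> complex" where \<mu>: "inj \<mu>" "\<And>i. matrix_eigenvalue X (\<mu> i)"
    using assms by (auto simp: distinct_eigen_def)
  \<comment> \<open>Inserting 1 keeps the set nonempty when \<open>n = 1\<close>.\<close>
  define D where "D = insert 1 {cmod (\<mu> i - \<mu> j) |i j. i \<noteq> j}"
  have finD: "finite D"
  proof -
    have "D \<subseteq> insert 1 ((\<lambda>(i, j). cmod (\<mu> i - \<mu> j)) ` UNIV)"
      by (auto simp: D_def)
    then show ?thesis by (rule finite_subset) simp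
  qed
  have posD: "0 < d" if "d \<in> D" for d
    using that \<mu>(1) by (auto simp: D_def dest: injD)
  define \<eta> where "\<eta> = Min D / 2"
  have "D \<noteq> {}" by (simp add: D_def)
  then have \<eta>: "0 < \<eta>"
    using Min_in[OF finD] posD by (simp add: \<eta>_def)
  have sep: "2 * \<eta> \<le> cmod (\<mu> i - \<mu> j)" if "i \<noteq> j" for i j
    unfolding \<eta>_def using Min_le[OF finD, of "cmod (\<mu> i - \<mu> j)"] that by (auto simp: D_def)
  have "\<forall>\<^sub>F t in at 0. cmod (det (mat (\<mu> i) - (X + t *\<^sub>C C))) < \<eta> ^ CARD('n)" for i
  proof -
    have "continuous_on UNIV (\<lambda>t. det (mat (\<mu> i) - (X + t *\<^sub>C C)))"
      unfolding det_def by (auto intro!: continuous_intros)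
    then have "((\<lambda>t. det (mat (\<mu> i) - (X + t *\<^sub>C C))) \<longlongrightarrow> det (mat (\<mu> i) - (X + 0 *\<^sub>C C))) (at 0)"
      by (metis UNIV_I continuous_on_def)
    then have "((\<lambda>t. cmod (det (mat (\<mu> i) - (X + t *\<^sub>C C)))) \<longlongrightarrow> cmod 0) (at 0)"
      using \<mu>(2)[of i] by (intro tendsto_norm) (simp add: matrix_eigenvalue_iff_det)
    then show ?thesis
      by (rule order_tendstoD(2)) (use \<eta> in simp)
  qed
  then have "\<forall>\<^sub>F t in at 0. \<forall>i. cmod (det (mat (\<mu> i) - (X + t *\<^sub>C C))) < \<eta> ^ CARD('n)"
    by (rule eventually_all_finite)
  then show ?thesis
  proof eventually_elim
    case (elim t)
    have "\<forall>i. \<exists>l. matrix_eigenvalue (X + t *\<^sub>C C) l \<and> cmod (l - \<mu> i) < \<eta>"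
      using eigenvalue_near[OF \<eta>] elim by metis
    then obtain \<nu> where \<nu>: "\<And>i. matrix_eigenvalue (X + t *\<^sub>C C) (\<nu> i)" "\<And>i. cmod (\<nu> i - \<mu> i) < \<eta>"
      by metis
    have "inj \<nu>"
    proof (rule injI, rule ccontr)
      fix i j assume "\<nu> i = \<nu> j" "i \<noteq> j"
      then have "cmod (\<mu> i - \<mu> j) \<le> cmod (\<nu> j - \<mu> j) + cmod (\<nu> i - \<mu> i)"
        using norm_triangle_ineq4[of "\<nu> j - \<mu> j" "\<nu> i - \<mu> i"] by simp
      then show False using \<nu>(2)[of i] \<nu>(2)[of j] sep[OF \<open>i \<noteq> j\<close>] by linarith
    qed
    with \<nu>(1) show ?case by (auto simp: distinct_eigen_def)
  qed
qed

lemma distinct_eigen_ramp: "distinct_eigen (ramp_matrix :: ('n::{finite,linorder}) cmatrix)"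
proof -
  let ?R = "ramp_matrix :: 'n cmatrix"
  have "det (mat (of_nat (coord_number i)) - ?R) = 0" for i :: 'n
  proof -
    have "det (mat (of_nat (coord_number i)) - ?R) = (\<Prod>j\<in>UNIV. (mat (of_nat (coord_number i)) - ?R) $ j $ j)"
      by (rule det_diagonal) (simp add: ramp_matrix_def mat_def)
    also have "\<dots> = 0"
      by (rule prod_zero) (auto simp: ramp_matrix_def mat_def intro!: bexI[of _ i])
    finally show ?thesis .
  qed
  then show ?thesis
    unfolding distinct_eigen_def matrix_eigenvalue_iff_det
    by (intro exI[of _ "\<lambda>i. of_nat (coord_number i)"]) (simp add: inj_on_def)
qed

section \<open>Polynomial multiples of conjugation fields\<close>

lemma matrix_field_scale_right: "matrix_field f (c *\<^sub>C B) A = c *\<^sub>C matrix_field f B A"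
  by (simp add: matrix_field_def scaleC_scaleC mult.commute)

lemma matrix_field_sum_right: "matrix_field f (\<Sum>i\<in>I. B i) A = (\<Sum>i\<in>I. matrix_field f (B i) A)"
  by (simp add: matrix_field_def mcomm_sum_right scaleC_sum_right)

lemma matrix_field_sum_scale_in:
  assumes "\<And>i. i \<in> I \<Longrightarrow> matrix_field f (B i) \<in> vertical_algebra"
  shows "matrix_field f (\<Sum>i\<in>I. c i *\<^sub>C B i) \<in> vertical_algebra"
proof -
  have "matrix_field f (\<Sum>i\<in>I. c i *\<^sub>C B i) = (\<lambda>A. \<Sum>i\<in>I. c i *\<^sub>C matrix_field f (B i) A)"
    by (rule ext) (simp add: matrix_field_sum_right matrix_field_scale_right)
  also have "\<dots> \<in> vertical_algebra"
    by (intro vertical_algebra_sum generated_lie_algebra.scale assms)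
  finally show ?thesis .
qed

text \<open>Conjugation by matrices commuting with \<open>X\<close> preserves
  \<open>trace_form X\<close>, so the coefficient is constant along the flow of
  \<open>B\<close>.\<close>

lemma trace_power_field_commuting:
  fixes X B :: "('n::{finite,linorder}) cmatrix"
  assumes b: "\<beta> = 0 \<or> \<beta> = 1" "B ** B = \<beta> *\<^sub>C B" and XB: "X ** B = B ** X"
  shows "matrix_field (\<lambda>A. trace_form X A ^ d) B \<in> vertical_algebra"
proof -
  have "trace_form X (conj_flow \<beta> B s A) = trace_form X A" for s A
  proof -
    let ?P = "mat 1 + exp_coeff \<beta> s *\<^sub>C B" and ?Q = "mat 1 + exp_coeff \<beta> (- s) *\<^sub>C B"
    have "trace (X ** (?Q ** A ** ?P)) = trace ((X ** ?Q ** A) ** ?P)"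
      by (simp only: matrix_mul_assoc)
    also have "\<dots> = trace (?P ** (X ** ?Q ** A))"
      by (rule trace_mul_sym)
    also have "\<dots> = trace (?P ** X ** ?Q ** A)"
      by (simp only: matrix_mul_assoc)
    also have "?P ** X = X ** ?P"
      by (simp add: matrix_add_ldistrib matrix_add_rdistrib XB)
    also have "X ** ?P ** ?Q = X"
      using conj_flow_inverse[OF b, of s] by (simp only: matrix_mul_assoc[symmetric] matrix_mul_rid)
    finally show ?thesis by (simp only: conj_flow_def)
  qed
  then have "complex_complete_on spectral_ball (matrix_field (\<lambda>A. trace_form X A ^ d) B)"
    by (intro complete_matrix_field[OF b, where c = "\<lambda>_. 0"]) simp
  then show ?thesis
    by (intro generated_lie_algebra.generator) (simp add: tangent_matrix_field[OF hp_trace_form_power])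
qed

text \<open>\<open>E X E = 0\<close>, so conjugation by \<open>1 + s E\<close> changes
  \<open>X\<close> only by a multiple of \<open>s E\<close>. The coefficient is therefore affine in
  time, the case that \<open>complete_matrix_field\<close> is made for.\<close>

lemma trace_field_nilpotent:
  fixes X E :: "('n::{finite,linorder}) cmatrix"
  assumes E: "E ** E = 0" and XE: "mcomm X E = \<alpha> *\<^sub>C E"
  shows "matrix_field (\<lambda>A. trace_form X A ^ 1) E \<in> vertical_algebra"
proof -
  have b: "(0::complex) = 0 \<or> (0::complex) = 1" "E ** E = 0 *\<^sub>C E"
    using E by simp_all
  have "trace_form X (conj_flow 0 E s A) = trace_form X A + s * (- \<alpha> * trace_form E A)" for s A
  proof -
    let ?P = "mat 1 + s *\<^sub>C E" and ?Q = "mat 1 + (- s) *\<^sub>C E"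
    have "trace (X ** (?Q ** A ** ?P)) = trace ((X ** ?Q ** A) ** ?P)"
      by (simp only: matrix_mul_assoc)
    also have "\<dots> = trace (?P ** (X ** ?Q ** A))"
      by (rule trace_mul_sym)
    also have "\<dots> = trace (?P ** X ** ?Q ** A)"
      by (simp only: matrix_mul_assoc)
    also have "?P ** X ** ?Q = X - (s * \<alpha>) *\<^sub>C E"
    proof -
      have XE': "X ** E = E ** X + \<alpha> *\<^sub>C E"
        using XE by (simp add: mcomm_def algebra_simps)
      have "E ** X ** E = E ** (X ** E)" by (simp only: matrix_mul_assoc)
      also have "\<dots> = 0"
        by (simp add: XE' matrix_add_ldistrib matrix_mul_assoc E)
      finally have "E ** X ** E = 0" .
      then show ?thesis
        by (simp add: matrix_distribs
            XE' scaleC_add_right scaleC_scaleC)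
    qed
    finally show ?thesis
      by (simp add: conj_flow_def exp_coeff_def matrix_diff_rdistrib trace_sub)
  qed
  then have "complex_complete_on spectral_ball (matrix_field (\<lambda>A. trace_form X A ^ 1) E)"
    by (intro complete_matrix_field[OF b, where c = "\<lambda>A. - \<alpha> * trace_form E A"]) simp
  then show ?thesis
    by (intro generated_lie_algebra.generator) (simp add: tangent_matrix_field[OF hp_trace_form_power[of 1], simplified])
qed

text \<open>The diagonal rank-one matrices of the eigenbasis commute with \<open>X\<close>. For the
  others the bracket step needs \<open>d > 0\<close>, so the exponents 0 and 1 both have to come
  from complete fields.\<close>

lemma trace_power_field_in_algebra:
  fixes X B :: "('n::{finite,linorder}) cmatrix"
  assumes "distinct_eigen X"
  shows "matrix_field (\<lambda>A. trace_form X A ^ d) B \<in> vertical_algebra"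
proof -
  obtain \<mu> :: "'n \<Rightarrow> complex" and g h :: "'n cmatrix"
    where \<mu>: "inj \<mu>" and gh: "g ** h = mat 1" "h ** g = mat 1" and X: "X = g ** diag_matrix \<mu> ** h"
    using distinct_eigen_diagonalizable[OF assms] by blast
  define E where "E = (\<lambda>i j. g ** matrix_unit i j ** h)"
  have EE: "E i j ** E k l = (if j = k then 1 else 0) *\<^sub>C E i l" for i j k l
  proof -
    have "E i j ** E k l = g ** matrix_unit i j ** (h ** g) ** matrix_unit k l ** h"
      by (simp only: E_def matrix_mul_assoc)
    also have "\<dots> = g ** (matrix_unit i j ** matrix_unit k l) ** h"
      by (simp add: gh matrix_mul_assoc)
    finally show ?thesis by (simp add: matrix_unit_mult E_def)
  qed
  have span: "M = (\<Sum>i\<in>UNIV. \<Sum>j\<in>UNIV. (h ** M ** g) $ i $ j *\<^sub>C E i j)" for M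
  proof -
    have "M = (g ** h) ** M ** (g ** h)" by (simp add: gh)
    also have "\<dots> = g ** (h ** M ** g) ** h"
      by (simp only: matrix_mul_assoc)
    also have "\<dots> = g ** (\<Sum>i\<in>UNIV. \<Sum>j\<in>UNIV. (h ** M ** g) $ i $ j *\<^sub>C matrix_unit i j) ** h"
      by (simp only: matrix_eq_sum_units[symmetric])
    finally show ?thesis
      by (simp add: E_def matrix_sum_left matrix_sum_right)
  qed
  have X': "X = (\<Sum>i\<in>UNIV. \<mu> i *\<^sub>C E i i)"
  proof -
    have "h ** X ** g = (h ** g) ** diag_matrix \<mu> ** (h ** g)"
      unfolding X by (simp only: matrix_mul_assoc)
    then have "h ** X ** g = diag_matrix \<mu>" by (simp add: gh)
    moreover have "(\<Sum>j\<in>UNIV. diag_matrix \<mu> $ i $ j *\<^sub>C E i j) = (\<Sum>j\<in>UNIV. if j = i then \<mu> i *\<^sub>C E i i else 0)" for i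
      by (rule sum.cong) (auto simp: diag_matrix_def)
    ultimately show ?thesis
      using span[of X] by simp
  qed
  have XE: "X ** E i j = \<mu> i *\<^sub>C E i j" "E i j ** X = \<mu> j *\<^sub>C E i j" for i j
  proof -
    have "X ** E i j = (\<Sum>k\<in>UNIV. if k = i then \<mu> i *\<^sub>C E i j else 0)"
      unfolding X' matrix_sum_left by (rule sum.cong) (auto simp: EE)
    then show "X ** E i j = \<mu> i *\<^sub>C E i j" by simp
    have "E i j ** X = (\<Sum>k\<in>UNIV. if k = j then \<mu> j *\<^sub>C E i j else 0)"
      unfolding X' matrix_sum_right by (rule sum.cong) (auto simp: EE)
    then show "E i j ** X = \<mu> j *\<^sub>C E i j" by simp
  qed
  have diag: "matrix_field (\<lambda>A. trace_form X A ^ d) (E i i) \<in> vertical_algebra" for i d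
    by (rule trace_power_field_commuting[of 1]) (simp_all add: EE XE)
  have XX: "matrix_field (\<lambda>A. trace_form X A ^ d) X \<in> vertical_algebra" for d
    using matrix_field_sum_scale_in[of UNIV "\<lambda>A. trace_form X A ^ d" "\<lambda>i. E i i" \<mu>] diag
    by (simp flip: X')
  have off: "matrix_field (\<lambda>A. trace_form X A ^ d) (E i j) \<in> vertical_algebra" if "i \<noteq> j" for i j d
  proof (induction d rule: less_induct)
    case (less d)
    have a: "mcomm X (E i j) = (\<mu> i - \<mu> j) *\<^sub>C E i j"
      by (simp add: mcomm_def XE vec_eq_iff algebra_simps)
    have E2: "E i j ** E i j = 0" using that by (simp add: EE)
    consider "d = 0" | "d = 1" | e where "d = Suc e" "e \<noteq> 0"
      by (metis One_nat_def not0_implies_Suc)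
    then show ?case
    proof cases
      case 1
      \<comment> \<open>With exponent 0 the coefficient is 1 whatever \<open>X\<close> is; the
        choice 0 commutes with \<open>E i j\<close>.\<close>
      have "matrix_field (\<lambda>A. trace_form 0 A ^ 0) (E i j) \<in> vertical_algebra"
        by (rule trace_power_field_commuting[of 0]) (simp_all add: E2)
      then show ?thesis using 1 by simp
    next
      case 2
      then show ?thesis using trace_field_nilpotent[OF E2 a] by simp
    next
      case 3
      have "\<mu> i - \<mu> j \<noteq> 0" using \<mu> that by (auto dest: injD)
      then show ?thesis
        unfolding 3(1) by (rule trace_power_field_step[OF a _ 3(2) XX less.IH]) (use 3 in auto)
    qed
  qed
  have "matrix_field (\<lambda>A. trace_form X A ^ d) (\<Sum>p\<in>UNIV. (h ** B ** g) $ fst p $ snd p *\<^sub>C E (fst p) (snd p)) \<in> vertical_algebra"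
    by (rule matrix_field_sum_scale_in) (use diag off in \<open>metis (no_types)\<close>)
  moreover have "(\<Sum>p\<in>UNIV. (h ** B ** g) $ fst p $ snd p *\<^sub>C E (fst p) (snd p)) = B"
  proof -
    have "(\<Sum>p\<in>UNIV. (h ** B ** g) $ fst p $ snd p *\<^sub>C E (fst p) (snd p))
        = (\<Sum>i\<in>UNIV. \<Sum>j\<in>UNIV. (h ** B ** g) $ i $ j *\<^sub>C E i j)"
      by (simp add: sum.cartesian_product split_beta)
    then show ?thesis by (simp only: span[symmetric])
  qed
  ultimately show ?thesis by simp
qed

section \<open>Lagrange interpolation and polarization\<close>

definition lagrange_poly :: "complex set \<Rightarrow> complex \<Rightarrow> complex poly"
  where "lagrange_poly S s = (\<Prod>r\<in>S - {s}. smult (1 / (s - r)) [:- r, 1:])"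

lemma lagrange_interpolation:
  assumes S: "finite S" and p: "degree p < card S"
  shows "p = (\<Sum>s\<in>S. smult (poly p s) (lagrange_poly S s))"
proof (rule poly_eqI_degree[of S])
  fix x assume x: "x \<in> S"
  have "poly (lagrange_poly S s) x = (if s = x then 1 else 0)" if "s \<in> S" for s
  proof (cases "s = x")
    case True
    then show ?thesis by (auto simp: lagrange_poly_def poly_prod simp flip: diff_divide_distrib intro!: prod.neutral split: if_splits)
  next
    case False
    have "poly (lagrange_poly S s) x = 0"
      unfolding lagrange_poly_def poly_prod
      by (rule prod_zero) (use S x False in \<open>auto intro!: bexI[of _ x]\<close>)
    then show ?thesis using False by simp
  qed
  then have "poly (\<Sum>s\<in>S. smult (poly p s) (lagrange_poly S s)) x
      = (\<Sum>s\<in>S. if s = x then poly p x else 0)"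
    unfolding poly_sum by (intro sum.cong) auto
  then show "poly p x = poly (\<Sum>s\<in>S. smult (poly p s) (lagrange_poly S s)) x"
    using S x by simp
next
  have "degree (lagrange_poly S s) \<le> card S - 1" if "s \<in> S" for s
  proof -
    have "degree (lagrange_poly S s) \<le> (\<Sum>r\<in>S - {s}. degree (smult (1 / (s - r)) [:- r, 1:]))"
      unfolding lagrange_poly_def
      using degree_prod_sum_le[of "S - {s}" "\<lambda>r. smult (1 / (s - r)) [:- r, 1:]"] S
      by (simp only: o_def finite_Diff)
    also have "\<dots> \<le> (\<Sum>r\<in>S - {s}. 1)"
      by (intro sum_mono) (auto intro: order_trans[OF degree_smult_le])
    finally show ?thesis using that S by simp
  qed
  then have "degree (\<Sum>s\<in>S. smult (poly p s) (lagrange_poly S s)) \<le> card S - 1"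
    using S by (intro degree_sum_le) (auto intro: order_trans[OF degree_smult_le])
  then show "degree (\<Sum>s\<in>S. smult (poly p s) (lagrange_poly S s)) < card S"
    using p by linarith
qed (use p in auto)

text \<open>Lagrange interpolation at \<open>D + 1\<close> parameters writes each coefficient as a
  combination of values, with weights that do not depend on \<open>x\<close>. \<open>L\<close>
  stands for membership in a linear space of functions.\<close>

lemma linear_coefficient_in:
  fixes v :: "nat \<Rightarrow> 'a \<Rightarrow> complex"
  assumes sum: "\<And>I F c. finite (I :: complex set) \<Longrightarrow> (\<And>i. i \<in> I \<Longrightarrow> L (F i)) \<Longrightarrow> L (\<lambda>x. \<Sum>i\<in>I. c i * F i x)"
    and S: "infinite S" "\<And>t. t \<in> S \<Longrightarrow> L (\<lambda>x. \<Sum>k\<le>D. t ^ k * v k x)" and j: "j \<le> D"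
  shows "L (v j)"
proof -
  obtain T where T: "T \<subseteq> S" "finite T" "card T = Suc D"
    using infinite_arbitrarily_large[OF S(1)] by metis
  let ?c = "\<lambda>t. coeff (lagrange_poly T t) j"
  have "L (\<lambda>x. \<Sum>t\<in>T. ?c t * (\<Sum>k\<le>D. t ^ k * v k x))"
    using sum[of T "\<lambda>t x. \<Sum>k\<le>D. t ^ k * v k x" ?c] T S(2) by blast
  moreover have "(\<Sum>t\<in>T. ?c t * (\<Sum>k\<le>D. t ^ k * v k x)) = v j x" for x
  proof -
    define p where "p = (\<Sum>k\<le>D. monom (v k x) k)"
    have "degree p \<le> D"
      unfolding p_def by (rule degree_sum_le) (auto intro: order_trans[OF degree_monom_le])
    then have "p = (\<Sum>t\<in>T. smult (poly p t) (lagrange_poly T t))"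
      using T by (intro lagrange_interpolation) auto
    then have "coeff p j = coeff (\<Sum>t\<in>T. smult (poly p t) (lagrange_poly T t)) j"
      by (rule arg_cong)
    also have "\<dots> = (\<Sum>t\<in>T. ?c t * (\<Sum>k\<le>D. t ^ k * v k x))"
      by (simp add: coeff_sum p_def poly_sum poly_monom mult.commute)
    also have "coeff p j = v j x"
      using j by (simp add: p_def coeff_sum)
    finally show ?thesis by simp
  qed
  ultimately show ?thesis by simp
qed

text \<open>These coefficient functions form a linear space, to which interpolation applies.\<close>

definition multiplier :: "(('n::{finite,linorder}) cmatrix \<Rightarrow> complex) \<Rightarrow> bool"
  where "multiplier P \<longleftrightarrow> (\<forall>B. matrix_field P B \<in> vertical_algebra)"

lemma multiplier_sum:
  fixes F :: "'i \<Rightarrow> ('n::{finite,linorder}) cmatrix \<Rightarrow> complex"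
  assumes "\<And>i. i \<in> I \<Longrightarrow> multiplier (F i)"
  shows "multiplier (\<lambda>A. \<Sum>i\<in>I. c i * F i A)"
  unfolding multiplier_def
proof
  fix B :: "'n cmatrix"
  have "scaleC (\<Sum>i\<in>I. f i) M = (\<Sum>i\<in>I. f i *\<^sub>C M)" for f and M :: "'n cmatrix"
    by (induction I rule: infinite_finite_induct) (auto simp: scaleC_add_left)
  then have "matrix_field (\<lambda>A. \<Sum>i\<in>I. c i * F i A) B = (\<lambda>A. \<Sum>i\<in>I. c i *\<^sub>C matrix_field (F i) B A)"
    by (simp add: fun_eq_iff matrix_field_def scaleC_scaleC)
  also have "\<dots> \<in> vertical_algebra"
    using assms by (intro vertical_algebra_sum generated_lie_algebra.scale) (simp add: multiplier_def)
  finally show "matrix_field (\<lambda>A. \<Sum>i\<in>I. c i * F i A) B \<in> vertical_algebra" .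
qed

lemma multiplier_add: "multiplier P \<Longrightarrow> multiplier Q \<Longrightarrow> multiplier (\<lambda>A. P A + Q A)"
  using multiplier_sum[of "UNIV :: bool set" "\<lambda>b. if b then P else Q" "\<lambda>_. 1"]
  by (simp add: UNIV_bool add.commute)

lemma multiplier_cmult: "multiplier P \<Longrightarrow> multiplier (\<lambda>A. c * P A)"
  using multiplier_sum[of "{()}" "\<lambda>_. P" "\<lambda>_. c"] by simp

lemma trace_form_unit: "trace_form (matrix_unit j i) A = A $ i $ j"
proof -
  have "(matrix_unit j i ** A) $ a $ a = (if a = j then A $ i $ a else 0)" for a
  proof -
    have "(matrix_unit j i ** A) $ a $ a = (\<Sum>k\<in>UNIV. if k = i then (if a = j then A $ i $ a else 0) else 0)"
      unfolding matrix_matrix_mult_def matrix_unit_def vec_lambda_beta by (intro sum.cong) auto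
    then show ?thesis by simp
  qed
  then show ?thesis by (simp add: trace_def)
qed

text \<open>The coordinate \<open>trace_form C\<close> is split off as the coefficient of \<open>t\<close> in a power of
  \<open>trace_form (X + t C)\<close>; eigenvalues stay distinct for small \<open>t\<close>.\<close>

lemma multiplier_hom_poly_trace_power:
  "hom_poly d P \<Longrightarrow> distinct_eigen X \<Longrightarrow> multiplier (\<lambda>A. P A * trace_form X A ^ e)"
proof (induction arbitrary: X e rule: hom_poly.induct)
  case (hp_zero d)
  show ?case using multiplier_sum[of "{}" undefined undefined] by simp
next
  case (hp_const c)
  then have "multiplier (\<lambda>A. trace_form X A ^ e)"
    by (simp add: multiplier_def trace_power_field_in_algebra)
  then show ?case by (rule multiplier_cmult)
next
  case (hp_coord d P i j)
  \<comment> \<open>The indices are swapped because the trace form of \<open>matrix_unit j i\<close>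
    is the entry \<open>A $ i $ j\<close>.\<close>
  let ?C = "matrix_unit j i"
  let ?S = "{t. distinct_eigen (X + t *\<^sub>C ?C)}"
  let ?v = "\<lambda>k A. of_nat (Suc e choose k) * (P A * (trace_form ?C A ^ k * trace_form X A ^ (Suc e - k)))"
  obtain r where r: "0 < r" "\<And>t. t \<noteq> 0 \<Longrightarrow> dist t 0 < r \<Longrightarrow> t \<in> ?S"
    using distinct_eigen_perturb[OF hp_coord.prems, of ?C] by (auto simp: eventually_at)
  have "ball 0 r - {0} \<subseteq> ?S"
    using r(2) by (auto simp: dist_commute)
  moreover have "infinite (ball 0 r - {0 :: complex})"
    using uncountable_ball[OF r(1), of "0 :: complex"] countable_finite by auto
  ultimately have inf: "infinite ?S" using finite_subset by blast
  have eq: "P A * trace_form (X + t *\<^sub>C ?C) A ^ Suc e = (\<Sum>k\<le>Suc e. t ^ k * ?v k A)" for t A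
  proof -
    have "trace_form (X + t *\<^sub>C ?C) A ^ Suc e = (t * trace_form ?C A + trace_form X A) ^ Suc e"
      by (simp add: matrix_add_rdistrib trace_add add.commute)
    also have "\<dots> = (\<Sum>k\<le>Suc e. of_nat (Suc e choose k) * (t * trace_form ?C A) ^ k * trace_form X A ^ (Suc e - k))"
      by (rule binomial_ring)
    finally show ?thesis
      by (simp only: sum_distrib_left power_mult_distrib mult_ac)
  qed
  \<comment> \<open>The induction hypothesis is applied to the perturbed \<open>X\<close> and the
    exponent \<open>e + 1\<close>, which is why both are generalized. The coefficient of
    \<open>t\<close> is \<open>e + 1\<close> times the function sought.\<close>
  have "multiplier (?v 1)"
  proof (rule linear_coefficient_in[where L = multiplier and S = ?S and v = ?v and D = "Suc e" and j = 1])
    show "infinite ?S" by (rule inf)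
    show "multiplier (\<lambda>A. \<Sum>k\<le>Suc e. t ^ k * ?v k A)" if "t \<in> ?S" for t
      unfolding eq[symmetric] using hp_coord.IH that by blast
  qed (auto intro: multiplier_sum)
  from multiplier_cmult[OF this, of "1 / of_nat (Suc e)"] show ?case
    by (simp add: trace_form_unit mult_ac del: of_nat_Suc)
next
  case (hp_add d P Q)
  then show ?case by (simp add: distrib_right multiplier_add)
qed

theorem mcomm_field_in_algebra:
  fixes F :: "('n::{finite,linorder}) cmatrix \<Rightarrow> 'n cmatrix"
  assumes "hom_poly_mat d F"
  shows "(\<lambda>A. mcomm A (F A)) \<in> vertical_algebra"
proof -
  have "matrix_field (\<lambda>A. F A $ i $ j) B \<in> vertical_algebra" for i j B
    using multiplier_hom_poly_trace_power[OF hpm_nth[OF assms] distinct_eigen_ramp, of i j 0]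
    by (simp add: multiplier_def)
  then have "(\<lambda>A. \<Sum>i\<in>UNIV. \<Sum>j\<in>UNIV. matrix_field (\<lambda>A. F A $ i $ j) (matrix_unit i j) A) \<in> vertical_algebra"
    by (intro vertical_algebra_sum)
  moreover have "mcomm A (F A) = (\<Sum>i\<in>UNIV. \<Sum>j\<in>UNIV. matrix_field (\<lambda>A. F A $ i $ j) (matrix_unit i j) A)" for A
    by (subst matrix_eq_sum_units[of "F A"]) (simp add: mcomm_sum_right matrix_field_def)
  ultimately show ?thesis by simp
qed

section \<open>Homogeneous expansion on balanced domains\<close>

text \<open>The homogeneous part is defined ray by ray, so that one-variable theory applies. That it
  is a polynomial in the entries has to be proved.\<close>

definition taylor_part :: "(complex ^ 'n ^ 'n \<Rightarrow> complex) \<Rightarrow> nat \<Rightarrow> complex ^ 'n ^ 'n \<Rightarrow> complex"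
  where "taylor_part \<theta> k A = (deriv ^^ k) (\<lambda>t. \<theta> (t *\<^sub>C A)) 0 / fact k"

lemma holomorphic_on_line:
  fixes \<theta> :: "complex ^ 'n ^ 'n \<Rightarrow> complex"
  assumes h: "holomorphic_map_on \<theta> U" and S: "\<And>z. z \<in> S \<Longrightarrow> A + z *\<^sub>C B \<in> U"
  shows "(\<lambda>z. \<theta> (A + z *\<^sub>C B)) holomorphic_on S"
  unfolding holomorphic_on_def
proof
  fix z assume "z \<in> S"
  then obtain D where D: "(\<theta> has_derivative D) (at (A + z *\<^sub>C B))" "complex_linear_map D"
    using h S by (auto simp: holomorphic_map_on_def)
  have l: "((\<lambda>z. A + z *\<^sub>C B) has_derivative (\<lambda>h. h *\<^sub>C B)) (at z)"
    using has_derivative_add[OF has_derivative_const has_derivative_scaleC[OF has_derivative_ident has_derivative_const]]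
    by fastforce
  have "((\<lambda>z. \<theta> (A + z *\<^sub>C B)) has_derivative (\<lambda>h. D (h *\<^sub>C B))) (at z)"
    by (rule has_derivative_compose[OF l D(1)])
  then have "((\<lambda>z. \<theta> (A + z *\<^sub>C B)) has_field_derivative D B) (at z)"
    unfolding has_field_derivative_def by (simp add: complex_linear_mapD(2)[OF D(2)] mult.commute[of _ "D B"])
  then show "(\<lambda>z. \<theta> (A + z *\<^sub>C B)) field_differentiable at z within S"
    using field_differentiable_at_within field_differentiable_def by blast
qed

lemma open_line:
  fixes A B :: "complex ^ 'n ^ 'n"
  assumes "open U"
  shows "open {z. A + z *\<^sub>C B \<in> U}"
proof -
  have "continuous_on UNIV (\<lambda>z. A + z *\<^sub>C B)"
    by (intro continuous_intros)
  from open_vimage[OF assms this] show ?thesis by (simp add: vimage_def)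
qed

text \<open>Balancedness enters through the hypotheses of the estimates, which ask that a disc of
  multiples of \<open>A\<close> lies in \<open>U\<close>.\<close>

locale balanced_holomorphic =
  fixes \<theta> :: "complex ^ 'n ^ 'n \<Rightarrow> complex" and U :: "(complex ^ 'n ^ 'n) set"
  assumes holo: "holomorphic_map_on \<theta> U" and U: "open U" "0 \<in> U"
begin

lemma holomorphic_ray: "(\<And>t. t \<in> S \<Longrightarrow> t *\<^sub>C A \<in> U) \<Longrightarrow> (\<lambda>t. \<theta> (t *\<^sub>C A)) holomorphic_on S"
  using holomorphic_on_line[OF holo, of S 0 A] by simp

lemma taylor_part_bound:
  assumes r: "0 < r" and "\<And>t. t \<in> cball 0 r \<Longrightarrow> t *\<^sub>C A \<in> U"
    and M: "\<And>t. t \<in> cball 0 r \<Longrightarrow> cmod (\<theta> (t *\<^sub>C A)) \<le> M"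
  shows "cmod (taylor_part \<theta> k A) \<le> M / r ^ k"
proof -
  have h: "(\<lambda>t. \<theta> (t *\<^sub>C A)) holomorphic_on cball 0 r"
    using assms(2) by (rule holomorphic_ray)
  have "cmod ((deriv ^^ k) (\<lambda>t. \<theta> (t *\<^sub>C A)) 0) \<le> fact k * M / r ^ k"
    by (rule Cauchy_inequality)
      (use h r M holomorphic_on_imp_continuous_on in \<open>auto intro: holomorphic_on_subset\<close>)
  then show ?thesis
    by (simp add: taylor_part_def norm_divide field_simps)
qed

lemma taylor_part_sums:
  assumes "\<And>t. t \<in> ball 0 r \<Longrightarrow> t *\<^sub>C A \<in> U" and t: "cmod t < r"
  shows "(\<lambda>k. taylor_part \<theta> k A * t ^ k) sums \<theta> (t *\<^sub>C A)"
  using holomorphic_power_series[OF holomorphic_ray[OF assms(1)], of 0 r t] t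
  by (simp add: taylor_part_def)

text \<open>The tail of the series is compared with a geometric one by Cauchy's estimates. Small
  \<open>t\<close> exhibits the homogeneous parts as limits of quotients; \<open>t = 1\<close> with
  \<open>r > 1\<close> gives the approximation on compact sets.\<close>

lemma taylor_remainder:
  assumes r: "0 < r" and in_U: "\<And>t. t \<in> cball 0 r \<Longrightarrow> t *\<^sub>C A \<in> U"
    and M: "\<And>t. t \<in> cball 0 r \<Longrightarrow> cmod (\<theta> (t *\<^sub>C A)) \<le> M" and t: "cmod t < r"
  shows "cmod (\<theta> (t *\<^sub>C A) - (\<Sum>m<k. taylor_part \<theta> m A * t ^ m))
    \<le> M * (cmod t / r) ^ k * (1 / (1 - cmod t / r))"
proof -
  let ?q = "cmod t / r"
  have s: "(\<lambda>m. taylor_part \<theta> m A * t ^ m) sums \<theta> (t *\<^sub>C A)"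
    by (rule taylor_part_sums[of r]) (use in_U t in auto)
  have s1: "(\<lambda>m. taylor_part \<theta> (m + k) A * t ^ (m + k)) sums
      (\<theta> (t *\<^sub>C A) - (\<Sum>m<k. taylor_part \<theta> m A * t ^ m))"
    using sums_split_initial_segment[OF s, of k] .
  have s2: "(\<lambda>m. M * ?q ^ k * ?q ^ m) sums (M * ?q ^ k * (1 / (1 - ?q)))"
    by (intro sums_mult geometric_sums) (use r t in auto)
  have "cmod (taylor_part \<theta> (m + k) A * t ^ (m + k)) \<le> M * ?q ^ k * ?q ^ m" for m
  proof -
    have "cmod (taylor_part \<theta> (m + k) A) * cmod t ^ (m + k) \<le> M / r ^ (m + k) * cmod t ^ (m + k)"
      by (intro mult_right_mono taylor_part_bound[OF r in_U M]) auto
    also have "\<dots> = M * ?q ^ k * ?q ^ m"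
      by (simp add: power_add power_divide mult_ac)
    finally show ?thesis by (simp add: norm_mult norm_power)
  qed
  then show ?thesis by (rule norm_sums_le[OF s1 s2])
qed

lemma bounded_near_zero:
  obtains \<rho> M where "0 < \<rho>" "\<And>A. norm A \<le> \<rho> \<Longrightarrow> A \<in> U \<and> cmod (\<theta> A) \<le> M"
proof -
  obtain D where "(\<theta> has_derivative D) (at 0)"
    using holo U(2) by (auto simp: holomorphic_map_on_def)
  then have "isCont \<theta> 0" by (rule has_derivative_continuous)
  then obtain d where d: "0 < d" "\<And>A. dist A 0 < d \<Longrightarrow> dist (\<theta> A) (\<theta> 0) < 1"
    unfolding continuous_at_eps_delta by (meson zero_less_one)
  obtain e where e: "0 < e" "ball 0 e \<subseteq> U"
    using U open_contains_ball by blast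
  define \<rho> where "\<rho> = min d e / 2"
  have "A \<in> U \<and> cmod (\<theta> A) \<le> cmod (\<theta> 0) + 1" if "norm A \<le> \<rho>" for A
  proof -
    have "norm A < d" "norm A < e" using that d(1) e(1) by (auto simp: \<rho>_def)
    then have "A \<in> U" "cmod (\<theta> A - \<theta> 0) < 1"
      using d(2)[of A] e(2) by (auto simp: dist_norm)
    moreover have "cmod (\<theta> A) \<le> cmod (\<theta> 0) + cmod (\<theta> A - \<theta> 0)"
      by (metis add.commute diff_add_cancel norm_triangle_ineq)
    ultimately show ?thesis by linarith
  qed
  with d(1) e(1) show thesis by (intro that[of \<rho>]) (auto simp: \<rho>_def)
qed

text \<open>Near 0 the function is bounded by some \<open>M\<close> on a ball of radius
  \<open>\<rho>\<close>, and \<open>A\<close> is scaled into that ball. The polynomial growth is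
  what Liouville's theorem needs.\<close>

lemma taylor_part_growth:
  obtains C where "\<And>A. cmod (taylor_part \<theta> k A) \<le> C * (norm A + 1) ^ k"
proof -
  obtain \<rho> M where \<rho>: "0 < \<rho>" "\<And>A. norm A \<le> \<rho> \<Longrightarrow> A \<in> U \<and> cmod (\<theta> A) \<le> M"
    using bounded_near_zero by blast
  have "cmod (taylor_part \<theta> k A) \<le> M / \<rho> ^ k * (norm A + 1) ^ k" for A
  proof -
    let ?r = "\<rho> / (norm A + 1)"
    have r: "0 < ?r" using \<rho>(1) by (simp add: add_nonneg_pos)
    have "norm (t *\<^sub>C A) \<le> \<rho>" if "t \<in> cball 0 ?r" for t
    proof -
      have "cmod t * norm A \<le> ?r * (norm A + 1)"
        using that r by (intro mult_mono) auto
      also have "\<dots> = \<rho>" by (simp add: add_nonneg_eq_0_iff)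
      finally show ?thesis by (simp add: norm_scaleC)
    qed
    then have "cmod (taylor_part \<theta> k A) \<le> M / ?r ^ k"
      using \<rho>(2) by (intro taylor_part_bound r) blast+
    then show ?thesis by (simp add: power_divide)
  qed
  then show thesis by (rule that)
qed

lemma taylor_part_homogeneous: "taylor_part \<theta> k (s *\<^sub>C A) = s ^ k * taylor_part \<theta> k A"
proof -
  have "(deriv ^^ k) (\<lambda>w. \<theta> ((s * w) *\<^sub>C A)) 0 = s ^ k * (deriv ^^ k) (\<lambda>t. \<theta> (t *\<^sub>C A)) (s * 0)"
  proof (rule higher_deriv_compose_linear)
    show "(\<lambda>t. \<theta> (t *\<^sub>C A)) holomorphic_on {t. t *\<^sub>C A \<in> U}"
      by (rule holomorphic_ray) simp
    show "open {t. (s * t) *\<^sub>C A \<in> U}"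
      using open_line[OF U(1), of 0 "s *\<^sub>C A"] by (simp add: scaleC_scaleC mult.commute)
    show "open {t. t *\<^sub>C A \<in> U}"
      using open_line[OF U(1), of 0 A] by simp
  qed (use U in auto)
  then show ?thesis
    by (simp add: taylor_part_def scaleC_scaleC mult.commute)
qed

text \<open>The part of degree \<open>k\<close> is the limit, as \<open>t\<close> tends to 0, of the
  remainder after \<open>k\<close> terms at \<open>t A\<close> divided by \<open>t ^ k\<close>. The
  limit is uniform on discs of the line, and the subtracted parts are holomorphic by
  induction.\<close>

lemma taylor_part_line_holomorphic: "(\<lambda>z. taylor_part \<theta> k (A + z *\<^sub>C B)) holomorphic_on UNIV"
proof (induction k rule: less_induct)
  case (less k)
  obtain \<rho> M where \<rho>: "0 < \<rho>" "\<And>A. norm A \<le> \<rho> \<Longrightarrow> A \<in> U \<and> cmod (\<theta> A) \<le> M"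
    using bounded_near_zero by blast
  have "(\<lambda>z. taylor_part \<theta> k (A + z *\<^sub>C B)) holomorphic_on ball 0 R" if R: "0 < R" for R
  proof -
    define s where "s = norm A + R * norm B + 1"
    define r where "r = \<rho> / s"
    have s: "1 \<le> s" using R by (simp add: s_def)
    then have r: "0 < r" using \<rho>(1) by (simp add: r_def)
    have small: "norm (t *\<^sub>C (A + z *\<^sub>C B)) \<le> \<rho>" if "t \<in> cball 0 r" "z \<in> cball 0 R" for t z :: complex
    proof -
      have "norm (A + z *\<^sub>C B) \<le> norm A + cmod z * norm B"
        using norm_triangle_ineq[of A "z *\<^sub>C B"] by (simp add: norm_scaleC)
      also have "\<dots> \<le> s"
        unfolding s_def using that(2) by (auto intro!: mult_right_mono add_increasing2)
      finally have "cmod t * norm (A + z *\<^sub>C B) \<le> r * s"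
        using that(1) r by (intro mult_mono) auto
      then show ?thesis using s by (simp add: norm_scaleC r_def)
    qed
    \<comment> \<open>The ratio \<open>q = 1 / (N + 2)\<close> of \<open>cmod (\<tau> N)\<close> to
      \<open>r\<close> stays below 1, and \<open>q / (1 - q)\<close> becomes
      \<open>1 / (N + 1)\<close>.\<close>
    define \<tau> where "\<tau> = (\<lambda>N :: nat. complex_of_real (r / (real N + 2)))"
    have \<tau>: "cmod (\<tau> N) = r / (real N + 2)" "\<tau> N \<noteq> 0" "cmod (\<tau> N) < r" for N
    proof -
      show c: "cmod (\<tau> N) = r / (real N + 2)"
        unfolding \<tau>_def norm_of_real using r by simp
      then show "\<tau> N \<noteq> 0" using r by auto
      show "cmod (\<tau> N) < r" unfolding c using r by (simp add: field_simps add_pos_nonneg)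
    qed
    define g where "g = (\<lambda>N (z :: complex). (\<theta> (\<tau> N *\<^sub>C (A + z *\<^sub>C B))
      - (\<Sum>m<k. taylor_part \<theta> m (A + z *\<^sub>C B) * \<tau> N ^ m)) / \<tau> N ^ k)"
    have hg: "g N holomorphic_on cball 0 R" for N
    proof -
      have "(\<lambda>z. \<theta> (\<tau> N *\<^sub>C A + z *\<^sub>C (\<tau> N *\<^sub>C B))) holomorphic_on cball 0 R"
      proof (rule holomorphic_on_line[OF holo])
        fix z :: complex assume "z \<in> cball 0 R"
        then have "norm (\<tau> N *\<^sub>C (A + z *\<^sub>C B)) \<le> \<rho>"
          using \<tau>(3)[of N] by (intro small) auto
        then show "\<tau> N *\<^sub>C A + z *\<^sub>C (\<tau> N *\<^sub>C B) \<in> U"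
          using \<rho>(2) by (simp add: scaleC_add_right scaleC_scaleC mult.commute)
      qed
      then have "(\<lambda>z. \<theta> (\<tau> N *\<^sub>C (A + z *\<^sub>C B))) holomorphic_on cball 0 R"
        by (simp add: scaleC_add_right scaleC_scaleC mult.commute)
      then show ?thesis
        unfolding g_def using less.IH \<tau>(2)
        by (intro holomorphic_intros) (auto intro: holomorphic_on_subset)
    qed
    have "uniform_limit (cball 0 R) g (\<lambda>z. taylor_part \<theta> k (A + z *\<^sub>C B)) sequentially"
    proof (rule uniform_limitI)
      fix e :: real assume e: "0 < e"
      have b: "cmod (g N z - taylor_part \<theta> k (A + z *\<^sub>C B)) \<le> M / r ^ k * (1 / (real N + 1))"
        if z: "z \<in> cball 0 R" for N and z :: complex
      proof -
        let ?X = "A + z *\<^sub>C B" and ?q = "1 / (real N + 2)"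
        have "cmod (\<theta> (\<tau> N *\<^sub>C ?X) - (\<Sum>m<Suc k. taylor_part \<theta> m ?X * \<tau> N ^ m))
            \<le> M * (cmod (\<tau> N) / r) ^ Suc k * (1 / (1 - cmod (\<tau> N) / r))"
          by (rule taylor_remainder[OF r _ _ \<tau>(3)]) (use small z \<rho>(2) in blast)+
        also have "cmod (\<tau> N) / r = ?q"
          using r by (simp add: \<tau>(1))
        also have "M * ?q ^ Suc k * (1 / (1 - ?q)) = M * ?q ^ k * (?q * (1 / (1 - ?q)))"
          by (simp only: power_Suc2 mult.assoc)
        also have "?q * (1 / (1 - ?q)) = 1 / (real N + 1)"
          by (simp add: field_simps)
        finally have 1: "cmod (\<theta> (\<tau> N *\<^sub>C ?X) - (\<Sum>m<Suc k. taylor_part \<theta> m ?X * \<tau> N ^ m))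
            \<le> M * ?q ^ k * (1 / (real N + 1))" .
        have "g N z - taylor_part \<theta> k ?X
            = (\<theta> (\<tau> N *\<^sub>C ?X) - (\<Sum>m<Suc k. taylor_part \<theta> m ?X * \<tau> N ^ m)) / \<tau> N ^ k"
          using \<tau>(2)[of N] by (simp add: g_def field_simps)
        then have "cmod (g N z - taylor_part \<theta> k ?X) \<le> M * ?q ^ k * (1 / (real N + 1)) / cmod (\<tau> N) ^ k"
          using divide_right_mono[OF 1, of "cmod (\<tau> N) ^ k"] by (simp add: norm_divide norm_power)
        also have "\<dots> = M / r ^ k * (1 / (real N + 1))"
          using r by (simp add: \<tau>(1) power_divide)
        finally show ?thesis .
      qed
      have "(\<lambda>N. M / r ^ k * (1 / (real N + 1))) \<longlonglongrightarrow> M / r ^ k * 0"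
        using LIMSEQ_inverse_real_of_nat
        by (intro tendsto_mult tendsto_const) (simp add: inverse_eq_divide add.commute)
      then have "\<forall>\<^sub>F N in sequentially. M / r ^ k * (1 / (real N + 1)) < e"
        using e by (intro order_tendstoD(2)) auto
      then show "\<forall>\<^sub>F N in sequentially. \<forall>z\<in>cball 0 R. dist (g N z) (taylor_part \<theta> k (A + z *\<^sub>C B)) < e"
      proof eventually_elim
        case (elim N)
        show ?case
          unfolding dist_norm using le_less_trans[OF b elim] by blast
      qed
    qed
    moreover have "\<forall>\<^sub>F N in sequentially. continuous_on (cball 0 R) (g N) \<and> g N holomorphic_on ball 0 R"
      using hg holomorphic_on_imp_continuous_on holomorphic_on_subset[OF _ ball_subset_cball]
      by (intro always_eventually) blast
    ultimately show ?thesis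
      using holomorphic_uniform_limit[OF _ _ sequentially_bot] by blast
  qed
  then have "(\<lambda>z. taylor_part \<theta> k (A + z *\<^sub>C B)) field_differentiable at z" for z
    by (rule holomorphic_on_imp_differentiable_at[OF _ open_ball, of _ _ "cmod z + 1"])
      (auto simp: add_nonneg_pos)
  then show ?case
    by (simp add: holomorphic_on_def)
qed

text \<open>An entire function that grows at most like \<open>cmod z ^ k\<close> is a polynomial of
  degree at most \<open>k\<close>.\<close>

lemma taylor_part_line_poly:
  obtains p where "degree p \<le> k" "\<And>z. taylor_part \<theta> k (A + z *\<^sub>C B) = poly p z"
proof -
  obtain C where C: "\<And>A. cmod (taylor_part \<theta> k A) \<le> C * (norm A + 1) ^ k"
    using taylor_part_growth by blast
  have "0 \<le> C * (norm (0 :: complex ^ 'n ^ 'n) + 1) ^ k"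
    using C[of 0] norm_ge_zero order_trans by blast
  then have C0: "0 \<le> C" by simp
  define f where "f = (\<lambda>z. taylor_part \<theta> k (A + z *\<^sub>C B))"
  have "cmod (f z) \<le> C * (norm A + norm B + 1) ^ k * cmod z ^ k" if "1 \<le> cmod z" for z
  proof -
    have "norm (A + z *\<^sub>C B) + 1 \<le> norm A + cmod z * norm B + 1"
      using norm_triangle_ineq[of A "z *\<^sub>C B"] by (simp add: norm_scaleC)
    also have "norm A \<le> norm A * cmod z"
      using mult_left_mono[OF that norm_ge_zero[of A]] by simp
    also have "norm A * cmod z + cmod z * norm B + 1 \<le> (norm A + norm B + 1) * cmod z"
      using that by (simp add: distrib_left mult.commute[of _ "cmod z"])
    finally have "C * (norm (A + z *\<^sub>C B) + 1) ^ k \<le> C * ((norm A + norm B + 1) * cmod z) ^ k"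
      using C0 by (intro mult_left_mono power_mono) auto
    then show ?thesis
      using C[of "A + z *\<^sub>C B"] by (simp add: f_def power_mult_distrib mult.assoc)
  qed
  then have f: "f z = (\<Sum>m\<le>k. (deriv ^^ m) f 0 / fact m * z ^ m)" for z
    by (rule Liouville_polynomial[rotated]) (simp_all add: f_def taylor_part_line_holomorphic)
  define p where "p = (\<Sum>m\<le>k. monom ((deriv ^^ m) f 0 / fact m) m)"
  have "degree p \<le> k"
    unfolding p_def by (intro degree_sum_le) (auto intro: order_trans[OF degree_monom_le])
  moreover have "f z = poly p z" for z
    by (subst f) (simp add: p_def poly_sum poly_monom)
  ultimately show thesis
    by (intro that[of p]) (simp_all add: f_def)
qed

end

text \<open>Interpolation in one matrix entry at a time. The common degree bound \<open>k\<close>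
  allows the same nodes 0, ..., \<open>k\<close> on all lines, and the values at the nodes depend on
  fewer entries.\<close>

lemma poly_fun_if_poly_on_lines:
  fixes v :: "complex ^ 'n ^ 'n \<Rightarrow> complex"
  assumes "\<And>A B. \<exists>p. degree p \<le> k \<and> (\<forall>z. v (A + z *\<^sub>C B) = poly p z)"
  shows "poly_fun v"
proof -
  define restr :: "('n \<times> 'n) set \<Rightarrow> complex ^ 'n ^ 'n \<Rightarrow> complex ^ 'n ^ 'n"
    where "restr = (\<lambda>S A. \<chi> i j. if (i, j) \<in> S then A $ i $ j else 0)"
  have "poly_fun (\<lambda>A. v (restr S A))"
    if "finite S" "\<And>A B. \<exists>p. degree p \<le> k \<and> (\<forall>z. v (A + z *\<^sub>C B) = poly p z)" for S v
    using that
  proof (induction S arbitrary: v rule: finite_induct)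
    case empty
    have "restr {} A = 0" for A by (simp add: restr_def vec_eq_iff)
    then show ?case by (simp add: pf_const)
  next
    case (insert q S)
    obtain a b where q: "q = (a, b)" by force
    let ?E = "matrix_unit a b"
    define T where "T = (of_nat :: nat \<Rightarrow> complex) ` {..k}"
    have T: "finite T" "card T = Suc k"
      by (simp_all add: T_def card_image inj_on_def)
    have split: "restr (insert q S) A = restr S A + A $ a $ b *\<^sub>C ?E" for A
      using insert.hyps(2) by (auto simp: vec_eq_iff restr_def matrix_unit_def q)
    have "v (X + z *\<^sub>C ?E) = (\<Sum>s\<in>T. v (X + s *\<^sub>C ?E) * poly (lagrange_poly T s) z)" for X z
    proof -
      obtain p where p: "degree p \<le> k" "\<And>z. v (X + z *\<^sub>C ?E) = poly p z"
        using insert.prems by blast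
      have "p = (\<Sum>s\<in>T. smult (poly p s) (lagrange_poly T s))"
        using p(1) T by (intro lagrange_interpolation) auto
      then have "poly p z = poly (\<Sum>s\<in>T. smult (poly p s) (lagrange_poly T s)) z"
        by (rule arg_cong)
      then show ?thesis by (simp add: p(2) poly_sum)
    qed
    then have eq: "v (restr (insert q S) A)
        = (\<Sum>s\<in>T. v (restr S A + s *\<^sub>C ?E) * poly (lagrange_poly T s) (A $ a $ b))" for A
      unfolding split .
    have pw: "poly_fun (\<lambda>A :: complex ^ 'n ^ 'n. poly P (A $ a $ b))" for P
      unfolding poly_altdef using hp_power[OF hp_nth] by (intro pf_sum pf_cmult pf_hom)
    show ?case
      unfolding eq
    proof (intro pf_sum pf_mult pw)
      fix s
      show "poly_fun (\<lambda>A. v (restr S A + s *\<^sub>C ?E))"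
      proof (rule insert.IH)
        fix A B
        obtain p where "degree p \<le> k" "\<And>z. v (A + s *\<^sub>C ?E + z *\<^sub>C B) = poly p z"
          using insert.prems by blast
        then show "\<exists>p. degree p \<le> k \<and> (\<forall>z. v (A + z *\<^sub>C B + s *\<^sub>C ?E) = poly p z)"
          by (intro exI[of _ p]) (simp add: ac_simps)
      qed
    qed
  qed
  from this[of UNIV v] assms show ?thesis by (simp add: restr_def)
qed

lemma poly_fun_decompose:
  "poly_fun P \<Longrightarrow> \<exists>D p. (\<forall>d. hom_poly (int d) (p d)) \<and> (\<forall>A. P A = (\<Sum>d<D. p d A)) \<and> (\<forall>d\<ge>D. p d = (\<lambda>_. 0))"
proof (induction rule: poly_fun.induct)
  case (pf_hom e P)
  show ?case
  proof (cases "e < 0")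
    case True
    then show ?thesis using hp_negative[OF pf_hom]
      by (intro exI[of _ 0] exI[of _ "\<lambda>_ _. 0"]) (auto intro: hp_zero)
  next
    case False
    then obtain d where d: "e = int d" by (metis nonneg_eq_int not_less)
    let ?p = "\<lambda>m. if m = d then P else (\<lambda>_. 0)"
    have "P A = (\<Sum>m<Suc d. ?p m A)" for A
    proof -
      have "(\<Sum>m<Suc d. ?p m A) = (\<Sum>m<Suc d. if m = d then P A else 0)"
        by (rule sum.cong) auto
      then show ?thesis by simp
    qed
    moreover have "hom_poly (int m) (?p m)" for m
      using pf_hom d by (auto intro: hp_zero)
    ultimately show ?thesis
      by (intro exI[of _ "Suc d"] exI[of _ ?p]) auto
  qed
next
  case (pf_add P Q)
  then obtain D p E q where
    p: "\<forall>d. hom_poly (int d) (p d)" "\<forall>A. P A = (\<Sum>d<D. p d A)" "\<forall>d\<ge>D. p d = (\<lambda>_. 0)" and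
    q: "\<forall>d. hom_poly (int d) (q d)" "\<forall>A. Q A = (\<Sum>d<E. q d A)" "\<forall>d\<ge>E. q d = (\<lambda>_. 0)"
    by blast
  let ?N = "max D E"
  have "P A = (\<Sum>d<?N. p d A)" "Q A = (\<Sum>d<?N. q d A)" for A
    unfolding p(2)[rule_format] q(2)[rule_format]
    by (rule sum.mono_neutral_left; use p(3) q(3) in auto)+
  then show ?case
    using p(1,3) q(1,3)
    by (intro exI[of _ ?N] exI[of _ "\<lambda>d A. p d A + q d A"]) (auto simp: sum.distrib intro: hp_add)
qed

text \<open>Compare the coefficients of \<open>s ^ k\<close> in \<open>P (s *\<^sub>C A)\<close>,
  once for \<open>P\<close> and once for its decomposition into homogeneous parts.\<close>

lemma hom_poly_if_homogeneous:
  assumes "poly_fun P" and hom: "\<And>s A. P (s *\<^sub>C A) = s ^ k * P A"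
  shows "hom_poly (int k) P"
proof -
  obtain D p where p: "\<forall>d. hom_poly (int d) (p d)" "\<forall>A. P A = (\<Sum>d<D. p d A)" "\<forall>d\<ge>D. p d = (\<lambda>_. 0)"
    using poly_fun_decompose[OF assms(1)] by blast
  have "P A = p k A" for A
  proof -
    have "poly (\<Sum>d<D. monom (p d A) d) s = poly (monom (P A) k) s" for s
    proof -
      have "poly (\<Sum>d<D. monom (p d A) d) s = (\<Sum>d<D. p d (s *\<^sub>C A))"
        using hp_homogeneous[OF p(1)[rule_format]] by (simp add: poly_sum poly_monom mult.commute)
      also have "\<dots> = poly (monom (P A) k) s"
        using hom[of s A] p(2) by (simp add: poly_monom mult.commute)
      finally show ?thesis .
    qed
    then have "(\<Sum>d<D. monom (p d A) d) = monom (P A) k"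
      by (intro poly_ext)
    then have "coeff (\<Sum>d<D. monom (p d A) d) k = P A" by simp
    moreover have "coeff (\<Sum>d<D. monom (p d A) d) k = (if k < D then p k A else 0)"
      by (simp add: coeff_sum)
    ultimately show ?thesis using p(3) by (auto split: if_splits)
  qed
  then have "P = p k" by (rule ext)
  then show ?thesis using p(1) by simp
qed

lemma (in balanced_holomorphic) hom_poly_taylor_part: "hom_poly (int k) (taylor_part \<theta> k)"
proof (rule hom_poly_if_homogeneous)
  show "poly_fun (taylor_part \<theta> k)"
    by (rule poly_fun_if_poly_on_lines[of k]) (metis taylor_part_line_poly)
qed (rule taylor_part_homogeneous)

section \<open>The homogeneous parts of a vertical field\<close>

lemma zero_in_spectral_ball: "(0 :: complex ^ 'n ^ 'n) \<in> spectral_ball"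
  by (simp add: spectral_ball_iff_det)

lemma spectral_ball_scaleC:
  assumes "A \<in> spectral_ball" "cmod t \<le> 1"
  shows "t *\<^sub>C A \<in> spectral_ball"
  unfolding spectral_ball_iff_det
proof
  fix \<mu> :: complex assume "\<mu> \<in> cball 0 1"
  then have "\<mu> * t \<in> cball 0 1"
    using assms(2) by (simp add: norm_mult mult_le_one)
  then show "det (mat 1 - \<mu> *\<^sub>C t *\<^sub>C A) \<noteq> 0"
    using assms(1) by (simp add: spectral_ball_iff_det scaleC_scaleC)
qed

lemma mat_pow_scaleC: "mat_pow (t *\<^sub>C A) j = t ^ j *\<^sub>C mat_pow A j"
  by (induction j) (simp_all add: scaleC_scaleC mult.commute)

definition taylor_field :: "(complex ^ 'n ^ 'n \<Rightarrow> complex ^ 'n ^ 'n) \<Rightarrow> nat \<Rightarrow> complex ^ 'n ^ 'n \<Rightarrow> complex ^ 'n ^ 'n"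
  where "taylor_field \<Theta> k A = (\<chi> i j. taylor_part (\<lambda>A. \<Theta> A $ i $ j) k A)"

lemma holomorphic_map_on_nth:
  fixes f :: "'a::complex_normed_space \<Rightarrow> 'b::complex_normed_space ^ 'm"
  assumes "holomorphic_map_on f U"
  shows "holomorphic_map_on (\<lambda>x. f x $ i) U"
  unfolding holomorphic_map_on_def
proof
  fix x assume "x \<in> U"
  then obtain D where D: "(f has_derivative D) (at x)" "complex_linear_map D"
    using assms by (auto simp: holomorphic_map_on_def)
  have "((\<lambda>x. f x $ i) has_derivative (\<lambda>h. D h $ i)) (at x)"
    by (rule bounded_linear.has_derivative[OF bounded_linear_vec_nth D(1)])
  moreover have "complex_linear_map (\<lambda>h. D h $ i)"
    using D(2) by (simp add: complex_linear_map_def)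
  ultimately show "\<exists>D. ((\<lambda>x. f x $ i) has_derivative D) (at x) \<and> complex_linear_map D" by blast
qed

lemma holomorphic_map_on_continuous: "holomorphic_map_on f U \<Longrightarrow> continuous_on U f"
  unfolding holomorphic_map_on_def
  by (meson continuous_at_imp_continuous_on has_derivative_continuous)

text \<open>The value at 0 gives the constant term; any other nonzero coefficient would make the
  zero of \<open>f\<close> at 0 isolated.\<close>

lemma power_series_zero:
  fixes a :: "nat \<Rightarrow> complex"
  assumes r: "0 < r" and s: "\<And>t. cmod t < r \<Longrightarrow> (\<lambda>k. a k * t ^ k) sums f t"
    and f: "\<And>t. cmod t < r \<Longrightarrow> t \<noteq> 0 \<Longrightarrow> f t = 0" and f0: "f 0 = 0"
  shows "a k = 0"
proof (cases "k = 0")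
  case True
  have "(\<lambda>k. a k * 0 ^ k) sums a 0" by (rule powser_sums_zero)
  with s[of 0] r f0 have "a 0 = 0" using sums_unique2 by fastforce
  then show ?thesis using True by simp
next
  case False
  show ?thesis
  proof (rule ccontr)
    assume "a k \<noteq> 0"
    then obtain \<rho> where \<rho>: "0 < \<rho>" "\<And>z. z \<in> cball 0 \<rho> - {0} \<Longrightarrow> f z \<noteq> 0"
      using powser_0_nonzero[of r 0 a f k] r s f0 False by auto
    define z where "z = complex_of_real (min \<rho> (r / 2))"
    have "cmod z \<le> \<rho>" "cmod z < r" "z \<noteq> 0"
      using r \<rho>(1) unfolding z_def norm_of_real by auto
    then show False using \<rho>(2)[of z] f[of z] by simp
  qed
qed

lemma tangent_trace_zero:
  assumes "\<Theta> \<in> vertical_fields U" "A \<in> U"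
  shows "trace (mat_pow A j ** \<Theta> A) = 0"
  using assms by (intro vertical_trace_zero) (simp add: tangent_holomorphic_fields_def)

lemma balanced_holomorphic_entry:
  assumes "holomorphic_map_on \<Theta> U" "open U" "0 \<in> U"
  shows "balanced_holomorphic (\<lambda>A. \<Theta> A $ i $ j) U"
  using assms by unfold_locales (auto intro: holomorphic_map_on_nth)

lemma hpm_taylor_field:
  assumes "holomorphic_map_on \<Theta> U" "open U" "0 \<in> U"
  shows "hom_poly_mat (int k) (taylor_field \<Theta> k)"
  using balanced_holomorphic.hom_poly_taylor_part[OF balanced_holomorphic_entry[OF assms]]
  by (simp add: hom_poly_mat_def taylor_field_def)

text \<open>Along the ray through \<open>A\<close> the function
  \<open>trace (A^j \<Theta>(t A))\<close> of \<open>t\<close> vanishes, and the claim concerns its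
  power series coefficients.\<close>

lemma taylor_field_trace_zero:
  fixes \<Theta> :: "('n::{finite,linorder}) cmatrix \<Rightarrow> 'n cmatrix"
  assumes T: "\<Theta> \<in> vertical_fields U" and U: "open U" "0 \<in> U"
  shows "trace (mat_pow A j ** taylor_field \<Theta> k A) = 0"
proof -
  have hol: "holomorphic_map_on \<Theta> U"
    using T by (simp add: tangent_holomorphic_fields_def)
  have "open {t. t *\<^sub>C A \<in> U}" using open_line[OF U(1), of 0 A] by simp
  moreover have "0 \<in> {t. t *\<^sub>C A \<in> U}" using U(2) by simp
  ultimately obtain r where r: "0 < r" "ball 0 r \<subseteq> {t. t *\<^sub>C A \<in> U}"
    by (rule openE)
  define a where "a = (\<lambda>k. trace (mat_pow A j ** taylor_field \<Theta> k A))"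
  define f where "f = (\<lambda>t. trace (mat_pow A j ** \<Theta> (t *\<^sub>C A)))"
  have s: "(\<lambda>k. a k * t ^ k) sums f t" if t: "cmod t < r" for t
  proof -
    have 1: "(\<lambda>k. taylor_part (\<lambda>A. \<Theta> A $ i $ l) k A * t ^ k) sums \<Theta> (t *\<^sub>C A) $ i $ l" for i l
      by (rule balanced_holomorphic.taylor_part_sums[OF balanced_holomorphic_entry[OF hol U] _ t])
        (use r(2) in auto)
    have "(\<lambda>k. \<Sum>i\<in>UNIV. \<Sum>l\<in>UNIV. mat_pow A j $ i $ l * (taylor_part (\<lambda>A. \<Theta> A $ l $ i) k A * t ^ k))
        sums (\<Sum>i\<in>UNIV. \<Sum>l\<in>UNIV. mat_pow A j $ i $ l * \<Theta> (t *\<^sub>C A) $ l $ i)"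
      by (intro sums_sum sums_mult 1)
    then show ?thesis
      by (simp add: a_def f_def trace_def matrix_matrix_mult_def taylor_field_def sum_distrib_right mult.assoc)
  qed
  \<comment> \<open>The trace condition at \<open>t A\<close> carries a factor \<open>t ^ j\<close>
    that can be divided out only for \<open>t \<noteq> 0\<close>; the value at 0 follows by
    continuity.\<close>
  have nz: "f t = 0" if t: "cmod t < r" "t \<noteq> 0" for t
  proof -
    have "trace (mat_pow (t *\<^sub>C A) j ** \<Theta> (t *\<^sub>C A)) = 0"
      by (rule tangent_trace_zero[OF T]) (use r(2) t in auto)
    then show ?thesis using t(2) by (simp add: mat_pow_scaleC f_def)
  qed
  have "f 0 = 0"
  proof -
    have "continuous_on (ball 0 r) f"
    proof -
      have "continuous_on (ball 0 r) (\<lambda>t. \<Theta> (t *\<^sub>C A))"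
        by (rule continuous_on_compose2[OF holomorphic_map_on_continuous[OF hol]])
          (use r(2) in \<open>auto intro!: continuous_intros\<close>)
      then show ?thesis
        unfolding f_def trace_def matrix_matrix_mult_def vec_lambda_beta
        by (intro continuous_intros)
    qed
    then have "(f \<longlongrightarrow> f 0) (at 0)"
      using r(1) by (metis at_within_open centre_in_ball continuous_on_def open_ball)
    moreover have "(f \<longlongrightarrow> 0) (at 0)"
      by (rule tendsto_eventually) (use r(1) nz in \<open>auto simp: eventually_at intro!: exI[of _ r]\<close>)
    ultimately show ?thesis using tendsto_unique[OF at_neq_bot[of "0::complex"]] by blast
  qed
  with power_series_zero[OF r(1) s nz] show ?thesis
    by (simp add: a_def)
qed

lemma tangent_zero: "(\<lambda>_. 0) \<in> vertical_fields U"
  using tangent_mcomm[OF hpm_zero, of U] by simp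

lemma tangent_add:
  fixes \<Theta> :: "('n::{finite,linorder}) cmatrix \<Rightarrow> 'n cmatrix"
  assumes "\<Theta> \<in> vertical_fields U"
    "\<Psi> \<in> vertical_fields U"
  shows "(\<lambda>A. \<Theta> A + \<Psi> A) \<in> vertical_fields U"
proof -
  have "holomorphic_map_on (\<lambda>A. \<Theta> A + \<Psi> A) U"
    unfolding holomorphic_map_on_def
  proof
    fix A assume "A \<in> U"
    have "holomorphic_map_on \<Theta> U" "holomorphic_map_on \<Psi> U"
      using assms by (simp_all add: tangent_holomorphic_fields_def)
    with \<open>A \<in> U\<close> obtain D E where DE: "(\<Theta> has_derivative D) (at A)" "complex_linear_map D"
      "(\<Psi> has_derivative E) (at A)" "complex_linear_map E"
      unfolding holomorphic_map_on_def by blast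
    have "((\<lambda>A. \<Theta> A + \<Psi> A) has_derivative (\<lambda>h. D h + E h)) (at A)"
      by (rule has_derivative_add[OF DE(1,3)])
    moreover have "complex_linear_map (\<lambda>h. D h + E h)"
      unfolding complex_linear_map_def
      by (simp add: complex_linear_mapD[OF DE(2)] complex_linear_mapD[OF DE(4)] scaleC_add_right)
    ultimately show "\<exists>D. ((\<lambda>A. \<Theta> A + \<Psi> A) has_derivative D) (at A) \<and> complex_linear_map D"
      by blast
  qed
  moreover have "frechet_derivative spectral_fibration (at A) (\<Theta> A + \<Psi> A) = 0" if "A \<in> U" for A
  proof -
    have "complex_linear_map (frechet_derivative spectral_fibration (at A))"
      using frechet_spectral_fibration[of A] by metis
    from complex_linear_mapD(1)[OF this] show ?thesis
      using assms that by (simp add: tangent_holomorphic_fields_def)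
  qed
  ultimately show ?thesis by (simp add: tangent_holomorphic_fields_def)
qed

lemma tangent_sum:
  "(\<And>i. i \<in> I \<Longrightarrow> \<Theta> i \<in> vertical_fields U) \<Longrightarrow>
    (\<lambda>A. \<Sum>i\<in>I. \<Theta> i A) \<in> vertical_fields U"
  by (induction I rule: infinite_finite_induct) (auto intro: tangent_zero tangent_add)

lemma taylor_sum_in_algebra:
  fixes \<Theta> :: "('n::{finite,linorder}) cmatrix \<Rightarrow> 'n cmatrix"
  assumes T: "\<Theta> \<in> vertical_fields U" and U: "open U" "0 \<in> U"
  shows "(\<lambda>A. \<Sum>k<N. taylor_field \<Theta> k A) \<in> vertical_algebra"
    "(\<lambda>A. \<Sum>k<N. taylor_field \<Theta> k A) \<in> vertical_fields V"
proof -
  have hol: "holomorphic_map_on \<Theta> U"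
    using T by (simp add: tangent_holomorphic_fields_def)
  have "taylor_field \<Theta> k \<in> vertical_algebra \<and> taylor_field \<Theta> k \<in> vertical_fields V" for k
  proof -
    obtain F where F: "hom_poly_mat (int k - 1) F" "\<And>A. taylor_field \<Theta> k A = mcomm A (F A)"
      using vertical_poly_is_mcomm[OF hpm_taylor_field[OF hol U] taylor_field_trace_zero[OF T U]] by blast
    then have "taylor_field \<Theta> k = (\<lambda>A. mcomm A (F A))" by (simp add: fun_eq_iff)
    then show ?thesis
      using mcomm_field_in_algebra[OF F(1)] tangent_mcomm[OF F(1)] by simp
  qed
  then show "(\<lambda>A. \<Sum>k<N. taylor_field \<Theta> k A) \<in> vertical_algebra"
    "(\<lambda>A. \<Sum>k<N. taylor_field \<Theta> k A) \<in> vertical_fields V"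
    by (auto intro: vertical_algebra_sum tangent_sum)
qed

section \<open>Uniform approximation on compact sets\<close>

lemma compact_scaleC_image:
  fixes K :: "(complex ^ 'n ^ 'n) set"
  assumes "compact S" "compact K"
  shows "compact ((\<lambda>(t, A). t *\<^sub>C A) ` (S \<times> K))"
proof (rule compact_continuous_image[OF _ compact_Times[OF assms]])
  show "continuous_on (S \<times> K) (\<lambda>(t, A). t *\<^sub>C A)"
    unfolding split_beta
    by (rule bounded_bilinear.continuous_on[OF bounded_bilinear_scaleC]) (intro continuous_intros)+
qed

text \<open>The multiples of \<open>K\<close> by the closed unit disc form a compact subset of the
  open ball and so have a margin. A radius above 1 is what makes the Taylor sums converge
  geometrically at \<open>t = 1\<close>.\<close>

lemma spectral_ball_enlarge:
  fixes K :: "(complex ^ 'n ^ 'n) set"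
  assumes K: "compact K" "K \<subseteq> spectral_ball"
  obtains r where "1 < r" "\<And>A t. A \<in> K \<Longrightarrow> cmod t \<le> r \<Longrightarrow> t *\<^sub>C A \<in> spectral_ball"
proof -
  let ?K = "(\<lambda>(t, A). t *\<^sub>C A) ` (cball (0::complex) 1 \<times> K)"
  have "compact ?K" by (rule compact_scaleC_image[OF compact_cball K(1)])
  moreover have "?K \<subseteq> spectral_ball"
  proof clarify
    fix t :: complex and A assume "t \<in> cball 0 1" "A \<in> K"
    then show "t *\<^sub>C A \<in> spectral_ball"
      using K(2) by (intro spectral_ball_scaleC) auto
  qed
  ultimately obtain \<epsilon> where \<epsilon>: "0 < \<epsilon>" "(\<Union>x\<in>?K. ball x \<epsilon>) \<subseteq> spectral_ball"
    using compact_subset_open_imp_ball_epsilon_subset[OF _ open_spectral_ball] by blast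
  obtain b where b: "0 < b" "\<And>A. A \<in> K \<Longrightarrow> norm A \<le> b"
    using compact_imp_bounded[OF K(1)] by (auto simp: bounded_pos)
  \<comment> \<open>Points then move by at most \<open>(r - 1) b\<close>, half of the margin
    \<open>\<epsilon>\<close>.\<close>
  define r where "r = 1 + \<epsilon> / (2 * b)"
  have r: "1 < r" using \<epsilon>(1) b(1) by (simp add: r_def)
  moreover have "t *\<^sub>C A \<in> spectral_ball" if A: "A \<in> K" and t: "cmod t \<le> r" for A t
  proof -
    let ?t = "t / of_real r"
    have t1: "cmod ?t \<le> 1" using t r by (simp add: norm_divide)
    have "dist (?t *\<^sub>C A) (t *\<^sub>C A) = cmod (?t * (1 - of_real r)) * norm A"
    proof -
      have "?t *\<^sub>C A - t *\<^sub>C A = (?t * (1 - of_real r)) *\<^sub>C A"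
        using r by (simp add: vec_eq_iff field_simps)
      then show ?thesis by (simp only: dist_norm norm_scaleC)
    qed
    also have "cmod (?t * (1 - of_real r)) = cmod ?t * (r - 1)"
    proof -
      have "1 - complex_of_real r = of_real (1 - r)" by simp
      then have "cmod (1 - complex_of_real r) = r - 1"
        using r by (simp only: norm_of_real)
      then show ?thesis by (simp only: norm_mult)
    qed
    also have "cmod ?t * (r - 1) * norm A \<le> 1 * (r - 1) * b"
      using t1 r b A by (intro mult_mono) auto
    also have "\<dots> < \<epsilon>"
      using \<epsilon>(1) b(1) by (simp add: r_def)
    finally have "t *\<^sub>C A \<in> ball (?t *\<^sub>C A) \<epsilon>" by simp
    moreover have "?t *\<^sub>C A \<in> ?K" using t1 A by (intro image_eqI[of _ _ "(?t, A)"]) auto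
    ultimately show ?thesis using \<epsilon>(2) by blast
  qed
  ultimately show thesis by (rule that)
qed

lemma taylor_sum_approximates:
  fixes \<Theta> :: "complex ^ 'n ^ 'n \<Rightarrow> complex ^ 'n ^ 'n"
  assumes hol: "holomorphic_map_on \<Theta> spectral_ball"
    and K: "compact K" "K \<subseteq> spectral_ball" and e: "0 < e"
  obtains N where "\<And>A. A \<in> K \<Longrightarrow> dist (\<Sum>k<N. taylor_field \<Theta> k A) (\<Theta> A) < e"
proof -
  obtain r where r: "1 < r" "\<And>A t. A \<in> K \<Longrightarrow> cmod t \<le> r \<Longrightarrow> t *\<^sub>C A \<in> spectral_ball"
    using spectral_ball_enlarge[OF K] by blast
  let ?K = "(\<lambda>(t, A). t *\<^sub>C A) ` (cball (0::complex) r \<times> K)"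
  have "?K \<subseteq> spectral_ball" using r(2) by auto
  then have "compact (\<Theta> ` ?K)"
    by (intro compact_continuous_image compact_scaleC_image K(1) compact_cball
        continuous_on_subset[OF holomorphic_map_on_continuous[OF hol]])
  then have "bounded (\<Theta> ` ?K)" by (rule compact_imp_bounded)
  then obtain M where M: "\<And>x. x \<in> ?K \<Longrightarrow> norm (\<Theta> x) \<le> M"
    unfolding bounded_iff by blast
  \<comment> \<open>The factor \<open>n * n\<close> comes from bounding the norm by the sum over all
    entries.\<close>
  define c where "c = (\<lambda>N. real (CARD('n)) * (real (CARD('n)) * (M * (1 / r) ^ N * (1 / (1 - 1 / r)))))"
  have "dist (\<Sum>k<N. taylor_field \<Theta> k A) (\<Theta> A) \<le> c N" if A: "A \<in> K" for A N
  proof -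
    have ent: "cmod (\<Theta> A $ i $ j - (\<Sum>k<N. taylor_part (\<lambda>A. \<Theta> A $ i $ j) k A)) \<le> M * (1 / r) ^ N * (1 / (1 - 1 / r))" for i j
    proof -
      have "cmod (\<Theta> (1 *\<^sub>C A) $ i $ j - (\<Sum>k<N. taylor_part (\<lambda>A. \<Theta> A $ i $ j) k A * 1 ^ k))
          \<le> M * (cmod 1 / r) ^ N * (1 / (1 - cmod 1 / r))"
      proof (rule balanced_holomorphic.taylor_remainder[OF balanced_holomorphic_entry[OF hol open_spectral_ball zero_in_spectral_ball]])
        fix t :: complex assume t: "t \<in> cball 0 r"
        then show "t *\<^sub>C A \<in> spectral_ball" using r(2) A by simp
        have "t *\<^sub>C A \<in> ?K" using t A by (intro image_eqI[of _ _ "(t, A)"]) auto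
        from M[OF this] show "cmod (\<Theta> (t *\<^sub>C A) $ i $ j) \<le> M"
          by (rule order_trans[OF order_trans[OF Finite_Cartesian_Product.norm_nth_le Finite_Cartesian_Product.norm_nth_le]])
      qed (use r in auto)
      then show ?thesis by simp
    qed
    have l1: "norm x \<le> (\<Sum>i\<in>UNIV. norm (x $ i))" for x :: "'b::real_normed_vector ^ 'n"
      by (simp add: norm_vec_def L2_set_le_sum)
    have "norm (\<Theta> A - (\<Sum>k<N. taylor_field \<Theta> k A))
        \<le> (\<Sum>i\<in>UNIV. \<Sum>j\<in>UNIV. cmod ((\<Theta> A - (\<Sum>k<N. taylor_field \<Theta> k A)) $ i $ j))"
      by (intro order_trans[OF l1] sum_mono l1)
    also have "\<dots> \<le> (\<Sum>i\<in>(UNIV :: 'n set). \<Sum>j\<in>(UNIV :: 'n set). M * (1 / r) ^ N * (1 / (1 - 1 / r)))"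
      using ent by (intro sum_mono) (simp add: taylor_field_def)
    also have "\<dots> = c N" by (simp add: c_def)
    finally show ?thesis by (simp add: dist_norm norm_minus_commute)
  qed
  moreover have "c \<longlonglongrightarrow> real (CARD('n)) * (real (CARD('n)) * (M * 0 * (1 / (1 - 1 / r))))"
    unfolding c_def using r(1) by (intro tendsto_mult tendsto_const LIMSEQ_power_zero) simp
  then have "\<forall>\<^sub>F N in sequentially. c N < e"
    using e by (intro order_tendstoD(2)) auto
  then obtain N where "c N < e"
    by (auto simp: eventually_sequentially)
  ultimately show thesis using that le_less_trans by blast
qed

lemma compact_open_neighbourhood:
  fixes X :: "'a::topological_space set" and \<Theta> :: "'a \<Rightarrow> 'b::metric_space"
  assumes "openin (compact_open_topology X) W" "\<Theta> \<in> W"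
  obtains K e where "compact K" "K \<subseteq> X" "0 < e"
    "\<And>\<Psi>. continuous_on X \<Psi> \<Longrightarrow> (\<And>x. x \<in> K \<Longrightarrow> dist (\<Psi> x) (\<Theta> x) < e) \<Longrightarrow> \<Psi> \<in> W"
proof -
  have "\<exists>K e. compact K \<and> K \<subseteq> X \<and> 0 < e \<and>
      (\<forall>\<Psi>. continuous_on X \<Psi> \<longrightarrow> (\<forall>x\<in>K. dist (\<Psi> x) (\<Theta> x) < e) \<longrightarrow> \<Psi> \<in> W)"
    using assms unfolding compact_open_topology_def openin_topology_generated_by_iff
  proof (induction rule: generate_topology_on.induct)
    case (Int a b)
    then obtain K e L d where "compact K" "K \<subseteq> X" "0 < e"
      "\<forall>\<Psi>. continuous_on X \<Psi> \<longrightarrow> (\<forall>x\<in>K. dist (\<Psi> x) (\<Theta> x) < e) \<longrightarrow> \<Psi> \<in> a"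
      "compact L" "L \<subseteq> X" "0 < d"
      "\<forall>\<Psi>. continuous_on X \<Psi> \<longrightarrow> (\<forall>x\<in>L. dist (\<Psi> x) (\<Theta> x) < d) \<longrightarrow> \<Psi> \<in> b"
      by auto
    then show ?case
      by (intro exI[of _ "K \<union> L"] exI[of _ "min e d"]) (auto simp: compact_Un)
  next
    case (UN \<K>)
    then obtain k where k: "k \<in> \<K>" "\<Theta> \<in> k" by auto
    then obtain K e where "compact K" "K \<subseteq> X" "0 < e"
      "\<forall>\<Psi>. continuous_on X \<Psi> \<longrightarrow> (\<forall>x\<in>K. dist (\<Psi> x) (\<Theta> x) < e) \<longrightarrow> \<Psi> \<in> k"
      using UN.IH by meson
    then show ?case using k(1) by blast
  next
    case (Basis s)
    then obtain K V where s: "s = {f. continuous_on X f \<and> f ` K \<subseteq> V}" "compact K" "K \<subseteq> X" "open V"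
      by blast
    then have "compact (\<Theta> ` K)" "\<Theta> ` K \<subseteq> V"
      using Basis.prems by (auto intro: compact_continuous_image continuous_on_subset)
    then obtain e where e: "0 < e" "(\<Union>x\<in>\<Theta> ` K. ball x e) \<subseteq> V"
      using compact_subset_open_imp_ball_epsilon_subset[OF _ s(4)] by blast
    have "\<Psi> \<in> s" if "continuous_on X \<Psi>" "\<forall>x\<in>K. dist (\<Psi> x) (\<Theta> x) < e" for \<Psi>
      using that e(2) by (auto simp: s(1) dist_commute subset_eq)
    then show ?case using s(2,3) e(1) by blast
  qed simp
  then obtain K e where "compact K" "K \<subseteq> X" "0 < e"
    and W: "\<forall>\<Psi>. continuous_on X \<Psi> \<longrightarrow> (\<forall>x\<in>K. dist (\<Psi> x) (\<Theta> x) < e) \<longrightarrow> \<Psi> \<in> W"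
    by blast
  from this(1-3) show thesis
    by (rule that) (use W in simp)
qed

theorem corollary4p7:
  shows "fibred_density_property spectral_fibration
    (spectral_ball :: (complex ^ ('n::{finite,linorder}) ^ ('n::{finite,linorder})) set)
    (symmetrized_polydisc :: (complex ^ ('n::{finite,linorder})) set)"
  unfolding fibred_density_property_def
proof
  let ?X = "spectral_ball :: (complex ^ ('n::{finite,linorder}) ^ ('n::{finite,linorder})) set"
  let ?T = "vertical_fields ?X"
  show "holomorphic_fibration spectral_fibration ?X symmetrized_polydisc"
    by (simp add: holomorphic_fibration_def open_spectral_ball open_symmetrized_polydisc
        holomorphic_spectral_fibration spectral_fibration_image)
  have cont: "continuous_on ?X \<Theta>" if "\<Theta> \<in> ?T" for \<Theta>
    using that by (intro holomorphic_map_on_continuous) (simp add: tangent_holomorphic_fields_def)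
  show "subtopology (compact_open_topology ?X) ?T closure_of vertical_algebra = ?T"
  proof
    show "subtopology (compact_open_topology ?X) ?T closure_of vertical_algebra \<subseteq> ?T"
      by (rule closure_of_subset_subtopology)
    show "?T \<subseteq> subtopology (compact_open_topology ?X) ?T closure_of vertical_algebra"
    proof
      fix \<Theta> assume T: "\<Theta> \<in> ?T"
      \<comment> \<open>The subbasic set with \<open>K = {}\<close> contains every continuous
        map.\<close>
      have top: "\<Theta> \<in> topspace (compact_open_topology ?X)"
        unfolding compact_open_topology_def topology_generated_by_topspace
        using cont[OF T] by (intro UnionI[of "{f. continuous_on ?X f \<and> f ` {} \<subseteq> UNIV}"]) auto
      have "\<exists>\<Psi>. \<Psi> \<in> vertical_algebra \<and> \<Psi> \<in> V"
        if V: "\<Theta> \<in> V" "openin (subtopology (compact_open_topology ?X) ?T) V" for V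
      proof -
        obtain W where W: "openin (compact_open_topology ?X) W" "V = W \<inter> ?T"
          using V(2) by (auto simp: openin_subtopology)
        then have "\<Theta> \<in> W" using V(1) by simp
        from compact_open_neighbourhood[OF W(1) this] obtain K e where K: "compact K" "K \<subseteq> ?X" "0 < e"
          "\<And>\<Psi>. continuous_on ?X \<Psi> \<Longrightarrow> (\<And>x. x \<in> K \<Longrightarrow> dist (\<Psi> x) (\<Theta> x) < e) \<Longrightarrow> \<Psi> \<in> W"
          by metis
        have "holomorphic_map_on \<Theta> ?X"
          using T by (simp add: tangent_holomorphic_fields_def)
        then obtain N where N: "\<And>A. A \<in> K \<Longrightarrow> dist (\<Sum>k<N. taylor_field \<Theta> k A) (\<Theta> A) < e"
          using taylor_sum_approximates[OF _ K(1-3)] by blast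
        let ?P = "\<lambda>A. \<Sum>k<N. taylor_field \<Theta> k A"
        have P: "?P \<in> vertical_algebra" "?P \<in> ?T"
          by (rule taylor_sum_in_algebra[OF T open_spectral_ball zero_in_spectral_ball])+
        then have "?P \<in> V"
          using K(4)[OF cont[OF P(2)]] N W(2) by blast
        with P(1) show ?thesis by blast
      qed
      with top T show "\<Theta> \<in> subtopology (compact_open_topology ?X) ?T closure_of vertical_algebra"
        by (auto simp: in_closure_of)
    qed
  qed
qed

end
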